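(* Let $\Sigma$ be a finite alphabet and let $L\subseteq\Sigma^\omega$ be a language which is not $\omega$-regular and which has a neutral letter. Then MSO$+$U $\subseteq$ MSO$+L$, i.e. every language of $\omega$-words (over any finite alphabet) that is definable in the logic MSO$+$U is definable in the logic MSO$+L$.
   Context: An $\omega$-word over a finite alphabet $\Sigma$ is a function $\omega\to\Sigma$; $\Sigma^\omega$ is the set of all $\omega$-words, $\Sigma^*$ the set of all finite words (including the empty one). MSO denotes monadic second-order logic over the structure $(\omega,<)$: it has first-order variables ranging over elements of $\omega$, set variables ranging over arbitrary subsets of $\omega$, quantification over both, Boolean connectives, and atomic formulas $x<y$, $x=y$, $x\in X$. MSO$+L$: let $\Sigma=\{a_1,\dots,a_k\}$ and $L\subseteq\Sigma^\omega$. The logic MSO$+L$ extends MSO by one additional $k$-ary predicate $L(X_1,\dots,X_k)$ on subsets of $\omega$, which is true if and only if $X_1,\dots,X_k$ form a partition of $\omega$ (blocks may be empty) and the $\omega$-word whose $n$-th letter is $a_i$ exactly when $n\in X_i$ belongs to $L$. MSO$+$U: the extension of MSO by the bounding quantifier $\mathsf U X\,\varphi(X)$, which says that $\varphi(X)$ is true for finite sets $X$ of unbounded size (for every $n\in\mathbb N$ there is a finite set $X\subseteq\omega$ with $|X|\ge n$ such that $\varphi(X)$ holds). It is known that this logic has the same expressive power as the extension of MSO, in the sense of MSO$+L$ above, by the language $U=\{a^{k_1}ba^{k_2}b\cdots : \limsup k_n=\infty\}\subseteq\{a,b\}^\omega$, so MSO$+$U may be read either way. Definability: a language $K\subseteq\Gamma^\omega$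 with $\Gamma=\{c_1,\dots,c_m\}$ is definable in one of these logics if there is a formula $\varphi(Y_1,\dots,Y_m)$ of the logic such that for every $w\in\Gamma^\omega$, $w\in K$ if and only if $\varphi$ is true in $(\omega,<)$ when each $Y_i$ is interpreted as the set of positions of $w$ with label $c_i$. The languages definable in MSO are exactly the $\omega$-regular languages. Neutral letter: $L\subseteq\Sigma^\omega$ has a neutral letter if there is a letter $1\in\Sigma$ such that for all finite words $w_1,w_2,\ldots\in\Sigma^*$ of which infinitely many are nonempty, $$w_1 1 w_2 1 w_3 1\cdots\in L \iff w_1w_2w_3\cdots\in L .$$ *)

theory Defs
  imports "HOL-Library.Omega_Words_Fun"
begin

text \<open>
  An alphabet is an explicit finite set of letters of an arbitrary type, and
  \<open>\<omega>\<close>-words are functions on \<open>nat\<close>, as in \<^theory>\<open>HOL-Library.Omega_Words_Fun\<close>.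
\<close>

definition omega_words :: "'a set \<Rightarrow> 'a word set" where
  "omega_words \<Sigma> = {w. range w \<subseteq> \<Sigma>}"

section \<open>Regular languages and neutral letters\<close>

text \<open>
  \<open>\<omega>\<close>-regularity is recognisability by a finite nondeterministic Buechi automaton; taking the
  states to be natural numbers loses nothing.
\<close>

definition buchi_accepts ::
  "nat set \<Rightarrow> (nat \<times> 'a \<times> nat) set \<Rightarrow> nat set \<Rightarrow> 'a word \<Rightarrow> bool" where
  "buchi_accepts I \<Delta> F w \<longleftrightarrow>
     (\<exists>r :: nat word. r 0 \<in> I \<and> (\<forall>n. (r n, w n, r (Suc n)) \<in> \<Delta>) \<and> limit r \<inter> F \<noteq> {})"

definition omega_regular :: "'a set \<Rightarrow> 'a word set \<Rightarrow> bool" where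
  "omega_regular \<Sigma> L \<longleftrightarrow>
     (\<exists>Q I \<Delta> F. finite Q \<and> I \<subseteq> Q \<and> \<Delta> \<subseteq> Q \<times> \<Sigma> \<times> Q \<and> F \<subseteq> Q \<and>
        L = {w \<in> omega_words \<Sigma>. buchi_accepts I \<Delta> F w})"

text \<open>
  The infinite concatenation \<open>u 0 @ u 1 @ \<dots>\<close>. It is meaningful only if infinitely many of the
  words \<open>u i\<close> are nonempty; otherwise the \<open>LEAST\<close> may range over an empty set.
\<close>

definition omega_concat :: "(nat \<Rightarrow> 'a list) \<Rightarrow> 'a word" where
  "omega_concat u n =
     concat (map u [0..<(LEAST k. n < length (concat (map u [0..<k])))]) ! n"

lemma nth_concat_prefix:
  assumes "k \<le> l" "n < length (concat (map u [0..<k]))"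
  shows "concat (map u [0..<l]) ! n = concat (map u [0..<k]) ! n"
proof -
  have "[0..<l] = [0..<k] @ [k..<l]"
    using assms(1) by (metis le0 le_add_diff_inverse upt_add_eq_append)
  then show ?thesis using assms(2) by (simp add: nth_append)
qed

lemma prefix_omega_concat:
  "prefix (length (concat (map u [0..<k]))) (omega_concat u) = concat (map u [0..<k])"
proof (rule nth_equalityI)
  fix n assume "n < length (prefix (length (concat (map u [0..<k]))) (omega_concat u))"
  then have n: "n < length (concat (map u [0..<k]))" by (simp add: subsequence_def)
  let ?P = "\<lambda>k. n < length (concat (map u [0..<k]))"
  have "?P (LEAST k. ?P k)" using n by (rule LeastI)
  moreover have "(LEAST k. ?P k) \<le> k" using n by (rule Least_le)
  ultimately have "omega_concat u n = concat (map u [0..<k]) ! n"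
    unfolding omega_concat_def by (metis nth_concat_prefix)
  then show "prefix (length (concat (map u [0..<k]))) (omega_concat u) ! n
      = concat (map u [0..<k]) ! n"
    using n by (simp add: subsequence_def)
qed (simp add: subsequence_def)

definition is_neutral_letter :: "'a set \<Rightarrow> 'a word set \<Rightarrow> 'a \<Rightarrow> bool" where
  "is_neutral_letter \<Sigma> L e \<longleftrightarrow> e \<in> \<Sigma> \<and>
     (\<forall>u :: nat \<Rightarrow> 'a list. (\<forall>i. set (u i) \<subseteq> \<Sigma>) \<longrightarrow> infinite {i. u i \<noteq> []} \<longrightarrow>
        (omega_concat (\<lambda>i. u i @ [e]) \<in> L \<longleftrightarrow> omega_concat u \<in> L))"

definition has_neutral_letter :: "'a set \<Rightarrow> 'a word set \<Rightarrow> bool" where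
  "has_neutral_letter \<Sigma> L \<longleftrightarrow> (\<exists>e. is_neutral_letter \<Sigma> L e)"

section \<open>Monadic second-order logic and its extensions\<close>

text \<open>
  One syntax covers both extensions of MSO; MSO\<open>+L\<close> and MSO\<open>+\<close>U are the fragments without
  \<open>Bounding\<close> and without \<open>Lang\<close>, respectively. First-order and set variables are two separate
  copies of \<open>nat\<close>. The atom \<open>Lang v\<close> is \<open>L(X\<^sub>1,\<dots>,X\<^sub>k)\<close>, whose argument positions are indexed by
  the letters of \<open>\<Sigma>\<close> instead of \<open>1,\<dots>,k\<close>: \<open>v a\<close> is the set variable in the position of letter
  \<open>a\<close>, and values of \<open>v\<close> outside \<open>\<Sigma>\<close> play no role.
\<close>

datatype 'a formula =
    Less nat nat
  | Equal nat nat
  | Member nat nat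
  | Neg "'a formula"
  | Conj "'a formula" "'a formula"
  | Disj "'a formula" "'a formula"
  | Ex_elem nat "'a formula"
  | All_elem nat "'a formula"
  | Ex_set nat "'a formula"
  | All_set nat "'a formula"
  | Lang "'a \<Rightarrow> nat"
  | Bounding nat "'a formula"

definition lang_predicate :: "'a set \<Rightarrow> 'a word set \<Rightarrow> ('a \<Rightarrow> nat set) \<Rightarrow> bool" where
  "lang_predicate \<Sigma> L X \<longleftrightarrow>
     (\<Union>a\<in>\<Sigma>. X a) = UNIV \<and>
     (\<forall>a\<in>\<Sigma>. \<forall>b\<in>\<Sigma>. a \<noteq> b \<longrightarrow> X a \<inter> X b = {}) \<and>
     (\<exists>w \<in> omega_words \<Sigma> \<inter> L. \<forall>n. \<forall>a\<in>\<Sigma>. w n = a \<longleftrightarrow> n \<in> X a)"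

text \<open>\<open>s\<close> and \<open>S\<close> assign values to the first-order and set variables.\<close>

primrec sat ::
  "'a set \<Rightarrow> 'a word set \<Rightarrow> (nat \<Rightarrow> nat) \<Rightarrow> (nat \<Rightarrow> nat set) \<Rightarrow> 'a formula \<Rightarrow> bool" where
  "sat \<Sigma> L s S (Less x y) \<longleftrightarrow> s x < s y"
| "sat \<Sigma> L s S (Equal x y) \<longleftrightarrow> s x = s y"
| "sat \<Sigma> L s S (Member x X) \<longleftrightarrow> s x \<in> S X"
| "sat \<Sigma> L s S (Neg \<phi>) \<longleftrightarrow> \<not> sat \<Sigma> L s S \<phi>"
| "sat \<Sigma> L s S (Conj \<phi> \<psi>) \<longleftrightarrow> sat \<Sigma> L s S \<phi> \<and> sat \<Sigma> L s S \<psi>"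
| "sat \<Sigma> L s S (Disj \<phi> \<psi>) \<longleftrightarrow> sat \<Sigma> L s S \<phi> \<or> sat \<Sigma> L s S \<psi>"
| "sat \<Sigma> L s S (Ex_elem x \<phi>) \<longleftrightarrow> (\<exists>n. sat \<Sigma> L (s(x := n)) S \<phi>)"
| "sat \<Sigma> L s S (All_elem x \<phi>) \<longleftrightarrow> (\<forall>n. sat \<Sigma> L (s(x := n)) S \<phi>)"
| "sat \<Sigma> L s S (Ex_set X \<phi>) \<longleftrightarrow> (\<exists>A. sat \<Sigma> L s (S(X := A)) \<phi>)"
| "sat \<Sigma> L s S (All_set X \<phi>) \<longleftrightarrow> (\<forall>A. sat \<Sigma> L s (S(X := A)) \<phi>)"
| "sat \<Sigma> L s S (Lang v) \<longleftrightarrow> lang_predicate \<Sigma> L (\<lambda>a. S (v a))"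
| "sat \<Sigma> L s S (Bounding X \<phi>) \<longleftrightarrow>
     (\<forall>n. \<exists>A. finite A \<and> n \<le> card A \<and> sat \<Sigma> L s (S(X := A)) \<phi>)"

primrec free_elems :: "'a formula \<Rightarrow> nat set" where
  "free_elems (Less x y) = {x, y}"
| "free_elems (Equal x y) = {x, y}"
| "free_elems (Member x X) = {x}"
| "free_elems (Neg \<phi>) = free_elems \<phi>"
| "free_elems (Conj \<phi> \<psi>) = free_elems \<phi> \<union> free_elems \<psi>"
| "free_elems (Disj \<phi> \<psi>) = free_elems \<phi> \<union> free_elems \<psi>"
| "free_elems (Ex_elem x \<phi>) = free_elems \<phi> - {x}"
| "free_elems (All_elem x \<phi>) = free_elems \<phi> - {x}"
| "free_elems (Ex_set X \<phi>) = free_elems \<phi>"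
| "free_elems (All_set X \<phi>) = free_elems \<phi>"
| "free_elems (Lang v) = {}"
| "free_elems (Bounding X \<phi>) = free_elems \<phi>"

primrec free_sets :: "'a set \<Rightarrow> 'a formula \<Rightarrow> nat set" where
  "free_sets \<Sigma> (Less x y) = {}"
| "free_sets \<Sigma> (Equal x y) = {}"
| "free_sets \<Sigma> (Member x X) = {X}"
| "free_sets \<Sigma> (Neg \<phi>) = free_sets \<Sigma> \<phi>"
| "free_sets \<Sigma> (Conj \<phi> \<psi>) = free_sets \<Sigma> \<phi> \<union> free_sets \<Sigma> \<psi>"
| "free_sets \<Sigma> (Disj \<phi> \<psi>) = free_sets \<Sigma> \<phi> \<union> free_sets \<Sigma> \<psi>"
| "free_sets \<Sigma> (Ex_elem x \<phi>) = free_sets \<Sigma> \<phi>"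
| "free_sets \<Sigma> (All_elem x \<phi>) = free_sets \<Sigma> \<phi>"
| "free_sets \<Sigma> (Ex_set X \<phi>) = free_sets \<Sigma> \<phi> - {X}"
| "free_sets \<Sigma> (All_set X \<phi>) = free_sets \<Sigma> \<phi> - {X}"
| "free_sets \<Sigma> (Lang v) = v ` \<Sigma>"
| "free_sets \<Sigma> (Bounding X \<phi>) = free_sets \<Sigma> \<phi> - {X}"

primrec lang_free :: "'a formula \<Rightarrow> bool" where
  "lang_free (Less x y) \<longleftrightarrow> True"
| "lang_free (Equal x y) \<longleftrightarrow> True"
| "lang_free (Member x X) \<longleftrightarrow> True"
| "lang_free (Neg \<phi>) \<longleftrightarrow> lang_free \<phi>"
| "lang_free (Conj \<phi> \<psi>) \<longleftrightarrow> lang_free \<phi> \<and> lang_free \<psi>"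
| "lang_free (Disj \<phi> \<psi>) \<longleftrightarrow> lang_free \<phi> \<and> lang_free \<psi>"
| "lang_free (Ex_elem x \<phi>) \<longleftrightarrow> lang_free \<phi>"
| "lang_free (All_elem x \<phi>) \<longleftrightarrow> lang_free \<phi>"
| "lang_free (Ex_set X \<phi>) \<longleftrightarrow> lang_free \<phi>"
| "lang_free (All_set X \<phi>) \<longleftrightarrow> lang_free \<phi>"
| "lang_free (Lang v) \<longleftrightarrow> False"
| "lang_free (Bounding X \<phi>) \<longleftrightarrow> lang_free \<phi>"

primrec bounding_free :: "'a formula \<Rightarrow> bool" where
  "bounding_free (Less x y) \<longleftrightarrow> True"
| "bounding_free (Equal x y) \<longleftrightarrow> True"
| "bounding_free (Member x X) \<longleftrightarrow> True"
| "bounding_free (Neg \<phi>) \<longleftrightarrow> bounding_free \<phi>"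
| "bounding_free (Conj \<phi> \<psi>) \<longleftrightarrow> bounding_free \<phi> \<and> bounding_free \<psi>"
| "bounding_free (Disj \<phi> \<psi>) \<longleftrightarrow> bounding_free \<phi> \<and> bounding_free \<psi>"
| "bounding_free (Ex_elem x \<phi>) \<longleftrightarrow> bounding_free \<phi>"
| "bounding_free (All_elem x \<phi>) \<longleftrightarrow> bounding_free \<phi>"
| "bounding_free (Ex_set X \<phi>) \<longleftrightarrow> bounding_free \<phi>"
| "bounding_free (All_set X \<phi>) \<longleftrightarrow> bounding_free \<phi>"
| "bounding_free (Lang v) \<longleftrightarrow> True"
| "bounding_free (Bounding X \<phi>) \<longleftrightarrow> False"

text \<open>
  The variable \<open>Y c\<close> stands for the set of positions labelled \<open>c\<close>. As no other variables are free
  in \<open>\<phi>\<close>, quantifying over all assignments \<open>s\<close>, \<open>S\<close> that are correct on the \<open>Y c\<close> is only a way of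
  leaving the irrelevant values unspecified.
\<close>

definition defines_language ::
  "'a set \<Rightarrow> 'a word set \<Rightarrow> 'a formula \<Rightarrow> ('c \<Rightarrow> nat) \<Rightarrow> 'c set \<Rightarrow> 'c word set \<Rightarrow> bool" where
  "defines_language \<Sigma> L \<phi> Y \<Gamma> K \<longleftrightarrow>
     inj_on Y \<Gamma> \<and> free_elems \<phi> = {} \<and> free_sets \<Sigma> \<phi> \<subseteq> Y ` \<Gamma> \<and>
     (\<forall>w \<in> omega_words \<Gamma>. \<forall>s S. (\<forall>c\<in>\<Gamma>. S (Y c) = {n. w n = c}) \<longrightarrow>
        (w \<in> K \<longleftrightarrow> sat \<Sigma> L s S \<phi>))"

definition MSO_L_definable ::
  "'a set \<Rightarrow> 'a word set \<Rightarrow> 'c set \<Rightarrow> 'c word set \<Rightarrow> bool" where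
  "MSO_L_definable \<Sigma> L \<Gamma> K \<longleftrightarrow>
     (\<exists>\<phi> Y. bounding_free \<phi> \<and> defines_language \<Sigma> L \<phi> Y \<Gamma> K)"

text \<open>
  The first two arguments of \<^const>\<open>defines_language\<close> do not matter for formulas without \<open>Lang\<close>;
  they are dummies here.
\<close>

definition MSO_U_definable :: "'c set \<Rightarrow> 'c word set \<Rightarrow> bool" where
  "MSO_U_definable \<Gamma> K \<longleftrightarrow>
     (\<exists>(\<phi> :: unit formula) Y. lang_free \<phi> \<and> defines_language {} {} \<phi> Y \<Gamma> K)"

end

theory Submission
  imports Defs "HOL-Library.Countable_Set" "HOL-Library.Ramsey"
begin

text \<open>
  Because of the neutral letter, membership in \<open>L\<close> depends only on the sequence of non-neutral
  letters, so finite words can be placed on arbitrary sufficiently large sets of positions. A family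
  of finite sets has unbounded sizes iff there are a set \<open>Z\<close> and consecutive blocks such that each
  \<open>Z \<inter> block\<close> lies in a member of the family and the sizes of these intersections are unbounded. So it
  suffices to find an MSO\<open>+L\<close> formula \<open>\<psi>\<close> about \<open>Z\<close> and the blocks that forces the intersections
  to be unbounded and holds whenever they grow fast enough. Call finite words equivalent if they can
  replace each other in all contexts, which may have infinitely many holes.

  If there are finitely many classes, then, \<open>L\<close> not being \<open>\<omega>\<close>-regular, Ramsey's theorem yields factors
  with \<open>u\<^sub>i\<close> equivalent to \<open>v\<^sub>i\<close> for all \<open>i\<close> although \<open>u\<^sub>0u\<^sub>1\<dots> \<in> L\<close> and \<open>v\<^sub>0v\<^sub>1\<dots> \<notin> L\<close>. The formula says that
  such words can be written on \<open>Z\<close>, block by block; on bounded blocks only finitely many pairs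
  \<open>(u\<^sub>i, v\<^sub>i)\<close> occur, and these can be exchanged one after the other.

  If there are infinitely many classes, the formula says that some word \<open>w\<close> written on \<open>Z\<close> is
  universal: for every \<open>v\<close> cut into factors there are subsequences of the factors of \<open>v\<close> and of the
  blocks of \<open>w\<close> that are interchangeable in all contexts. A \<open>w\<close> listing every finite word infinitely
  often is universal, whereas on bounded blocks \<open>w\<close> misses the class of some \<open>u\<close>, and \<open>v = uuu\<dots>\<close>
  refutes universality.
\<close>

section \<open>Infinite concatenations and the neutral letter\<close>

lemma omega_wordsI: "(\<And>n. w n \<in> \<Gamma>) \<Longrightarrow> w \<in> omega_words \<Gamma>"
  by (auto simp: omega_words_def)

lemma omega_wordsD: "w \<in> omega_words \<Gamma> \<Longrightarrow> w n \<in> \<Gamma>"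
  by (auto simp: omega_words_def)

lemma omega_concat_nth:
  assumes "n < length (concat (map u [0..<k]))"
  shows "omega_concat u n = concat (map u [0..<k]) ! n"
proof -
  have "prefix (length (concat (map u [0..<k]))) (omega_concat u) ! n = concat (map u [0..<k]) ! n"
    by (simp only: prefix_omega_concat)
  then show ?thesis
    using assms by (simp add: subsequence_def)
qed

lemma length_concat_unbounded:
  assumes "infinite {i. u i \<noteq> []}"
  shows "\<exists>k. n < length (concat (map u [0..<k]))"
proof (induction n)
  case 0
  obtain i where "u i \<noteq> []" using assms not_finite_existsD by blast
  then show ?case by (intro exI[of _ "Suc i"]) simp
next
  case (Suc n)
  then obtain k where k: "n < length (concat (map u [0..<k]))" by blast
  obtain i where i: "k \<le> i" "u i \<noteq> []"
    using assms unfolding infinite_nat_iff_unbounded_le by blast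
  have "[0..<i] = [0..<k] @ [k..<i]"
    using i(1) by (metis le0 le_add_diff_inverse upt_add_eq_append)
  then have "length (concat (map u [0..<k])) \<le> length (concat (map u [0..<i]))" by simp
  then show ?case using k i(2) by (intro exI[of _ "Suc i"]) (cases "u i"; simp)
qed

lemma omega_concat_eqI:
  assumes "g 0 = 0" "\<And>i. g i \<le> g (Suc i)" "\<And>n. \<exists>i. n < g i"
    and "\<And>i. map w [g i..<g (Suc i)] = u i"
  shows "omega_concat u = w"
proof
  fix n
  have *: "concat (map u [0..<k]) = map w [0..<g k]" for k
  proof (induction k)
    case (Suc k)
    have "[0..<g (Suc k)] = [0..<g k] @ [g k..<g (Suc k)]"
      by (metis assms(2) le0 le_add_diff_inverse upt_add_eq_append)
    then show ?case using Suc assms(4)[of k] by simp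
  qed (simp add: assms(1))
  obtain k where "n < g k" using assms(3) by blast
  then show "omega_concat u n = w n" using omega_concat_nth[of n u k] * by simp
qed

lemma strict_mono_unbounded:
  fixes g :: "nat \<Rightarrow> nat"
  assumes "strict_mono g"
  shows "\<exists>i. n < g i"
  by (metis assms lessI less_le_trans strict_mono_imp_increasing)

lemma omega_concat_blocks:
  assumes "strict_mono g" "g 0 = 0"
  shows "omega_concat (\<lambda>i. map w [g i..<g (Suc i)]) = w"
  using assms by (intro omega_concat_eqI[of g])
    (auto simp: strict_mono_less_eq strict_mono_unbounded)

lemma omega_concat_in_omega_words:
  assumes "\<And>i. set (u i) \<subseteq> A" "infinite {i. u i \<noteq> []}"
  shows "omega_concat u \<in> omega_words A"
proof -
  have "omega_concat u n \<in> A" for n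
  proof -
    obtain k where k: "n < length (concat (map u [0..<k]))"
      using length_concat_unbounded[OF assms(2)] by blast
    then have "concat (map u [0..<k]) ! n \<in> set (concat (map u [0..<k]))" by (rule nth_mem)
    then show ?thesis using assms(1) k by (auto simp: omega_concat_nth)
  qed
  then show ?thesis by (auto simp: omega_words_def)
qed

lemma omega_concat_map:
  assumes "infinite {i. W i \<noteq> []}"
  shows "omega_concat (\<lambda>i. map f (W i)) = (\<lambda>n. f (omega_concat W n))"
proof
  fix n :: nat
  obtain k where k: "n < length (concat (map W [0..<k]))"
    using length_concat_unbounded[OF assms] by blast
  have "concat (map (\<lambda>i. map f (W i)) [0..<k]) = map f (concat (map W [0..<k]))"
    by (simp add: map_concat comp_def)
  then show "omega_concat (\<lambda>i. map f (W i)) n = f (omega_concat W n)"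
    using k omega_concat_nth[of n "\<lambda>i. map f (W i)" k] omega_concat_nth[of n W k] by simp
qed

lemma concat_map_concat: "concat (map concat xss) = concat (concat xss)"
  by (induction xss) auto

lemma prefix_omega_concat':
  "map (omega_concat u) [0..<length (concat (map u [0..<k]))] = concat (map u [0..<k])"
  using prefix_omega_concat[of u k] by (simp add: subsequence_def)

text \<open>Associativity of infinite concatenation. It regroups factors, so that neutrality, which
  speaks about the ends of given factors, can be applied to a finer factorization.\<close>

lemma omega_concat_omega_concat:
  assumes "infinite {i. concat (W i) \<noteq> []}"
  shows "omega_concat (omega_concat W) = omega_concat (\<lambda>i. concat (W i))"
proof
  fix n
  obtain k where k: "n < length (concat (map (\<lambda>i. concat (W i)) [0..<k]))"
    using length_concat_unbounded[OF assms] by blast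
  have "concat (map (omega_concat W) [0..<length (concat (map W [0..<k]))])
      = concat (map (\<lambda>i. concat (W i)) [0..<k])"
    by (simp add: prefix_omega_concat' concat_map_concat[symmetric] comp_def)
  then show "omega_concat (omega_concat W) n = omega_concat (\<lambda>i. concat (W i)) n"
    using k omega_concat_nth[of n "omega_concat W" "length (concat (map W [0..<k]))"]
      omega_concat_nth[of n "\<lambda>i. concat (W i)" k] by simp
qed

lemma infinite_all: "(\<And>i. P (i::nat)) \<Longrightarrow> infinite {i. P i}"
  by simp

section \<open>Membership in \<open>L\<close> up to neutral letters\<close>

locale omega_language =
  fixes \<Sigma> :: "'a set" and L :: "'a word set"
  assumes finite_alphabet: "finite \<Sigma>"

locale neutral_language = omega_language \<Sigma> L for \<Sigma> :: "'a set" and L +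
  fixes e :: 'a
  assumes neutral: "is_neutral_letter \<Sigma> L e"
begin

lemma e_in [simp]: "e \<in> \<Sigma>"
  using neutral by (simp add: is_neutral_letter_def)

lemma neutral_iff:
  assumes "\<And>i. set (u i) \<subseteq> \<Sigma>" "infinite {i. u i \<noteq> []}"
  shows "omega_concat (\<lambda>i. u i @ [e]) \<in> L \<longleftrightarrow> omega_concat u \<in> L"
  using neutral assms by (simp add: is_neutral_letter_def)

definition core :: "'a list \<Rightarrow> 'a list" where
  "core u = filter (\<lambda>a. a \<noteq> e) u"

lemma core_simps [simp]:
  "core [] = []" "core (u @ v) = core u @ core v" "core (core u) = core u"
  "core (a # u) = (if a = e then core u else a # core u)"
  by (simp_all add: core_def)

lemma set_core: "set (core u) \<subseteq> set u"
  by (auto simp: core_def)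

lemma core_Nil_iff: "core u = [] \<longleftrightarrow> set u \<subseteq> {e}"
  by (auto simp: core_def filter_empty_conv)

text \<open>Cutting at the neutral letters makes each removed \<open>e\<close> the end of a piece,
  which is the only place where the definition of neutrality can remove it. The last piece has no
  \<open>e\<close> after it, hence the additional \<open>e\<close> in
  \<open>concat_splits_neutral\<close>.\<close>

fun splits :: "'a list \<Rightarrow> 'a list list" where
  "splits [] = [[]]"
| "splits (a # u) =
    (if a = e then [] # splits u else (a # hd (splits u)) # tl (splits u))"

lemma splits_not_Nil [simp]: "splits u \<noteq> []"
  by (cases u) auto

lemma concat_splits: "concat (splits u) = core u"
proof (induction u)
  case (Cons a u)
  then show ?case by (cases "splits u") auto
qed simp

lemma concat_splits_neutral: "concat (map (\<lambda>w. w @ [e]) (splits u)) = u @ [e]"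
proof (induction u)
  case (Cons a u)
  then show ?case by (cases "splits u") auto
qed simp

text \<open>
  Padding every factor with three neutral letters lets one application of neutrality delete all
  neutral letters but one per factor; keeping that one makes the result infinite even if only
  finitely many letters differ from \<open>e\<close>.
\<close>

lemma omega_concat_core:
  assumes "\<And>i. set (u i) \<subseteq> \<Sigma>" "infinite {i. u i \<noteq> []}"
  shows "omega_concat u \<in> L \<longleftrightarrow> omega_concat (\<lambda>i. core (u i) @ [e]) \<in> L"
proof -
  \<comment> \<open>Appending \<open>e\<close> to every piece of \<open>W i\<close> and
    concatenating gives \<open>u i @ [e, e, e]\<close>, while concatenating the pieces alone gives
    \<open>core (u i) @ [e]\<close>.\<close>
  define W where "W i = splits (u i) @ [[e]]" for i
  define y where "y = omega_concat W"
  have W: "infinite {i. W i \<noteq> []}" by (rule infinite_all) (simp add: W_def)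
  have cW: "concat (W i) = core (u i) @ [e]" for i by (simp add: W_def concat_splits)
  have "set w \<subseteq> set (concat (W i))" if "w \<in> set (W i)" for w i using that by auto
  moreover have "set (concat (W i)) \<subseteq> \<Sigma>" for i using assms(1)[of i] set_core[of "u i"] by (auto simp: cW)
  ultimately have "y \<in> omega_words {w. set w \<subseteq> \<Sigma>}"
    unfolding y_def by (intro omega_concat_in_omega_words W) blast
  then have y: "set (y j) \<subseteq> \<Sigma>" for j by (auto simp: omega_words_def)
  \<comment> \<open>The witness is the position of the piece \<open>[e]\<close> that closes
    \<open>W n\<close>. Since every \<open>W i\<close> is nonempty, this position is at least
    \<open>n\<close>.\<close>
  have "\<exists>j\<ge>n. y j \<noteq> []" for n
  proof (intro exI conjI)
    let ?h = "length (concat (map W [0..<n]))"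
    show "n \<le> ?h + length (splits (u n))"
      by (induction n) (auto simp: W_def)
    show "y (?h + length (splits (u n))) \<noteq> []"
      unfolding y_def by (subst omega_concat_nth[where k = "Suc n"]) (auto simp: W_def nth_append)
  qed
  then have y_inf: "infinite {j. y j \<noteq> []}"
    by (auto simp: infinite_nat_iff_unbounded_le)
  have "omega_concat u \<in> L \<longleftrightarrow> omega_concat (\<lambda>i. u i @ [e]) \<in> L"
    using assms by (simp add: neutral_iff)
  also have "\<dots> \<longleftrightarrow> omega_concat (\<lambda>i. (u i @ [e]) @ [e]) \<in> L"
    using assms by (subst neutral_iff) auto
  also have "\<dots> \<longleftrightarrow> omega_concat (\<lambda>i. ((u i @ [e]) @ [e]) @ [e]) \<in> L"
    using assms by (subst (2) neutral_iff) auto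
  also have "(\<lambda>i. ((u i @ [e]) @ [e]) @ [e]) = (\<lambda>i. concat (map (\<lambda>w. w @ [e]) (W i)))"
    by (simp add: W_def concat_splits_neutral)
  also have "omega_concat \<dots> = omega_concat (omega_concat (\<lambda>i. map (\<lambda>w. w @ [e]) (W i)))"
    by (rule omega_concat_omega_concat[symmetric]) (simp add: W_def)
  also have "omega_concat (\<lambda>i. map (\<lambda>w. w @ [e]) (W i)) = (\<lambda>j. y j @ [e])"
    unfolding y_def by (rule omega_concat_map[OF W])
  also have "omega_concat \<dots> \<in> L \<longleftrightarrow> omega_concat y \<in> L"
    using y y_inf by (rule neutral_iff)
  also have "omega_concat y = omega_concat (\<lambda>i. core (u i) @ [e])"
    unfolding y_def by (subst omega_concat_omega_concat) (simp_all add: cW)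
  finally show ?thesis .
qed

lemma omega_concat_core_cong:
  assumes "\<And>i. set (u i) \<subseteq> \<Sigma>" "infinite {i. u i \<noteq> []}"
    and "\<And>i. set (v i) \<subseteq> \<Sigma>" "infinite {i. v i \<noteq> []}"
    and "\<And>i. core (u i) = core (v i)"
  shows "omega_concat u \<in> L \<longleftrightarrow> omega_concat v \<in> L"
  using omega_concat_core[of u] omega_concat_core[of v] assms by simp

lemma word_core_cong:
  assumes "strict_mono g" "g 0 = 0" "w \<in> omega_words \<Sigma>"
    and "\<And>i. set (v i) \<subseteq> \<Sigma>" "infinite {i. v i \<noteq> []}"
    and "\<And>i. core (map w [g i..<g (Suc i)]) = core (v i)"
  shows "w \<in> L \<longleftrightarrow> omega_concat v \<in> L"
proof -
  have "map w [g i..<g (Suc i)] \<noteq> []" for i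
    using strict_monoD[OF assms(1), of i "Suc i"] by simp
  then have "omega_concat (\<lambda>i. map w [g i..<g (Suc i)]) \<in> L \<longleftrightarrow> omega_concat v \<in> L"
    using assms by (intro omega_concat_core_cong) (auto simp: omega_words_def)
  then show ?thesis by (simp only: omega_concat_blocks[OF assms(1,2)])
qed

lemma words_core_cong:
  assumes g: "strict_mono g" "g 0 = 0" and w: "w \<in> omega_words \<Sigma>" "w' \<in> omega_words \<Sigma>"
    and core: "\<And>i. core (map w [g i..<g (Suc i)]) = core (map w' [g i..<g (Suc i)])"
  shows "w \<in> L \<longleftrightarrow> w' \<in> L"
proof -
  have "w \<in> L \<longleftrightarrow> omega_concat (\<lambda>i. map w' [g i..<g (Suc i)]) \<in> L"
  proof (rule word_core_cong[OF g w(1) _ _ core])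
    show "set (map w' [g i..<g (Suc i)]) \<subseteq> \<Sigma>" for i using omega_wordsD[OF w(2)] by auto
    have "map w' [g i..<g (Suc i)] \<noteq> []" for i
      using strict_monoD[OF g(1) lessI, of i] by (simp del: upt_Suc)
    then show "infinite {i. map w' [g i..<g (Suc i)] \<noteq> []}" by (rule infinite_all)
  qed
  then show ?thesis by (simp only: omega_concat_blocks[OF g])
qed

end

section \<open>Factorizations and \<open>\<omega>\<close>-regularity\<close>

definition block_of :: "(nat \<Rightarrow> nat) \<Rightarrow> nat \<Rightarrow> nat" where
  "block_of g n = (LEAST k. n < g (Suc k))"

lemma block_of_less:
  assumes "strict_mono g"
  shows "n < g (Suc (block_of g n))"
proof -
  obtain i where "n < g i" using strict_mono_unbounded[OF assms] by blast
  then have "n < g (Suc i)" using strict_monoD[OF assms, of i "Suc i"] by simp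
  then show ?thesis unfolding block_of_def by (rule LeastI)
qed

lemma block_of_le:
  assumes "strict_mono g" "g 0 = 0"
  shows "g (block_of g n) \<le> n"
proof (cases "block_of g n")
  case (Suc k)
  then have "\<not> n < g (Suc k)" unfolding block_of_def using not_less_Least[of k "\<lambda>k. n < g (Suc k)"] by simp
  then show ?thesis using Suc by simp
qed (simp add: assms)

lemma block_of_eqI:
  assumes "strict_mono g" "g k \<le> n" "n < g (Suc k)"
  shows "block_of g n = k"
  unfolding block_of_def
proof (rule Least_equality)
  fix j assume "n < g (Suc j)"
  then have "g k < g (Suc j)" using assms(2) by simp
  then show "k \<le> j" using assms(1) by (simp add: strict_mono_less)
qed (use assms in simp)

lemma not_in_range_between:
  fixes g :: "nat \<Rightarrow> nat"
  assumes "strict_mono g" "g k < n" "n < g (Suc k)"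
  shows "n \<notin> range g"
  using assms by (auto simp: strict_mono_less)

lemma constant_on_block:
  assumes "\<And>n. n \<notin> range g \<Longrightarrow> n > 0 \<Longrightarrow> N (n - 1) \<longleftrightarrow> N n"
    and "strict_mono (g :: nat \<Rightarrow> nat)" "g k \<le> n" "n < g (Suc k)"
  shows "N n \<longleftrightarrow> N (g k)"
  using assms(3,4)
proof (induction n rule: dec_induct)
  case (step n)
  then show ?case
    using assms(1)[of "Suc n"] not_in_range_between[OF assms(2), of k "Suc n"] by simp
qed simp

lemma ex_strict_mono_range:
  assumes "infinite (J :: nat set)" "0 \<in> J"
  shows "\<exists>g :: nat \<Rightarrow> nat. strict_mono g \<and> g 0 = 0 \<and> range g = J"
proof (intro exI[of _ "enumerate J"] conjI)
  show "enumerate J 0 = 0" using assms(2) by (simp add: enumerate_0 Least_equality)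
qed (use assms in \<open>simp_all add: strict_mono_enumerate range_enumerate\<close>)

text \<open>Two positions are coloured by the class of the factor between them, and the cuts are
  taken from an infinite homogeneous set. The cut 0 has to be added to that set, so the first factor
  may have another class.\<close>

lemma ramsey_factorization:
  fixes w :: "'a word" and cls :: "'a list \<Rightarrow> nat"
  assumes "finite (range (\<lambda>(i, j). cls (map w [i..<j])))"
  shows "\<exists>(g :: nat \<Rightarrow> nat) t. strict_mono g \<and> g 0 = 0 \<and> (\<forall>i>0. cls (map w [g i..<g (Suc i)]) = t)"
proof -
  obtain s where "\<And>n. n \<in> range (\<lambda>(i, j). cls (map w [i..<j])) \<Longrightarrow> n < s"
    using assms unfolding finite_nat_set_iff_bounded by blast
  then have s: "cls (map w [i..<j]) < s" for i j by (auto intro: range_eqI[of _ _ "(i, j)"])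
  define f where "f X = cls (map w [Min X..<Max X])" for X
  have "\<exists>Y t. Y \<subseteq> UNIV \<and> infinite Y \<and> t < s \<and> (\<forall>x\<in>Y. \<forall>y\<in>Y. x \<noteq> y \<longrightarrow> f {x, y} = t)"
    by (rule Ramsey2) (simp_all add: f_def s)
  then obtain Y t where Y: "infinite Y" and t: "\<forall>x\<in>Y. \<forall>y\<in>Y. x \<noteq> y \<longrightarrow> f {x, y} = t"
    by (elim exE conjE)
  obtain g :: "nat \<Rightarrow> nat" where g: "strict_mono g" "g 0 = 0" "range g = insert 0 Y"
    using ex_strict_mono_range[of "insert 0 Y"] Y by auto
  have "g i \<in> Y" if "i > 0" for i
    using g strict_monoD[OF g(1) that] by (metis insertE less_irrefl rangeI)
  moreover have "g i < g (Suc i)" for i using g(1) by (simp add: strict_monoD)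
  ultimately have "cls (map w [g i..<g (Suc i)]) = t" if "i > 0" for i
    using t[rule_format, of "g i" "g (Suc i)"] that less_imp_le[of "g i" "g (Suc i)"]
    by (simp add: f_def min_def max_def less_imp_neq)
  then show ?thesis using g by blast
qed

text \<open>
  The automaton guesses a factorization into factors of classes \<open>s, t, t, \<dots>\<close>; a state records \<open>t\<close>,
  the class expected of the current factor, the class read so far, and whether a factor has just
  been completed.
\<close>

lemma omega_regular_if_finite_congruence:
  fixes cls :: "'a list \<Rightarrow> nat"
  assumes L: "L \<subseteq> omega_words \<Sigma>"
    and fin: "finite (cls ` lists \<Sigma>)"
    and cong: "\<And>u v a. u \<in> lists \<Sigma> \<Longrightarrow> v \<in> lists \<Sigma> \<Longrightarrow> a \<in> \<Sigma> \<Longrightarrow> cls u = cls v \<Longrightarrow>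
      cls (u @ [a]) = cls (v @ [a])"
    and sat: "\<And>u v. (\<And>i. u i \<in> lists \<Sigma> \<and> u i \<noteq> []) \<Longrightarrow> (\<And>i. v i \<in> lists \<Sigma> \<and> v i \<noteq> []) \<Longrightarrow>
      (\<And>i. cls (u i) = cls (v i)) \<Longrightarrow> omega_concat u \<in> L \<Longrightarrow> omega_concat v \<in> L"
  shows "omega_regular \<Sigma> L"
proof -
  define R where "R = cls ` lists \<Sigma>"
  \<comment> \<open>By the hypothesis \<open>sat\<close>, the classes of nonempty factors decide
    membership in \<open>L\<close>. So one witness \<open>u\<close> for \<open>(s, t)\<close>
    vouches for every word that factors into classes \<open>s, t, t, ...\<close>.\<close>
  define good where "good = {(s, t). \<exists>u. (\<forall>i. u i \<in> lists \<Sigma> \<and> u i \<noteq> []) \<and>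
      cls (u 0) = s \<and> (\<forall>i>0. cls (u i) = t) \<and> omega_concat u \<in> L}"
  define st :: "nat \<times> nat \<times> nat \<times> bool \<Rightarrow> nat" where "st = to_nat"
  have st: "st x = st y \<longleftrightarrow> x = y" for x y by (simp add: st_def)
  define Q where "Q = st ` (R \<times> R \<times> R \<times> UNIV)"
  define I where "I = (\<lambda>(s, t). st (t, s, cls [], False)) ` good"
  \<comment> \<open>The first group of transitions extends the current factor. The second ends it
    with \<open>a\<close>, which is allowed only if its class is the expected one; from then on
    \<open>t\<close> is expected.\<close>
  define \<Delta> where "\<Delta> =
      {(st (t, p, cls u, f), a, st (t, p, cls (u @ [a]), False)) | t p u f a.
        t \<in> R \<and> p \<in> R \<and> a \<in> \<Sigma> \<and> u \<in> lists \<Sigma>} \<union>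
      {(st (t, cls (u @ [a]), cls u, f), a, st (t, t, cls [], True)) | t u f a.
        t \<in> R \<and> a \<in> \<Sigma> \<and> u \<in> lists \<Sigma>}"
  define F where "F = st ` (R \<times> R \<times> R \<times> {True})"
  have good_R: "s \<in> R \<and> t \<in> R" if "(s, t) \<in> good" for s t
  proof -
    have "\<exists>u. (\<forall>i. u i \<in> lists \<Sigma> \<and> u i \<noteq> []) \<and> cls (u 0) = s \<and> (\<forall>i>0. cls (u i) = t) \<and>
        omega_concat u \<in> L"
      using that by (simp only: good_def mem_Collect_eq prod.case)
    then obtain u where "(\<forall>i. u i \<in> lists \<Sigma> \<and> u i \<noteq> []) \<and> cls (u 0) = s \<and> (\<forall>i>0. cls (u i) = t) \<and>
        omega_concat u \<in> L" by (rule exE)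
    then have u: "\<forall>i. u i \<in> lists \<Sigma>" "cls (u 0) = s" "\<forall>i>0. cls (u i) = t" by simp_all
    then have "cls (u (Suc 0)) = t" by simp
    moreover have "cls (u i) \<in> R" for i unfolding R_def using u(1) by (intro imageI) simp
    ultimately show ?thesis using u(2) by metis
  qed
  have cls_R: "u \<in> lists \<Sigma> \<Longrightarrow> cls u \<in> R" for u by (simp add: R_def)
  have cls_snoc_R: "cls (u @ [a]) \<in> R" if "u \<in> lists \<Sigma>" "a \<in> \<Sigma>" for u a
    using that by (intro cls_R) auto
  have step_continue: "(st (t, p, cls u, f), a, st (t, p, cls (u @ [a]), False)) \<in> \<Delta>"
    if "t \<in> R" "p \<in> R" "a \<in> \<Sigma>" "u \<in> lists \<Sigma>" for t p a u f
    unfolding \<Delta>_def using that by (intro UnI1) blast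
  have step_complete: "(st (t, p, cls u, f), a, st (t, t, cls [], True)) \<in> \<Delta>"
    if "t \<in> R" "p \<in> R" "a \<in> \<Sigma>" "u \<in> lists \<Sigma>" "cls (u @ [a]) = p" for t p a u f
    unfolding \<Delta>_def using that by (intro UnI2) blast
  have "finite Q" using fin by (simp add: Q_def R_def)
  moreover have "I \<subseteq> Q" unfolding I_def Q_def using good_R cls_R by auto
  moreover have "\<Delta> \<subseteq> Q \<times> \<Sigma> \<times> Q" unfolding \<Delta>_def Q_def by (auto intro!: imageI cls_R)
  moreover have "F \<subseteq> Q" by (auto simp: F_def Q_def)
  moreover have "L = {w \<in> omega_words \<Sigma>. buchi_accepts I \<Delta> F w}"
  proof (intro equalityI subsetI)
    fix w assume w: "w \<in> L"
    then have w_in: "w \<in> omega_words \<Sigma>" using L by blast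
    then have wl: "map w xs \<in> lists \<Sigma>" for xs by (auto simp: omega_words_def image_subset_iff)
    have "range (\<lambda>(i, j). cls (map w [i..<j])) \<subseteq> R" using cls_R wl by auto
    then have "finite (range (\<lambda>(i, j). cls (map w [i..<j])))" using fin R_def finite_subset by blast
    then obtain g :: "nat \<Rightarrow> nat" and t where g: "strict_mono g" "g 0 = 0"
      and t: "\<And>i. i > 0 \<Longrightarrow> cls (map w [g i..<g (Suc i)]) = t"
      using ramsey_factorization by blast
    define s where "s = cls (map w [0..<g 1])"
    have "(s, t) \<in> good"
      unfolding good_def mem_Collect_eq prod.case
    proof (intro exI[of _ "\<lambda>i. map w [g i..<g (Suc i)]"] conjI allI impI)
      show "map w [g i..<g (Suc i)] \<noteq> []" for i using strict_monoD[OF g(1) lessI, of i] by simp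
      show "omega_concat (\<lambda>i. map w [g i..<g (Suc i)]) \<in> L" using w by (simp only: omega_concat_blocks[OF g])
    qed (use t wl g in \<open>simp_all add: s_def\<close>)
    note st_R = good_R[OF this]
    define k where "k n = block_of g n" for n
    have k: "g (k n) \<le> n" "n < g (Suc (k n))" for n
      using g by (simp_all add: k_def block_of_le block_of_less)
    define p where "p n = (if k n = 0 then s else t)" for n
    \<comment> \<open>The flag is off at position 0, although a factor starts there, because none
      has been completed and initial states carry \<open>False\<close>.\<close>
    define r where "r n = st (t, p n, cls (map w [g (k n)..<n]), n = g (k n) \<and> k n > 0)" for n
    have "k 0 = 0" unfolding k_def using g strict_monoD[OF g(1), of 0 1]
      by (intro block_of_eqI) auto
    then have "r 0 \<in> I" using \<open>(s, t) \<in> good\<close> g by (force simp: r_def p_def I_def)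
    moreover have "(r n, w n, r (Suc n)) \<in> \<Delta>" for n
    proof -
      let ?u = "map w [g (k n)..<n]"
      have snoc: "?u @ [w n] = map w [g (k n)..<Suc n]" using k(1)[of n] by simp
      have "w n \<in> \<Sigma>" using w_in by (auto simp: omega_words_def)
      have pt: "p n \<in> R" "t \<in> R" using st_R by (simp_all add: p_def)
      show ?thesis
      proof (cases "Suc n < g (Suc (k n))")
        case True
        then have "k (Suc n) = k n"
          unfolding k_def using g k(1)[of n] by (intro block_of_eqI) (auto simp: k_def)
        then have "r (Suc n) = st (t, p n, cls (?u @ [w n]), False)"
          unfolding snoc using k(1)[of n] by (simp add: r_def p_def)
        then show ?thesis
          unfolding r_def[of n] using step_continue[OF pt(2,1) \<open>w n \<in> \<Sigma>\<close> wl] by simp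
      next
        case False
        then have eq: "Suc n = g (Suc (k n))" using k(2)[of n] by simp
        then have "k (Suc n) = Suc (k n)"
          unfolding k_def using g by (intro block_of_eqI) (auto simp: k_def strict_mono_less)
        moreover have "cls (map w [g (k n)..<Suc n]) = p n"
          using t[of "k n"] g eq by (cases "k n") (auto simp: p_def s_def)
        ultimately have "r (Suc n) = st (t, t, cls [], True)" "cls (?u @ [w n]) = p n"
          unfolding snoc using eq by (simp_all add: r_def p_def)
        then show ?thesis
          unfolding r_def[of n] using step_complete[OF pt(2,1) \<open>w n \<in> \<Sigma>\<close> wl] by simp
      qed
    qed
    moreover have "st (t, t, cls [], True) \<in> limit r"
    proof -
      have "k (g (Suc i)) = Suc i" for i
        unfolding k_def using g by (intro block_of_eqI) (auto simp: strict_mono_less)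
      then have "g (Suc i) \<in> {n. r n = st (t, t, cls [], True)}" for i by (simp add: r_def p_def)
      then have "range (\<lambda>i. g (Suc i)) \<subseteq> {n. r n = st (t, t, cls [], True)}" by blast
      moreover have "inj (\<lambda>i. g (Suc i))"
        using g(1) by (auto intro!: injI simp: strict_mono_eq)
      ultimately have "infinite {n. r n = st (t, t, cls [], True)}"
        using infinite_super range_inj_infinite by blast
      then show ?thesis by (simp add: limit_def INFM_iff_infinite)
    qed
    moreover have "st (t, t, cls [], True) \<in> F" using st_R cls_R by (simp add: F_def)
    ultimately show "w \<in> {w \<in> omega_words \<Sigma>. buchi_accepts I \<Delta> F w}"
      using w_in unfolding buchi_accepts_def by blast
  next
    fix w assume "w \<in> {w \<in> omega_words \<Sigma>. buchi_accepts I \<Delta> F w}"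
    then obtain r where w_in: "w \<in> omega_words \<Sigma>" and r0: "r 0 \<in> I"
      and step: "\<And>n. (r n, w n, r (Suc n)) \<in> \<Delta>" and lim: "limit r \<inter> F \<noteq> {}"
      unfolding buchi_accepts_def by blast
    have wl: "map w xs \<in> lists \<Sigma>" for xs using w_in by (auto simp: omega_words_def image_subset_iff)
    have "\<exists>y. r n = st y" for n using step[of n] unfolding \<Delta>_def by blast
    then obtain y where y: "\<And>n. r n = st (y n)" by metis
    obtain s t where st_good: "(s, t) \<in> good" and y0: "y 0 = (t, s, cls [], False)"
      using r0 unfolding I_def by (auto simp: y st)
    have fst_y: "fst (y n) = t" for n
    proof (induction n)
      case (Suc n)
      then show ?case using step[of n] unfolding \<Delta>_def by (auto simp: y st)
    qed (simp add: y0)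
    define p where "p n = fst (snd (y n))" for n
    define q where "q n = fst (snd (snd (y n)))" for n
    define f where "f n = snd (snd (snd (y n)))" for n
    have y_eq: "y n = (t, p n, q n, f n)" for n
      using fst_y[of n] by (simp add: p_def q_def f_def prod_eq_iff)
    have st': "\<exists>u\<in>lists \<Sigma>. cls u = q n \<and> (p (Suc n) = p n \<and> q (Suc n) = cls (u @ [w n]) \<and> \<not> f (Suc n) \<or>
        cls (u @ [w n]) = p n \<and> p (Suc n) = t \<and> q (Suc n) = cls [] \<and> f (Suc n))" for n
      using step[of n] unfolding \<Delta>_def y y_eq by (auto simp: st simp del: lists_eq_set in_lists_conv_set)
    \<comment> \<open>A transition only provides some word of class \<open>q n\<close>. By
      \<open>cong\<close> it can be exchanged for any other word of that class, in particular for
      the factor actually read.\<close>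
    have stp: "p (Suc n) = p n \<and> q (Suc n) = cls (u @ [w n]) \<and> \<not> f (Suc n) \<or>
        cls (u @ [w n]) = p n \<and> p (Suc n) = t \<and> q (Suc n) = cls [] \<and> f (Suc n)"
      if "q n = cls u" "u \<in> lists \<Sigma>" for n u
    proof -
      have "w n \<in> \<Sigma>" using w_in by (auto simp: omega_words_def)
      then show ?thesis using st'[of n] cong that by metis
    qed
    have "infinite {n. f n}"
    proof -
      obtain z where "z \<in> limit r" "z \<in> F" using lim by blast
      then obtain a b c where "infinite {n. r n = st (a, b, c, True)}"
        by (auto simp: limit_def INFM_iff_infinite F_def)
      moreover have "{n. r n = st (a, b, c, True)} \<subseteq> {n. f n}" by (auto simp: y st f_def)
      ultimately show ?thesis using infinite_super by blast
    qed
    \<comment> \<open>Factors begin at the flagged positions and at 0, where the run starts without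
      a flag. Visiting \<open>F\<close> infinitely often makes the flagged positions infinite in
      number.\<close>
    then obtain g :: "nat \<Rightarrow> nat" where g: "strict_mono g" "g 0 = 0" "range g = insert 0 {n. f n}"
      using ex_strict_mono_range[of "insert 0 {n. f n}"] by auto
    define pk where "pk k = (if k = 0 then s else t)" for k :: nat
    have start: "p (g k) = pk k \<and> q (g k) = cls []" for k
    proof (cases k)
      case 0
      then show ?thesis using y0 g(2) by (simp add: p_def q_def pk_def)
    next
      case (Suc j)
      then have "g k > 0" using g by (metis strict_mono_less zero_less_Suc)
      then obtain n where n: "g k = Suc n" by (cases "g k") auto
      then have "f (Suc n)" using g(3) by (metis Suc_neq_Zero insertE mem_Collect_eq rangeI)
      then show ?thesis using st'[of n] Suc n by (auto simp: pk_def)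
    qed
    have mid: "p n = pk k \<and> q n = cls (map w [g k..<n])" if "g k \<le> n" "n < g (Suc k)" for n k
      using that
    proof (induction n rule: dec_induct)
      case base
      then show ?case using start by simp
    next
      case (step n)
      then have "\<not> f (Suc n)"
        using not_in_range_between[OF g(1), of k "Suc n"] g(3) by auto
      then show ?case using stp[of n "map w [g k..<n]"] step wl by (auto simp del: lists_eq_set in_lists_conv_set)
    qed
    have "cls (map w [g k..<g (Suc k)]) = pk k" for k
    proof -
      have lt: "g k < g (Suc k)" using g(1) by (simp add: strict_mono_less)
      then obtain n where n: "g (Suc k) = Suc n" by (cases "g (Suc k)") auto
      then have "f (Suc n)" using g(3) by (metis Suc_neq_Zero insertE mem_Collect_eq rangeI)
      then show ?thesis using stp[of n "map w [g k..<n]"] mid[of k n] wl n lt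
        by (auto simp del: lists_eq_set in_lists_conv_set)
    qed
    note cls_block = this
    obtain u where u: "\<And>i. u i \<in> lists \<Sigma> \<and> u i \<noteq> []" "cls (u 0) = s" "\<And>i. i > 0 \<Longrightarrow> cls (u i) = t"
      "omega_concat u \<in> L"
      using st_good unfolding good_def by blast
    have "omega_concat (\<lambda>k. map w [g k..<g (Suc k)]) \<in> L"
    proof (rule sat[of u])
      show "map w [g i..<g (Suc i)] \<in> lists \<Sigma> \<and> map w [g i..<g (Suc i)] \<noteq> []" for i
        using wl strict_monoD[OF g(1) lessI, of i] by simp
      show "cls (u i) = cls (map w [g i..<g (Suc i)])" for i
        unfolding cls_block using u by (cases i) (auto simp: pk_def)
    qed (use u in auto)
    then show "w \<in> L" by (simp add: omega_concat_blocks g)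
  qed
  ultimately show ?thesis unfolding omega_regular_def by blast
qed

section \<open>Definability in MSO\<open>+L\<close>\<close>

context omega_language
begin

definition expressible :: "((nat \<Rightarrow> nat) \<Rightarrow> (nat \<Rightarrow> nat set) \<Rightarrow> bool) \<Rightarrow> bool" where
  "expressible P \<longleftrightarrow> (\<exists>\<phi> :: 'a formula. bounding_free \<phi> \<and> (\<forall>s S. sat \<Sigma> L s S \<phi> \<longleftrightarrow> P s S))"

lemma expressibleI:
  assumes "bounding_free \<phi>" "\<And>s S. sat \<Sigma> L s S \<phi> \<longleftrightarrow> P s S"
  shows "expressible P"
  using assms unfolding expressible_def by blast

lemma expressible_atoms:
  "expressible (\<lambda>s S. s x < s y)" "expressible (\<lambda>s S. s x = s y)" "expressible (\<lambda>s S. s x \<in> S X)"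
  "expressible (\<lambda>s S. lang_predicate \<Sigma> L (\<lambda>a. S (v a)))"
  by (rule expressibleI[of "Less x y"] expressibleI[of "Equal x y"] expressibleI[of "Member x X"]
      expressibleI[of "Lang v"]; simp)+

lemma expressible_not:
  assumes "expressible P"
  shows "expressible (\<lambda>s S. \<not> P s S)"
proof -
  obtain \<phi> :: "'a formula" where "bounding_free \<phi>" "\<And>s S. sat \<Sigma> L s S \<phi> \<longleftrightarrow> P s S"
    using assms unfolding expressible_def by metis
  then show ?thesis by (intro expressibleI[of "Neg \<phi>"]) simp_all
qed

lemma expressible_conj:
  assumes "expressible P" "expressible Q"
  shows "expressible (\<lambda>s S. P s S \<and> Q s S)"
proof -
  obtain \<phi> \<psi> :: "'a formula" where "bounding_free \<phi>" "\<And>s S. sat \<Sigma> L s S \<phi> \<longleftrightarrow> P s S"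
    "bounding_free \<psi>" "\<And>s S. sat \<Sigma> L s S \<psi> \<longleftrightarrow> Q s S"
    using assms unfolding expressible_def by metis
  then show ?thesis by (intro expressibleI[of "Conj \<phi> \<psi>"]) simp_all
qed

lemma expressible_disj:
  assumes "expressible P" "expressible Q"
  shows "expressible (\<lambda>s S. P s S \<or> Q s S)"
proof -
  have "expressible (\<lambda>s S. \<not> (\<not> P s S \<and> \<not> Q s S))"
    by (intro expressible_not expressible_conj assms)
  then show ?thesis by simp
qed

lemma expressible_imp:
  assumes "expressible P" "expressible Q"
  shows "expressible (\<lambda>s S. P s S \<longrightarrow> Q s S)"
proof -
  have "expressible (\<lambda>s S. \<not> P s S \<or> Q s S)"
    by (intro expressible_not expressible_disj assms)
  then show ?thesis by simp
qed

lemma expressible_ex_elem: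
  assumes "expressible P"
  shows "expressible (\<lambda>s S. \<exists>n. P (s(x := n)) S)"
proof -
  obtain \<phi> :: "'a formula" where "bounding_free \<phi>" "\<And>s S. sat \<Sigma> L s S \<phi> \<longleftrightarrow> P s S"
    using assms unfolding expressible_def by metis
  then show ?thesis by (intro expressibleI[of "Ex_elem x \<phi>"]) simp_all
qed

lemma expressible_all_elem:
  assumes "expressible P"
  shows "expressible (\<lambda>s S. \<forall>n. P (s(x := n)) S)"
proof -
  have "expressible (\<lambda>s S. \<not> (\<exists>n. (\<lambda>s S. \<not> P s S) (s(x := n)) S))"
    by (intro expressible_not expressible_ex_elem assms)
  then show ?thesis by simp
qed

lemma expressible_ex_set:
  assumes "expressible P"
  shows "expressible (\<lambda>s S. \<exists>A. P s (S(X := A)))"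
proof -
  obtain \<phi> :: "'a formula" where "bounding_free \<phi>" "\<And>s S. sat \<Sigma> L s S \<phi> \<longleftrightarrow> P s S"
    using assms unfolding expressible_def by metis
  then show ?thesis by (intro expressibleI[of "Ex_set X \<phi>"]) simp_all
qed

lemma expressible_all_set:
  assumes "expressible P"
  shows "expressible (\<lambda>s S. \<forall>A. P s (S(X := A)))"
proof -
  have "expressible (\<lambda>s S. \<not> (\<exists>A. (\<lambda>s S. \<not> P s S) s (S(X := A))))"
    by (intro expressible_not expressible_ex_set assms)
  then show ?thesis by simp
qed

lemma expressible_const: "expressible (\<lambda>s S. b)"
proof (cases b)
  case True
  then show ?thesis by (intro expressibleI[of "Equal 0 0"]) simp_all
next
  case False
  then show ?thesis by (intro expressibleI[of "Neg (Equal 0 0)"]) simp_all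
qed

lemma expressible_ball:
  assumes "finite C" "\<And>c. c \<in> C \<Longrightarrow> expressible (P c)"
  shows "expressible (\<lambda>s S. \<forall>c\<in>C. P c s S)"
  using assms
proof (induction C rule: finite_induct)
  case empty
  show ?case using expressible_const[of True] by simp
next
  case (insert c C)
  have "expressible (P c)" by (rule insert.prems) simp
  moreover have "expressible (\<lambda>s S. \<forall>c\<in>C. P c s S)" by (rule insert.IH, rule insert.prems) simp
  ultimately have "expressible (\<lambda>s S. P c s S \<and> (\<forall>c\<in>C. P c s S))" by (rule expressible_conj)
  then show ?case by simp
qed

lemma expressible_bex:
  assumes "finite C" "\<And>c. c \<in> C \<Longrightarrow> expressible (P c)"
  shows "expressible (\<lambda>s S. \<exists>c\<in>C. P c s S)"
proof -
  have "expressible (\<lambda>s S. \<not> (\<forall>c\<in>C. \<not> P c s S))"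
    by (rule expressible_not, rule expressible_ball[OF assms(1)], rule expressible_not, rule assms(2))
  then show ?thesis by simp
qed

text \<open>One quantifier per variable in \<open>V\<close>, by induction. The function
  \<open>f\<close> bundles the chosen sets, so a whole tuple of sets is handled as a single
  witness.\<close>

lemma expressible_ex_sets:
  assumes "finite V" "expressible P"
  shows "expressible (\<lambda>s S. \<exists>f. P s (\<lambda>X. if X \<in> V then f X else S X))"
  using assms(1)
proof (induction V rule: finite_induct)
  case empty
  then show ?case using assms(2) by simp
next
  case (insert X V)
  have "(\<exists>A f. P s (\<lambda>Y. if Y \<in> V then f Y else (S(X := A)) Y)) \<longleftrightarrow>
      (\<exists>f. P s (\<lambda>Y. if Y \<in> insert X V then f Y else S Y))" for s S
  proof
    assume "\<exists>A f. P s (\<lambda>Y. if Y \<in> V then f Y else (S(X := A)) Y)"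
    then obtain A f where "P s (\<lambda>Y. if Y \<in> V then f Y else (S(X := A)) Y)" by blast
    moreover have "(\<lambda>Y. if Y \<in> V then f Y else (S(X := A)) Y) =
        (\<lambda>Y. if Y \<in> insert X V then (f(X := A)) Y else S Y)"
      using insert.hyps by (auto simp: fun_eq_iff)
    ultimately show "\<exists>f. P s (\<lambda>Y. if Y \<in> insert X V then f Y else S Y)"
      by (intro exI[of _ "f(X := A)"]) simp
  next
    assume "\<exists>f. P s (\<lambda>Y. if Y \<in> insert X V then f Y else S Y)"
    then obtain f where "P s (\<lambda>Y. if Y \<in> insert X V then f Y else S Y)" by blast
    moreover have "(\<lambda>Y. if Y \<in> insert X V then f Y else S Y) =
        (\<lambda>Y. if Y \<in> V then f Y else (S(X := f X)) Y)"
      by (auto simp: fun_eq_iff)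
    ultimately show "\<exists>A f. P s (\<lambda>Y. if Y \<in> V then f Y else (S(X := A)) Y)"
      by (intro exI[of _ "f X"] exI[of _ f]) simp
  qed
  then show ?case using expressible_ex_set[OF insert.IH, of X] by simp
qed

text \<open>The fixed variables 0 and 1 are those of \<open>word_definable_local\<close>; 2 is an
  auxiliary bound variable.\<close>

lemma expressible_Suc: "expressible (\<lambda>s S. s 1 = Suc (s 0))"
proof -
  have "expressible (\<lambda>s S. s 0 < s 1 \<and> \<not> (\<exists>n. (\<lambda>s S. s 0 < s 2 \<and> s 2 < s 1) (s(2 := n)) S))"
    by (intro expressible_conj expressible_not expressible_ex_elem expressible_atoms)
  moreover have "(x < y \<and> \<not> (\<exists>n. x < n \<and> n < y)) \<longleftrightarrow> y = Suc x" for x y :: nat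
    using not_less_eq Suc_lessI by blast
  ultimately show ?thesis by simp
qed

lemma expressible_finite: "expressible (\<lambda>s S. finite (S X))"
proof -
  have "expressible (\<lambda>s S. \<exists>m. (\<lambda>s S. \<forall>k. (\<lambda>s S. s 1 \<in> S X \<longrightarrow> s 1 < s 0) (s(1 := k)) S) (s(0 := m)) S)"
    by (intro expressible_ex_elem expressible_all_elem expressible_imp expressible_atoms)
  moreover have "finite A \<longleftrightarrow> (\<exists>m. \<forall>k. k \<in> A \<longrightarrow> k < m)" for A :: "nat set"
    by (auto simp: finite_nat_set_iff_bounded)
  ultimately show ?thesis by simp
qed

text \<open>
  The formula may be chosen depending on the variables \<open>Y\<close>, which makes injectivity of \<open>Y\<close> and
  renaming of variables irrelevant.
\<close>

definition word_definable :: "'c set \<Rightarrow> ('c word \<Rightarrow> bool) \<Rightarrow> bool" where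
  "word_definable \<Gamma> P \<longleftrightarrow> (\<forall>Y. \<exists>Q. expressible Q \<and>
     (\<forall>w\<in>omega_words \<Gamma>. \<forall>s S. (\<forall>c\<in>\<Gamma>. S (Y c) = {n. w n = c}) \<longrightarrow> (Q s S \<longleftrightarrow> P w)))"

lemma word_definableI:
  assumes "\<And>Y. expressible (Q Y)"
    and "\<And>Y w s S. w \<in> omega_words \<Gamma> \<Longrightarrow> (\<And>c. c \<in> \<Gamma> \<Longrightarrow> S (Y c) = {n. w n = c}) \<Longrightarrow> Q Y s S \<longleftrightarrow> P w"
  shows "word_definable \<Gamma> P"
  unfolding word_definable_def
proof (intro allI exI conjI ballI impI)
  fix Y
  show "expressible (Q Y)" by (rule assms(1))
  fix w s S
  assume "w \<in> omega_words \<Gamma>" "\<forall>c\<in>\<Gamma>. S (Y c) = {n. w n = c}"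
  then show "Q Y s S \<longleftrightarrow> P w" by (intro assms(2)) simp_all
qed

section \<open>Closure properties of definable word predicates\<close>

lemma word_definable_not:
  assumes "word_definable \<Gamma> P"
  shows "word_definable \<Gamma> (\<lambda>w. \<not> P w)"
  unfolding word_definable_def
proof
  fix Y
  obtain Q where Q: "expressible Q \<and>
      (\<forall>w\<in>omega_words \<Gamma>. \<forall>s S. (\<forall>c\<in>\<Gamma>. S (Y c) = {n. w n = c}) \<longrightarrow> (Q s S \<longleftrightarrow> P w))"
    using assms[unfolded word_definable_def, THEN spec[of _ Y]] by (rule exE)
  then show "\<exists>Q. expressible Q \<and>
      (\<forall>w\<in>omega_words \<Gamma>. \<forall>s S. (\<forall>c\<in>\<Gamma>. S (Y c) = {n. w n = c}) \<longrightarrow> (Q s S \<longleftrightarrow> \<not> P w))"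
    by (intro exI[of _ "\<lambda>s S. \<not> Q s S"]) (simp add: expressible_not)
qed

lemma word_definable_conj:
  assumes "word_definable \<Gamma> P" "word_definable \<Gamma> P'"
  shows "word_definable \<Gamma> (\<lambda>w. P w \<and> P' w)"
  unfolding word_definable_def
proof
  fix Y
  obtain Q where Q: "expressible Q \<and>
      (\<forall>w\<in>omega_words \<Gamma>. \<forall>s S. (\<forall>c\<in>\<Gamma>. S (Y c) = {n. w n = c}) \<longrightarrow> (Q s S \<longleftrightarrow> P w))"
    using assms(1)[unfolded word_definable_def, THEN spec[of _ Y]] by (rule exE)
  obtain Q' where Q': "expressible Q' \<and>
      (\<forall>w\<in>omega_words \<Gamma>. \<forall>s S. (\<forall>c\<in>\<Gamma>. S (Y c) = {n. w n = c}) \<longrightarrow> (Q' s S \<longleftrightarrow> P' w))"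
    using assms(2)[unfolded word_definable_def, THEN spec[of _ Y]] by (rule exE)
  with Q show "\<exists>Q. expressible Q \<and>
      (\<forall>w\<in>omega_words \<Gamma>. \<forall>s S. (\<forall>c\<in>\<Gamma>. S (Y c) = {n. w n = c}) \<longrightarrow> (Q s S \<longleftrightarrow> P w \<and> P' w))"
    by (intro exI[of _ "\<lambda>s S. Q s S \<and> Q' s S"]) (simp add: expressible_conj)
qed

text \<open>\<open>G\<close> is an arbitrary relation from outside the logic. Over a finite alphabet
  it becomes a finite disjunction over pairs of letters, in which \<open>G c d\<close> is a truth
  constant.\<close>

lemma word_definable_local:
  assumes "finite \<Gamma>"
  shows "word_definable \<Gamma> (\<lambda>w. \<forall>n. G (w n) (w (Suc n)))"
proof (rule word_definableI)
  fix Y :: "'b \<Rightarrow> nat" and w and s :: "nat \<Rightarrow> nat" and S :: "nat \<Rightarrow> nat set"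
  let ?P = "\<lambda>s S. s 1 = Suc (s 0) \<longrightarrow> (\<exists>c\<in>\<Gamma>. \<exists>d\<in>\<Gamma>. G c d \<and> s 0 \<in> S (Y c) \<and> s 1 \<in> S (Y d))"
  show "expressible (\<lambda>s S. \<forall>n. (\<lambda>s S. \<forall>m. ?P (s(1 := m)) S) (s(0 := n)) S)"
    by (intro expressible_all_elem expressible_imp expressible_bex expressible_conj assms
        expressible_const expressible_atoms expressible_Suc)
  assume w: "w \<in> omega_words \<Gamma>" and S: "\<And>c. c \<in> \<Gamma> \<Longrightarrow> S (Y c) = {n. w n = c}"
  show "(\<forall>n. (\<lambda>s S. \<forall>m. ?P (s(1 := m)) S) (s(0 := n)) S) \<longleftrightarrow> (\<forall>n. G (w n) (w (Suc n)))"
    using S omega_wordsD[OF w] by auto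
qed

lemma word_definable_first:
  assumes "finite \<Gamma>"
  shows "word_definable \<Gamma> (\<lambda>w. g (w 0))"
proof (rule word_definableI)
  fix Y :: "'b \<Rightarrow> nat" and w and s :: "nat \<Rightarrow> nat" and S :: "nat \<Rightarrow> nat set"
  let ?P = "\<lambda>s S. \<forall>m. (\<lambda>s S. \<not> s 1 < s 0) (s(1 := m)) S"
  let ?Q = "\<lambda>s S. \<exists>c\<in>\<Gamma>. g c \<and> s 0 \<in> S (Y c)"
  show "expressible (\<lambda>s S. \<exists>n. (\<lambda>s S. ?P s S \<and> ?Q s S) (s(0 := n)) S)"
    by (intro expressible_all_elem expressible_ex_elem expressible_not expressible_bex
        expressible_conj assms expressible_const expressible_atoms)
  assume w: "w \<in> omega_words \<Gamma>" and S: "\<And>c. c \<in> \<Gamma> \<Longrightarrow> S (Y c) = {n. w n = c}"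
  have "(\<forall>m. \<not> m < n) \<longleftrightarrow> n = 0" for n :: nat by auto
  then show "(\<exists>n. (\<lambda>s S. ?P s S \<and> ?Q s S) (s(0 := n)) S) \<longleftrightarrow> g (w 0)"
    using S omega_wordsD[OF w] by auto
qed

lemma word_definable_infinite:
  assumes "finite \<Gamma>"
  shows "word_definable \<Gamma> (\<lambda>w. infinite {n. g (w n)})"
proof (rule word_definableI)
  fix Y :: "'b \<Rightarrow> nat" and w and s :: "nat \<Rightarrow> nat" and S :: "nat \<Rightarrow> nat set"
  let ?Q = "\<lambda>s S. \<exists>c\<in>\<Gamma>. g c \<and> s 1 \<in> S (Y c)"
  show "expressible (\<lambda>s S. \<forall>m. (\<lambda>s S. \<exists>n. (\<lambda>s S. s 0 < s 1 \<and> ?Q s S) (s(1 := n)) S) (s(0 := m)) S)"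
    by (intro expressible_all_elem expressible_ex_elem expressible_bex
        expressible_conj assms expressible_const expressible_atoms)
  assume w: "w \<in> omega_words \<Gamma>" and S: "\<And>c. c \<in> \<Gamma> \<Longrightarrow> S (Y c) = {n. w n = c}"
  show "(\<forall>m. (\<lambda>s S. \<exists>n. (\<lambda>s S. s 0 < s 1 \<and> ?Q s S) (s(1 := n)) S) (s(0 := m)) S) \<longleftrightarrow>
      infinite {n. g (w n)}"
    using S omega_wordsD[OF w] by (auto simp: infinite_nat_iff_unbounded)
qed

lemma ex_inj_on_avoiding:
  assumes "finite (\<Delta> :: 'd set)" "finite (V :: nat set)"
  shows "\<exists>Y. inj_on Y \<Delta> \<and> Y ` \<Delta> \<inter> V = {}"
proof -
  obtain k where k: "\<forall>x\<in>V. x < k" using assms(2) finite_nat_set_iff_bounded by blast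
  obtain f :: "'d \<Rightarrow> nat" where "inj_on f \<Delta>" using finite_imp_inj_to_nat_seg[OF assms(1)] by blast
  then have "inj_on (\<lambda>d. k + f d) \<Delta>" by (auto simp: inj_on_def)
  moreover have "(\<lambda>d. k + f d) ` \<Delta> \<inter> V = {}" using k by fastforce
  ultimately show ?thesis by blast
qed

text \<open>A word over \<open>\<Delta>\<close> is a partition of the positions indexed by letters.
  So one set per letter is quantified, and \<open>part\<close> requires the sets to cover all
  positions and to be disjoint; injectivity of \<open>Z\<close> keeps the sets of different letters
  apart.\<close>

lemma expressible_ex_word:
  assumes "finite \<Delta>" "inj_on Z \<Delta>" "expressible R"
  shows "expressible (\<lambda>s S. \<exists>x\<in>omega_words \<Delta>.
    R s (\<lambda>X. if X \<in> Z ` \<Delta> then {n. Z (x n) = X} else S X))"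
proof -
  let ?total = "\<lambda>s S. \<forall>n. (\<lambda>s S. \<exists>d\<in>\<Delta>. s 0 \<in> S (Z d)) (s(0 := n)) S"
  let ?disj = "\<lambda>s S. \<forall>c\<in>\<Delta>. \<forall>d\<in>\<Delta>. c \<noteq> d \<longrightarrow>
      (\<forall>n. (\<lambda>s S. \<not> (s 0 \<in> S (Z c) \<and> s 0 \<in> S (Z d))) (s(0 := n)) S)"
  define part :: "(nat \<Rightarrow> nat) \<Rightarrow> (nat \<Rightarrow> nat set) \<Rightarrow> bool" where "part = (\<lambda>s S. ?total s S \<and> ?disj s S)"
  define up where "up f S X = (if X \<in> Z ` \<Delta> then f X else S X)"
    for f S :: "nat \<Rightarrow> nat set" and X
  have "expressible (\<lambda>s S. part s S \<and> R s S)" unfolding part_def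
    by (intro expressible_conj expressible_all_elem expressible_bex expressible_ball expressible_imp
        expressible_not expressible_const expressible_atoms assms)
  then have "expressible (\<lambda>s S. \<exists>f. part s (up f S) \<and> R s (up f S))"
    using expressible_ex_sets[of "Z ` \<Delta>" "\<lambda>s S. part s S \<and> R s S"] assms(1) unfolding up_def by simp
  moreover have "(\<exists>f. part s (up f S) \<and> R s (up f S)) \<longleftrightarrow>
      (\<exists>x\<in>omega_words \<Delta>. R s (up (\<lambda>X. {n. Z (x n) = X}) S))" for s S
  proof
    assume "\<exists>f. part s (up f S) \<and> R s (up f S)"
    then obtain f where f: "part s (up f S)" "R s (up f S)" by blast
    have "\<exists>d\<in>\<Delta>. n \<in> f (Z d)" for n
      using f(1) by (auto simp: part_def up_def)
    then obtain x where x: "\<And>n. x n \<in> \<Delta> \<and> n \<in> f (Z (x n))" by metis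
    have disj: "c = d" if "c \<in> \<Delta>" "d \<in> \<Delta>" "n \<in> f (Z c)" "n \<in> f (Z d)" for c d n
    proof (rule ccontr)
      assume "c \<noteq> d"
      then have "\<not> (n \<in> up f S (Z c) \<and> n \<in> up f S (Z d))" using f(1) that by (simp add: part_def)
      then show False using that by (simp add: up_def)
    qed
    have "f (Z c) = {n. Z (x n) = Z c}" if "c \<in> \<Delta>" for c
      using x disj that inj_onD[OF assms(2)] by blast
    then have "up f S = up (\<lambda>X. {n. Z (x n) = X}) S" by (auto simp: up_def fun_eq_iff)
    moreover have "x \<in> omega_words \<Delta>" using x by (auto simp: omega_words_def)
    ultimately show "\<exists>x\<in>omega_words \<Delta>. R s (up (\<lambda>X. {n. Z (x n) = X}) S)" using f(2) by auto
  next
    assume "\<exists>x\<in>omega_words \<Delta>. R s (up (\<lambda>X. {n. Z (x n) = X}) S)"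
    then obtain x where x: "x \<in> omega_words \<Delta>" "R s (up (\<lambda>X. {n. Z (x n) = X}) S)" by blast
    have "part s (up (\<lambda>X. {n. Z (x n) = X}) S)"
      using omega_wordsD[OF x(1)] inj_onD[OF assms(2)] by (auto simp: part_def up_def)
    then show "\<exists>f. part s (up f S) \<and> R s (up f S)" using x(2) by blast
  qed
  ultimately show ?thesis by (simp add: up_def[abs_def])
qed

text \<open>This is the common source of letterwise substitution and of quantification over words:
  \<open>\<rho>\<close> becomes the graph of a function or the projection of a product alphabet. The
  variables for \<open>x\<close> avoid those of \<open>w\<close>, so coding \<open>x\<close> does
  not disturb \<open>w\<close>.\<close>

lemma word_definable_rel:
  assumes "finite \<Gamma>" "finite \<Delta>" "word_definable \<Delta> P"
  shows "word_definable \<Gamma> (\<lambda>w. \<exists>x\<in>omega_words \<Delta>. (\<forall>n. (w n, x n) \<in> \<rho>) \<and> P x)"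
  unfolding word_definable_def
proof
  fix Y :: "'b \<Rightarrow> nat"
  obtain Z where Z: "inj_on Z \<Delta>" "Z ` \<Delta> \<inter> Y ` \<Gamma> = {}"
    using ex_inj_on_avoiding[of \<Delta> "Y ` \<Gamma>"] assms by blast
  obtain Q where Q': "expressible Q \<and>
      (\<forall>w\<in>omega_words \<Delta>. \<forall>s S. (\<forall>c\<in>\<Delta>. S (Z c) = {n. w n = c}) \<longrightarrow> (Q s S \<longleftrightarrow> P w))"
    using assms(3)[unfolded word_definable_def, THEN spec[of _ Z]] by (rule exE)
  then have Q: "expressible Q" "\<And>x s S. x \<in> omega_words \<Delta> \<Longrightarrow>
      \<forall>c\<in>\<Delta>. S (Z c) = {n. x n = c} \<Longrightarrow> Q s S \<longleftrightarrow> P x"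
    by simp_all
  let ?rel = "\<lambda>s S. \<forall>n. (\<lambda>s S. \<exists>c\<in>\<Gamma>. \<exists>d\<in>\<Delta>. (c, d) \<in> \<rho> \<and> s 0 \<in> S (Y c) \<and> s 0 \<in> S (Z d)) (s(0 := n)) S"
  define R where "R = (\<lambda>s S. ?rel s S \<and> Q s S)"
  define up where "up x S X = (if X \<in> Z ` \<Delta> then {n. Z (x n) = X} else S X)" for x and S :: "nat \<Rightarrow> nat set" and X
  have "expressible R" unfolding R_def
    by (intro expressible_conj expressible_all_elem expressible_bex expressible_const
        expressible_atoms assms Q)
  then have "expressible (\<lambda>s S. \<exists>x\<in>omega_words \<Delta>. R s (up x S))"
    unfolding up_def[abs_def] by (rule expressible_ex_word[OF assms(2) Z(1)])
  moreover have "R s (up x S) \<longleftrightarrow> (\<forall>n. (w n, x n) \<in> \<rho>) \<and> P x"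
    if w: "w \<in> omega_words \<Gamma>" and S: "\<forall>c\<in>\<Gamma>. S (Y c) = {n. w n = c}" and x: "x \<in> omega_words \<Delta>" for w s S x
  proof -
    have Y_up: "up x S (Y c) = {n. w n = c}" if "c \<in> \<Gamma>" for c
      using that S Z(2) by (auto simp: up_def)
    have Z_up: "up x S (Z d) = {n. x n = d}" if "d \<in> \<Delta>" for d
      using that inj_onD[OF Z(1)] omega_wordsD[OF x] by (auto simp: up_def)
    have "Q s (up x S) \<longleftrightarrow> P x" using Q(2) x Z_up by simp
    moreover have "?rel s (up x S) \<longleftrightarrow> (\<forall>n. (w n, x n) \<in> \<rho>)"
      using omega_wordsD[OF x] omega_wordsD[OF w] Y_up Z_up by auto
    ultimately show ?thesis unfolding R_def by blast
  qed
  ultimately show "\<exists>Q. expressible Q \<and> (\<forall>w\<in>omega_words \<Gamma>. \<forall>s S.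
      (\<forall>c\<in>\<Gamma>. S (Y c) = {n. w n = c}) \<longrightarrow>
      (Q s S \<longleftrightarrow> (\<exists>x\<in>omega_words \<Delta>. (\<forall>n. (w n, x n) \<in> \<rho>) \<and> P x)))"
    by (intro exI[of _ "\<lambda>s S. \<exists>x\<in>omega_words \<Delta>. R s (up x S)"]) simp
qed

lemma word_definable_cong:
  assumes "word_definable \<Gamma> P" "\<And>w. w \<in> omega_words \<Gamma> \<Longrightarrow> P w \<longleftrightarrow> P' w"
  shows "word_definable \<Gamma> P'"
  unfolding word_definable_def
proof
  fix Y
  obtain Q where Q: "expressible Q \<and>
      (\<forall>w\<in>omega_words \<Gamma>. \<forall>s S. (\<forall>c\<in>\<Gamma>. S (Y c) = {n. w n = c}) \<longrightarrow> (Q s S \<longleftrightarrow> P w))"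
    using assms(1)[unfolded word_definable_def, THEN spec[of _ Y]] by (rule exE)
  then show "\<exists>Q. expressible Q \<and>
      (\<forall>w\<in>omega_words \<Gamma>. \<forall>s S. (\<forall>c\<in>\<Gamma>. S (Y c) = {n. w n = c}) \<longrightarrow> (Q s S \<longleftrightarrow> P' w))"
    using assms(2) by (intro exI[of _ Q]) simp
qed

lemma word_definable_comp:
  assumes "finite \<Gamma>" "finite \<Delta>" "f ` \<Gamma> \<subseteq> \<Delta>" "word_definable \<Delta> P"
  shows "word_definable \<Gamma> (\<lambda>w. P (\<lambda>n. f (w n)))"
proof (rule word_definable_cong)
  show "word_definable \<Gamma> (\<lambda>w. \<exists>x\<in>omega_words \<Delta>. (\<forall>n. (w n, x n) \<in> {(c, d). d = f c}) \<and> P x)"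
    by (rule word_definable_rel[OF assms(1,2,4)])
  fix w assume "w \<in> omega_words \<Gamma>"
  then have "(\<lambda>n. f (w n)) \<in> omega_words \<Delta>" using assms(3) by (auto simp: omega_words_def)
  moreover have "(\<forall>n. x n = f (w n)) \<longleftrightarrow> x = (\<lambda>n. f (w n))" for x by auto
  ultimately show "(\<exists>x\<in>omega_words \<Delta>. (\<forall>n. (w n, x n) \<in> {(c, d). d = f c}) \<and> P x) \<longleftrightarrow>
      P (\<lambda>n. f (w n))" by simp
qed

text \<open>A pair of words is read as one word over the product alphabet. Iterated quantifiers
  therefore produce left-nested products, with the innermost variable in the outermost
  \<open>snd\<close>.\<close>

lemma word_definable_ex:
  assumes "finite \<Gamma>" "finite \<Delta>" "word_definable (\<Gamma> \<times> \<Delta>) (\<lambda>z. P (\<lambda>n. fst (z n)) (\<lambda>n. snd (z n)))"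
  shows "word_definable \<Gamma> (\<lambda>w. \<exists>x\<in>omega_words \<Delta>. P w x)"
proof (rule word_definable_cong)
  show "word_definable \<Gamma> (\<lambda>w. \<exists>z\<in>omega_words (\<Gamma> \<times> \<Delta>).
      (\<forall>n. (w n, z n) \<in> {(c, d). fst d = c}) \<and> P (\<lambda>n. fst (z n)) (\<lambda>n. snd (z n)))"
    by (rule word_definable_rel) (use assms in simp_all)
  fix w assume w: "w \<in> omega_words \<Gamma>"
  show "(\<exists>z\<in>omega_words (\<Gamma> \<times> \<Delta>).
      (\<forall>n. (w n, z n) \<in> {(c, d). fst d = c}) \<and> P (\<lambda>n. fst (z n)) (\<lambda>n. snd (z n))) \<longleftrightarrow>
      (\<exists>x\<in>omega_words \<Delta>. P w x)"
  proof
    assume "\<exists>z\<in>omega_words (\<Gamma> \<times> \<Delta>).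
      (\<forall>n. (w n, z n) \<in> {(c, d). fst d = c}) \<and> P (\<lambda>n. fst (z n)) (\<lambda>n. snd (z n))"
    then obtain z where "z \<in> omega_words (\<Gamma> \<times> \<Delta>)" "\<And>n. fst (z n) = w n"
      "P (\<lambda>n. fst (z n)) (\<lambda>n. snd (z n))" by auto
    moreover from this have "(\<lambda>n. snd (z n)) \<in> omega_words \<Delta>"
      by (auto simp: omega_words_def image_subset_iff mem_Times_iff)
    ultimately show "\<exists>x\<in>omega_words \<Delta>. P w x" by auto
  next
    assume "\<exists>x\<in>omega_words \<Delta>. P w x"
    then obtain x where x: "x \<in> omega_words \<Delta>" "P w x" by blast
    then have "(\<lambda>n. (w n, x n)) \<in> omega_words (\<Gamma> \<times> \<Delta>)"
      using w by (auto simp: omega_words_def)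
    then show "\<exists>z\<in>omega_words (\<Gamma> \<times> \<Delta>).
      (\<forall>n. (w n, z n) \<in> {(c, d). fst d = c}) \<and> P (\<lambda>n. fst (z n)) (\<lambda>n. snd (z n))"
      using x by (intro bexI[of _ "\<lambda>n. (w n, x n)"]) auto
  qed
qed

lemma word_definable_all:
  assumes "finite \<Gamma>" "finite \<Delta>" "word_definable (\<Gamma> \<times> \<Delta>) (\<lambda>z. P (\<lambda>n. fst (z n)) (\<lambda>n. snd (z n)))"
  shows "word_definable \<Gamma> (\<lambda>w. \<forall>x\<in>omega_words \<Delta>. P w x)"
proof -
  have "word_definable \<Gamma> (\<lambda>w. \<not> (\<exists>x\<in>omega_words \<Delta>. \<not> P w x))"
    by (intro word_definable_not word_definable_ex assms)
  then show ?thesis by simp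
qed

lemma word_definable_imp:
  assumes "word_definable \<Gamma> P" "word_definable \<Gamma> P'"
  shows "word_definable \<Gamma> (\<lambda>w. P w \<longrightarrow> P' w)"
proof -
  have "word_definable \<Gamma> (\<lambda>w. \<not> (P w \<and> \<not> P' w))"
    by (intro word_definable_not word_definable_conj assms)
  then show ?thesis by simp
qed

lemma word_definable_iff:
  assumes "word_definable \<Gamma> P" "word_definable \<Gamma> P'"
  shows "word_definable \<Gamma> (\<lambda>w. P w \<longleftrightarrow> P' w)"
proof -
  have "word_definable \<Gamma> (\<lambda>w. (P w \<longrightarrow> P' w) \<and> (P' w \<longrightarrow> P w))"
    by (intro word_definable_imp word_definable_conj assms)
  then show ?thesis by (simp add: iff_conv_conj_imp)
qed

lemma word_definable_lang:
  assumes "finite \<Gamma>" "f ` \<Gamma> \<subseteq> \<Sigma>"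
  shows "word_definable \<Gamma> (\<lambda>w. (\<lambda>n. f (w n)) \<in> L)"
proof (rule word_definable_comp[OF assms(1) finite_alphabet assms(2)])
  show "word_definable \<Sigma> (\<lambda>w. w \<in> L)"
  proof (rule word_definableI)
    show "expressible (\<lambda>s S. lang_predicate \<Sigma> L (\<lambda>a. S (Y a)))" for Y
      by (rule expressible_atoms)
    fix Y w s and S :: "nat \<Rightarrow> nat set"
    assume w: "w \<in> omega_words \<Sigma>" and S: "\<And>c. c \<in> \<Sigma> \<Longrightarrow> S (Y c) = {n. w n = c}"
    have "v = w" if v: "v \<in> omega_words \<Sigma>" "\<forall>n. \<forall>a\<in>\<Sigma>. v n = a \<longleftrightarrow> w n = a" for v
    proof
      show "v n = w n" for n using v(2) omega_wordsD[OF v(1), of n] by metis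
    qed
    then show "lang_predicate \<Sigma> L (\<lambda>a. S (Y a)) \<longleftrightarrow> w \<in> L"
      using S w by (auto simp: lang_predicate_def dest: omega_wordsD)
  qed
qed

end

section \<open>The bounding quantifier\<close>

lemma lang_predicate_cong:
  assumes "\<And>a. a \<in> \<Sigma> \<Longrightarrow> X a = X' a"
  shows "lang_predicate \<Sigma> L X \<longleftrightarrow> lang_predicate \<Sigma> L X'"
proof -
  have "(\<Union>a\<in>\<Sigma>. X a) = (\<Union>a\<in>\<Sigma>. X' a)" using assms by simp
  then show ?thesis unfolding lang_predicate_def using assms by simp
qed

lemma sat_cong:
  assumes "\<And>x. x \<in> free_elems \<phi> \<Longrightarrow> s x = s' x" "\<And>X. X \<in> free_sets \<Sigma> \<phi> \<Longrightarrow> S X = S' X"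
  shows "sat \<Sigma> L s S \<phi> \<longleftrightarrow> sat \<Sigma> L s' S' \<phi>"
  using assms
proof (induction \<phi> arbitrary: s s' S S')
  case (Conj \<phi> \<psi>)
  have "sat \<Sigma> L s S \<phi> \<longleftrightarrow> sat \<Sigma> L s' S' \<phi>" by (rule Conj.IH(1)) (use Conj.prems in simp_all)
  moreover have "sat \<Sigma> L s S \<psi> \<longleftrightarrow> sat \<Sigma> L s' S' \<psi>" by (rule Conj.IH(2)) (use Conj.prems in simp_all)
  ultimately show ?case by simp
next
  case (Disj \<phi> \<psi>)
  have "sat \<Sigma> L s S \<phi> \<longleftrightarrow> sat \<Sigma> L s' S' \<phi>" by (rule Disj.IH(1)) (use Disj.prems in simp_all)
  moreover have "sat \<Sigma> L s S \<psi> \<longleftrightarrow> sat \<Sigma> L s' S' \<psi>" by (rule Disj.IH(2)) (use Disj.prems in simp_all)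
  ultimately show ?case by simp
next
  case (Neg \<phi>)
  have "sat \<Sigma> L s S \<phi> \<longleftrightarrow> sat \<Sigma> L s' S' \<phi>" by (rule Neg.IH) (use Neg.prems in simp_all)
  then show ?case by simp
next
  case (Ex_elem x \<phi>)
  have "sat \<Sigma> L (s(x := n)) S \<phi> \<longleftrightarrow> sat \<Sigma> L (s'(x := n)) S' \<phi>" for n
    by (rule Ex_elem.IH) (use Ex_elem.prems in auto)
  then show ?case by simp
next
  case (All_elem x \<phi>)
  have "sat \<Sigma> L (s(x := n)) S \<phi> \<longleftrightarrow> sat \<Sigma> L (s'(x := n)) S' \<phi>" for n
    by (rule All_elem.IH) (use All_elem.prems in auto)
  then show ?case by simp
next
  case (Ex_set X \<phi>)
  have "sat \<Sigma> L s (S(X := A)) \<phi> \<longleftrightarrow> sat \<Sigma> L s' (S'(X := A)) \<phi>" for A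
    by (rule Ex_set.IH) (use Ex_set.prems in auto)
  then show ?case by simp
next
  case (All_set X \<phi>)
  have "sat \<Sigma> L s (S(X := A)) \<phi> \<longleftrightarrow> sat \<Sigma> L s' (S'(X := A)) \<phi>" for A
    by (rule All_set.IH) (use All_set.prems in auto)
  then show ?case by simp
next
  case (Bounding X \<phi>)
  have "sat \<Sigma> L s (S(X := A)) \<phi> \<longleftrightarrow> sat \<Sigma> L s' (S'(X := A)) \<phi>" for A
    by (rule Bounding.IH) (use Bounding.prems in auto)
  then show ?case by simp
next
  case (Lang v)
  have "lang_predicate \<Sigma> L (\<lambda>a. S (v a)) \<longleftrightarrow> lang_predicate \<Sigma> L (\<lambda>a. S' (v a))"
    by (rule lang_predicate_cong) (use Lang.prems in simp)
  then show ?case by simp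
qed simp_all

lemma finite_free_elems: "finite (free_elems \<phi>)"
  by (induction \<phi>) auto

lemma finite_free_sets: "finite \<Sigma> \<Longrightarrow> finite (free_sets \<Sigma> \<phi>)"
  by (induction \<phi>) auto

text \<open>
  A word \<open>z\<close> encodes a set of positions (first component) and the starting positions of consecutive
  blocks (second component). For \<open>\<psi> z\<close> it is enough that the blocks contain fast growing numbers of
  elements of the set, because the sets \<open>A\<close> can be thinned out to disjoint pieces of any sizes.
\<close>

lemma unbounded_sets_iff:
  fixes \<psi> :: "(bool \<times> bool) word \<Rightarrow> bool" and P :: "nat set \<Rightarrow> bool"
  assumes sound: "\<And>z m. \<psi> z \<Longrightarrow> \<exists>p q. p \<le> q \<and> (\<forall>r. p < r \<and> r \<le> q \<longrightarrow> \<not> snd (z r)) \<and>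
      m \<le> card {r. p \<le> r \<and> r \<le> q \<and> fst (z r)}"
    and complete: "\<And>z g. strict_mono g \<Longrightarrow> g 0 = 0 \<Longrightarrow> (\<And>n. snd (z n) \<longleftrightarrow> n \<in> range g) \<Longrightarrow>
      (\<And>i. f i \<le> card {n. g i \<le> n \<and> n < g (Suc i) \<and> fst (z n)}) \<Longrightarrow> \<psi> z"
  shows "(\<forall>n. \<exists>A. finite A \<and> n \<le> card A \<and> P A) \<longleftrightarrow>
    (\<exists>z. \<psi> z \<and> (\<forall>p q. p \<le> q \<and> (\<forall>r. p < r \<and> r \<le> q \<longrightarrow> \<not> snd (z r)) \<longrightarrow>
      (\<exists>A. finite A \<and> P A \<and> (\<forall>r. p \<le> r \<and> r \<le> q \<and> fst (z r) \<longrightarrow> r \<in> A))))"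
proof
  assume big: "\<forall>n. \<exists>A. finite A \<and> n \<le> card A \<and> P A"
  \<comment> \<open>\<open>fst (h i)\<close> is the start of block \<open>i\<close> and
    \<open>snd (h i)\<close> the member of the family used there. Its \<open>fst (h i)\<close>
    surplus elements make up for those lying before the block, and the next block starts beyond its
    last element.\<close>
  let ?I = "\<lambda>i (h :: nat \<times> nat set). (i = 0 \<longrightarrow> fst h = 0) \<and>
      finite (snd h) \<and> fst h + f i \<le> card (snd h) \<and> P (snd h)"
  have "\<exists>h. \<forall>i. ?I i (h i) \<and> (fst (h i) < fst (h (Suc i)) \<and> snd (h i) \<subseteq> {..<fst (h (Suc i))})"
  proof (rule dependent_nat_choice)
    show "\<exists>h. ?I 0 h" using big by fastforce
    fix h :: "nat \<times> nat set" and i assume h: "?I i h"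
    obtain k where k: "\<forall>a\<in>snd h. a < k" using h finite_nat_set_iff_bounded by blast
    obtain A where "finite A" "(fst h + k + 1) + f (Suc i) \<le> card A" "P A" using big by blast
    then show "\<exists>h'. ?I (Suc i) h' \<and> (fst h < fst h' \<and> snd h \<subseteq> {..<fst h'})"
      using k by (intro exI[of _ "(fst h + k + 1, A)"]) auto
  qed
  then obtain h where h_all: "\<forall>i. ?I i (h i) \<and>
      (fst (h i) < fst (h (Suc i)) \<and> snd (h i) \<subseteq> {..<fst (h (Suc i))})"
    by (rule exE)
  have h: "fst (h 0) = 0"
      "\<And>i. finite (snd (h i)) \<and> fst (h i) + f i \<le> card (snd (h i)) \<and> P (snd (h i))"
      "\<And>i. fst (h i) < fst (h (Suc i)) \<and> snd (h i) \<subseteq> {..<fst (h (Suc i))}"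
    using h_all by simp_all
  define g where "g i = fst (h i)" for i
  define A where "A i = snd (h i)" for i
  have g: "strict_mono g" "g 0 = 0" using h by (simp_all add: g_def strict_mono_Suc_iff)
  have A: "finite (A i)" "g i + f i \<le> card (A i)" "P (A i)" "A i \<subseteq> {..<g (Suc i)}" for i
    using h(2,3)[of i] by (simp_all add: A_def g_def)
  \<comment> \<open>A position is tested only against the set of its own block, so each block is
    covered by a single member of the family.\<close>
  define z where "z n = (n \<in> A (block_of g n), n \<in> range g)" for n
  have "\<psi> z"
  proof (rule complete[OF g])
    fix i
    have "fst (z n) \<longleftrightarrow> n \<in> A i" if "g i \<le> n" "n < g (Suc i)" for n
      using that by (simp add: z_def block_of_eqI[OF g(1)])
    then have "{n. g i \<le> n \<and> n < g (Suc i) \<and> fst (z n)} = A i - {..<g i}"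
      using A(4)[of i] by auto
    moreover have "card (A i) - card {..<g i} \<le> card (A i - {..<g i})"
      by (rule diff_card_le_card_Diff) simp
    ultimately show "f i \<le> card {n. g i \<le> n \<and> n < g (Suc i) \<and> fst (z n)}"
      using A(2)[of i] by simp
  qed (simp add: z_def)
  moreover have "\<exists>B. finite B \<and> P B \<and> (\<forall>r. p \<le> r \<and> r \<le> q \<and> fst (z r) \<longrightarrow> r \<in> B)"
    if "p \<le> q" "\<forall>r. p < r \<and> r \<le> q \<longrightarrow> \<not> snd (z r)" for p q
  proof -
    define i where "i = block_of g p"
    have "q < g (Suc i)"
    proof (rule ccontr)
      assume "\<not> q < g (Suc i)"
      then show False
        using that(2)[rule_format, of "g (Suc i)"] block_of_less[OF g(1), of p, folded i_def] by (simp add: z_def)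
    qed
    then have "block_of g r = i" if "p \<le> r" "r \<le> q" for r
      using block_of_le[OF g, of p, folded i_def] that by (intro block_of_eqI[OF g(1)]) auto
    then have "\<forall>r. p \<le> r \<and> r \<le> q \<and> fst (z r) \<longrightarrow> r \<in> A i"
      unfolding z_def fst_conv by metis
    then show ?thesis using A(1,3)[of i] by blast
  qed
  ultimately show "\<exists>z. \<psi> z \<and> (\<forall>p q. p \<le> q \<and> (\<forall>r. p < r \<and> r \<le> q \<longrightarrow> \<not> snd (z r)) \<longrightarrow>
      (\<exists>A. finite A \<and> P A \<and> (\<forall>r. p \<le> r \<and> r \<le> q \<and> fst (z r) \<longrightarrow> r \<in> A)))"
    by (intro exI[of _ z] conjI allI impI; simp)
next
  assume "\<exists>z. \<psi> z \<and> (\<forall>p q. p \<le> q \<and> (\<forall>r. p < r \<and> r \<le> q \<longrightarrow> \<not> snd (z r)) \<longrightarrow>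
      (\<exists>A. finite A \<and> P A \<and> (\<forall>r. p \<le> r \<and> r \<le> q \<and> fst (z r) \<longrightarrow> r \<in> A)))"
  then obtain z where z: "\<psi> z" and blocks: "\<forall>p q. p \<le> q \<and> (\<forall>r. p < r \<and> r \<le> q \<longrightarrow> \<not> snd (z r)) \<longrightarrow>
      (\<exists>A. finite A \<and> P A \<and> (\<forall>r. p \<le> r \<and> r \<le> q \<and> fst (z r) \<longrightarrow> r \<in> A))"
    by (elim exE conjE)
  show "\<forall>n. \<exists>A. finite A \<and> n \<le> card A \<and> P A"
  proof
    fix n
    obtain p q where pq: "p \<le> q \<and> (\<forall>r. p < r \<and> r \<le> q \<longrightarrow> \<not> snd (z r))"
      and n: "n \<le> card {r. p \<le> r \<and> r \<le> q \<and> fst (z r)}"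
      using sound[OF z, of n] by blast
    obtain A where A: "finite A" "P A" "\<And>r. p \<le> r \<and> r \<le> q \<and> fst (z r) \<Longrightarrow> r \<in> A"
      using blocks[rule_format, OF pq] by blast
    have "card {r. p \<le> r \<and> r \<le> q \<and> fst (z r)} \<le> card A"
      using A by (intro card_mono) auto
    then show "\<exists>A. finite A \<and> n \<le> card A \<and> P A" using n A by (meson le_trans)
  qed
qed

section \<open>Elimination of the bounding quantifier\<close>

context omega_language
begin

text \<open>The right-hand side of \<open>unbounded_sets_iff\<close> quantifies over a word
  \<open>z\<close>, two end points and a finite set, all of which is available without the bounding
  quantifier.\<close>

lemma expressible_bounding:
  fixes \<psi> :: "(bool \<times> bool) word \<Rightarrow> bool"
  assumes def: "word_definable UNIV \<psi>"
    and sound: "\<And>z m. \<psi> z \<Longrightarrow> \<exists>p q. p \<le> q \<and> (\<forall>r. p < r \<and> r \<le> q \<longrightarrow> \<not> snd (z r)) \<and>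
      m \<le> card {r. p \<le> r \<and> r \<le> q \<and> fst (z r)}"
    and complete: "\<And>z g. strict_mono g \<Longrightarrow> g 0 = 0 \<Longrightarrow> (\<And>n. snd (z n) \<longleftrightarrow> n \<in> range g) \<Longrightarrow>
      (\<And>i. f i \<le> card {n. g i \<le> n \<and> n < g (Suc i) \<and> fst (z n)}) \<Longrightarrow> \<psi> z"
    and P: "expressible P"
  shows "expressible (\<lambda>s S. \<forall>n. \<exists>A. finite A \<and> n \<le> card A \<and> P s (S(X := A)))"
proof -
  \<comment> \<open>A concrete formula for \<open>P\<close> bounds the variables on which
    \<open>P\<close> depends. The variables coding \<open>z\<close> and the end points are chosen
    outside of it, and \<open>sat_cong\<close> then shows that assigning them leaves
    \<open>P\<close> unchanged.\<close>
  obtain \<phi> :: "'a formula" where \<phi>: "\<And>s S. sat \<Sigma> L s S \<phi> \<longleftrightarrow> P s S"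
    using P unfolding expressible_def by metis
  obtain Y :: "bool \<times> bool \<Rightarrow> nat" where Y: "inj_on Y UNIV" "Y ` UNIV \<inter> (insert X (free_sets \<Sigma> \<phi>)) = {}"
    using ex_inj_on_avoiding[of "UNIV :: (bool \<times> bool) set" "insert X (free_sets \<Sigma> \<phi>)"]
      finite_free_sets[OF finite_alphabet] by auto
  obtain k where k: "\<forall>x\<in>free_elems \<phi>. x < k"
    using finite_free_elems finite_nat_set_iff_bounded by blast
  define p q r where "p = k" and "q = k + 1" and "r = k + 2"
  have pqr: "p \<noteq> q" "p \<noteq> r" "q \<noteq> r" by (simp_all add: p_def q_def r_def)
  have fresh: "p \<notin> free_elems \<phi>" "q \<notin> free_elems \<phi>"
    using k by (auto simp: p_def q_def)
  have Y_ne: "Y d \<noteq> X" for d using Y(2) by auto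
  obtain Q where Q': "expressible Q \<and>
      (\<forall>w\<in>omega_words UNIV. \<forall>s S. (\<forall>c\<in>UNIV. S (Y c) = {n. w n = c}) \<longrightarrow> (Q s S \<longleftrightarrow> \<psi> w))"
    using def[unfolded word_definable_def, THEN spec[of _ Y]] by (rule exE)
  then have Q: "expressible Q" "\<And>x s S. (\<And>c. S (Y c) = {n. x n = c}) \<Longrightarrow> Q s S \<longleftrightarrow> \<psi> x"
    by (simp_all add: omega_words_def)
  define first_at second_at where "first_at S n \<longleftrightarrow> (\<exists>d\<in>UNIV. fst d \<and> n \<in> S (Y d))"
    and "second_at S n \<longleftrightarrow> (\<exists>d\<in>UNIV. snd d \<and> n \<in> S (Y d))" for S and n :: nat
  \<comment> \<open>Only \<open><\<close> and \<open>=\<close> are atomic, so non-strict comparisons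
    are written as negated strict ones.\<close>
  define free_of_boundaries where "free_of_boundaries = (\<lambda>(s :: nat \<Rightarrow> nat) (S :: nat \<Rightarrow> nat set).
      \<not> s q < s p \<and> (\<forall>c. (\<lambda>s S. s p < s r \<and> \<not> s q < s r \<longrightarrow>
        \<not> second_at S (s r)) (s(r := c)) S))"
  define covered where "covered = (\<lambda>(s :: nat \<Rightarrow> nat) (S :: nat \<Rightarrow> nat set).
      finite (S X) \<and> P s S \<and> (\<forall>c. (\<lambda>s S. \<not> s r < s p \<and> \<not> s q < s r \<and> first_at S (s r) \<longrightarrow>
        s r \<in> S X) (s(r := c)) S))"
  define R where "R = (\<lambda>s S. Q s S \<and> (\<forall>a. (\<lambda>s S. \<forall>b. (\<lambda>s S. free_of_boundaries s S \<longrightarrow>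
      (\<exists>A. covered s (S(X := A)))) (s(q := b)) S) (s(p := a)) S))"
  define up where "up x S Z = (if Z \<in> Y ` UNIV then {n. Y (x n) = Z} else S Z)"
    for x and S :: "nat \<Rightarrow> nat set" and Z
  have "expressible R"
    unfolding R_def free_of_boundaries_def covered_def first_at_def second_at_def
    by (intro expressible_conj expressible_all_elem expressible_imp expressible_not
        expressible_ex_set expressible_finite expressible_bex expressible_const
        expressible_atoms P Q finite_UNIV)
  then have "expressible (\<lambda>s S. \<exists>x\<in>omega_words UNIV. R s (up x S))"
    unfolding up_def[abs_def] by (rule expressible_ex_word[OF finite Y(1)])
  moreover have "R s (up x S) \<longleftrightarrow> \<psi> x \<and> (\<forall>a b. a \<le> b \<and> (\<forall>c. a < c \<and> c \<le> b \<longrightarrow> \<not> snd (x c)) \<longrightarrow>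
      (\<exists>A. finite A \<and> P s (S(X := A)) \<and> (\<forall>c. a \<le> c \<and> c \<le> b \<and> fst (x c) \<longrightarrow> c \<in> A)))" for s S x
  proof -
    have Y_up: "up x S (Y c) = {n. x n = c}" for c
      by (auto simp: up_def inj_eq[OF Y(1)])
    have at: "second_at (up x S) n \<longleftrightarrow> snd (x n)" "first_at (up x S) n \<longleftrightarrow> fst (x n)"
      "first_at ((up x S)(X := A)) n \<longleftrightarrow> fst (x n)" for n A
      unfolding first_at_def second_at_def using Y_ne by (auto simp: Y_up simp del: split_paired_Ex)
    have "P (s(p := a, q := b)) ((up x S)(X := A)) \<longleftrightarrow> P s (S(X := A))" for a b A
    proof -
      have "sat \<Sigma> L (s(p := a, q := b)) ((up x S)(X := A)) \<phi> \<longleftrightarrow> sat \<Sigma> L s (S(X := A)) \<phi>"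
        using fresh Y(2) by (intro sat_cong) (auto simp: up_def)
      then show ?thesis by (simp only: \<phi>)
    qed
    moreover have "Q s (up x S) \<longleftrightarrow> \<psi> x" by (rule Q(2)) (rule Y_up)
    ultimately show ?thesis
      unfolding R_def free_of_boundaries_def covered_def
      using pqr by (simp add: at not_less)
  qed
  ultimately have "expressible (\<lambda>s S. \<exists>x. \<psi> x \<and>
      (\<forall>a b. a \<le> b \<and> (\<forall>c. a < c \<and> c \<le> b \<longrightarrow> \<not> snd (x c)) \<longrightarrow>
      (\<exists>A. finite A \<and> P s (S(X := A)) \<and> (\<forall>c. a \<le> c \<and> c \<le> b \<and> fst (x c) \<longrightarrow> c \<in> A))))"
    by (simp add: omega_words_def)
  moreover have "(\<forall>n. \<exists>A. finite A \<and> n \<le> card A \<and> P s (S(X := A))) \<longleftrightarrow> (\<exists>x. \<psi> x \<and>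
      (\<forall>a b. a \<le> b \<and> (\<forall>c. a < c \<and> c \<le> b \<longrightarrow> \<not> snd (x c)) \<longrightarrow>
      (\<exists>A. finite A \<and> P s (S(X := A)) \<and> (\<forall>c. a \<le> c \<and> c \<le> b \<and> fst (x c) \<longrightarrow> c \<in> A))))" for s S
  proof (rule unbounded_sets_iff[of \<psi> f "\<lambda>A. P s (S(X := A))"])
    fix z m assume "\<psi> z"
    then show "\<exists>p q. p \<le> q \<and> (\<forall>r. p < r \<and> r \<le> q \<longrightarrow> \<not> snd (z r)) \<and>
        m \<le> card {r. p \<le> r \<and> r \<le> q \<and> fst (z r)}" by (rule sound)
  next
    fix z and g :: "nat \<Rightarrow> nat"
    assume "strict_mono g" "g 0 = 0" "\<And>n. snd (z n) \<longleftrightarrow> n \<in> range g"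
      "\<And>i. f i \<le> card {n. g i \<le> n \<and> n < g (Suc i) \<and> fst (z n)}"
    then show "\<psi> z" by (rule complete)
  qed
  ultimately show ?thesis by (simp only:)
qed

text \<open>Induction on the formula translates MSO+U: every connective and quantifier except the
  bounding one is shared by both logics, and \<open>bounding\<close> supplies that case.\<close>

lemma MSO_L_definable_if_expressible_bounding:
  assumes bounding: "\<And>P X. expressible P \<Longrightarrow>
      expressible (\<lambda>s S. \<forall>n. \<exists>A. finite A \<and> n \<le> card A \<and> P s (S(X := A)))"
    and K: "MSO_U_definable \<Gamma> K"
  shows "MSO_L_definable \<Sigma> L \<Gamma> K"
proof -
  have translate: "expressible (\<lambda>s S. sat {} {} s S \<phi>)" if "lang_free \<phi>" for \<phi> :: "unit formula"
    using that
  proof (induction \<phi>)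
    case (Ex_elem x \<phi>)
    then have "expressible (\<lambda>s S. sat {} {} s S \<phi>)" by simp
    from expressible_ex_elem[OF this, of x] show ?case by simp
  next
    case (All_elem x \<phi>)
    then have "expressible (\<lambda>s S. sat {} {} s S \<phi>)" by simp
    from expressible_all_elem[OF this, of x] show ?case by simp
  next
    case (Ex_set X \<phi>)
    then have "expressible (\<lambda>s S. sat {} {} s S \<phi>)" by simp
    from expressible_ex_set[OF this, of X] show ?case by simp
  next
    case (All_set X \<phi>)
    then have "expressible (\<lambda>s S. sat {} {} s S \<phi>)" by simp
    from expressible_all_set[OF this, of X] show ?case by simp
  next
    case (Bounding X \<phi>)
    then have "expressible (\<lambda>s S. sat {} {} s S \<phi>)" by simp
    from bounding[OF this, of X] show ?case by simp
  next
    case (Neg \<phi>)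
    then have "expressible (\<lambda>s S. sat {} {} s S \<phi>)" by simp
    from expressible_not[OF this] show ?case by simp
  next
    case (Conj \<phi> \<psi>)
    then have "expressible (\<lambda>s S. sat {} {} s S \<phi>)" "expressible (\<lambda>s S. sat {} {} s S \<psi>)" by simp_all
    from expressible_conj[OF this] show ?case by simp
  next
    case (Disj \<phi> \<psi>)
    then have "expressible (\<lambda>s S. sat {} {} s S \<phi>)" "expressible (\<lambda>s S. sat {} {} s S \<psi>)" by simp_all
    from expressible_disj[OF this] show ?case by simp
  qed (simp_all add: expressible_atoms)
  obtain \<phi> :: "unit formula" and Y where lf: "lang_free \<phi>" and d: "defines_language {} {} \<phi> Y \<Gamma> K"
    using K unfolding MSO_U_definable_def by blast
  obtain \<psi> :: "'a formula" where \<psi>: "bounding_free \<psi>" "\<And>s S. sat \<Sigma> L s S \<psi> \<longleftrightarrow> sat {} {} s S \<phi>"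
    using translate[OF lf] unfolding expressible_def by metis
  \<comment> \<open>\<open>\<psi>\<close> may have free variables besides the \<open>Y c\<close>.
    Given the word, its truth value does not depend on them, so binding them existentially changes
    nothing and yields admissible free variables.\<close>
  define ex_elems where "ex_elems xs \<chi> = foldr Ex_elem xs \<chi>" for xs and \<chi> :: "'a formula"
  define ex_sets where "ex_sets xs \<chi> = foldr Ex_set xs \<chi>" for xs and \<chi> :: "'a formula"
  have bf: "bounding_free (ex_elems xs \<chi>) \<longleftrightarrow> bounding_free \<chi>"
      "bounding_free (ex_sets xs \<chi>) \<longleftrightarrow> bounding_free \<chi>" for xs \<chi>
    unfolding ex_elems_def ex_sets_def by (induction xs) auto
  have fe: "free_elems (ex_elems xs \<chi>) = free_elems \<chi> - set xs"
      "free_elems (ex_sets xs \<chi>) = free_elems \<chi>" for xs \<chi>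
    unfolding ex_elems_def ex_sets_def by (induction xs) auto
  have fs: "free_sets \<Sigma> (ex_elems xs \<chi>) = free_sets \<Sigma> \<chi>"
      "free_sets \<Sigma> (ex_sets xs \<chi>) = free_sets \<Sigma> \<chi> - set xs" for xs \<chi>
    unfolding ex_elems_def ex_sets_def by (induction xs) auto
  have sat_elems: "sat \<Sigma> L s S (ex_elems xs \<chi>) \<longleftrightarrow> b"
    if "\<And>s. sat \<Sigma> L s S \<chi> \<longleftrightarrow> b" for xs \<chi> s S b
    unfolding ex_elems_def using that by (induction xs arbitrary: s) auto
  have sat_sets: "sat \<Sigma> L s S (ex_sets xs \<chi>) \<longleftrightarrow> b"
    if "\<And>S'. (\<And>c. c \<in> \<Gamma> \<Longrightarrow> S' (Y c) = S (Y c)) \<Longrightarrow> sat \<Sigma> L s S' \<chi> \<longleftrightarrow> b" "set xs \<inter> Y ` \<Gamma> = {}" for xs \<chi> s S b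
    unfolding ex_sets_def using that
  proof (induction xs arbitrary: S)
    case (Cons X xs)
    have "sat \<Sigma> L s (S(X := A)) (foldr Ex_set xs \<chi>) \<longleftrightarrow> b" for A
    proof (rule Cons.IH)
      fix S' assume "\<And>c. c \<in> \<Gamma> \<Longrightarrow> S' (Y c) = (S(X := A)) (Y c)"
      moreover have "Y c \<noteq> X" if "c \<in> \<Gamma>" for c using Cons.prems(2) that by auto
      ultimately show "sat \<Sigma> L s S' \<chi> \<longleftrightarrow> b" by (intro Cons.prems(1)) simp
    qed (use Cons.prems(2) in simp)
    then show ?case by simp
  qed simp
  obtain xs where xs: "set xs = free_elems \<psi>" using finite_free_elems finite_list by blast
  obtain Xs where Xs: "set Xs = free_sets \<Sigma> \<psi> - Y ` \<Gamma>"
    using finite_free_sets[OF finite_alphabet, of \<psi>] finite_list[of "free_sets \<Sigma> \<psi> - Y ` \<Gamma>"] by auto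
  let ?\<chi> = "ex_sets Xs (ex_elems xs \<psi>)"
  have "w \<in> K \<longleftrightarrow> sat \<Sigma> L s S ?\<chi>"
    if w: "w \<in> omega_words \<Gamma>" and S: "\<forall>c\<in>\<Gamma>. S (Y c) = {n. w n = c}" for w s S
  proof -
    have "sat \<Sigma> L s' S' \<psi> \<longleftrightarrow> w \<in> K" if "\<And>c. c \<in> \<Gamma> \<Longrightarrow> S' (Y c) = S (Y c)" for s' S'
      using d w S that unfolding defines_language_def \<psi>(2) by simp
    then have "sat \<Sigma> L s S ?\<chi> \<longleftrightarrow> w \<in> K"
      using Xs by (intro sat_sets sat_elems) auto
    then show ?thesis by simp
  qed
  then have "defines_language \<Sigma> L ?\<chi> Y \<Gamma> K"
    using d xs Xs unfolding defines_language_def by (auto simp: fe fs)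
  then show ?thesis unfolding MSO_L_definable_def using \<psi>(1) bf by blast
qed

end

section \<open>Equivalence of finite words\<close>

context neutral_language
begin

text \<open>\<open>None\<close> is a hole. The \<open>e\<close> behind the inserted word keeps the
  factor nonempty, so that even an empty \<open>u\<close> yields an infinite word; by neutrality it
  does not distort the resulting equivalence.\<close>

definition fill :: "(nat \<Rightarrow> 'a option) \<Rightarrow> 'a list \<Rightarrow> 'a word" where
  "fill C u = omega_concat (\<lambda>i. case C i of None \<Rightarrow> u @ [e] | Some a \<Rightarrow> [a])"

definition contexts :: "(nat \<Rightarrow> 'a option) set" where
  "contexts = omega_words (insert None (Some ` \<Sigma>))"

definition eqv :: "'a list \<Rightarrow> 'a list \<Rightarrow> bool" where
  "eqv u v \<longleftrightarrow> (\<forall>C\<in>contexts. fill C u \<in> L \<longleftrightarrow> fill C v \<in> L)"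

lemma eqv_sym: "eqv u v \<Longrightarrow> eqv v u"
  and eqv_trans: "eqv u v \<Longrightarrow> eqv v t \<Longrightarrow> eqv u t"
  by (auto simp: eqv_def)

lemma contexts_cases: "C \<in> contexts \<Longrightarrow> C i = None \<or> (\<exists>a\<in>\<Sigma>. C i = Some a)"
  by (auto simp: contexts_def omega_words_def image_subset_iff)

lemma eqv_core:
  assumes "set u \<subseteq> \<Sigma>" "set v \<subseteq> \<Sigma>" "core u = core v"
  shows "eqv u v"
  unfolding eqv_def fill_def
proof
  fix C assume "C \<in> contexts"
  then have C: "C i = None \<or> (\<exists>a\<in>\<Sigma>. C i = Some a)" for i by (rule contexts_cases)
  then have "set (case C i of None \<Rightarrow> x @ [e] | Some a \<Rightarrow> [a]) \<subseteq> \<Sigma>" if "set x \<subseteq> \<Sigma>" for i x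
    using that C[of i] by (cases "C i") auto
  then show "omega_concat (\<lambda>i. case C i of None \<Rightarrow> u @ [e] | Some a \<Rightarrow> [a]) \<in> L \<longleftrightarrow>
      omega_concat (\<lambda>i. case C i of None \<Rightarrow> v @ [e] | Some a \<Rightarrow> [a]) \<in> L"
    using assms by (intro omega_concat_core_cong infinite_all) (auto split: option.splits)
qed

lemma fill_omega_concat:
  assumes "\<And>i. D i \<noteq> []"
  shows "fill (omega_concat D) u =
    omega_concat (\<lambda>i. concat (map (\<lambda>c. case c of None \<Rightarrow> u @ [e] | Some a \<Rightarrow> [a]) (D i)))"
proof -
  have "concat (map (\<lambda>c. case c of None \<Rightarrow> u @ [e] | Some a \<Rightarrow> [a]) (D i)) \<noteq> []" for i
    using assms[of i] by (cases "D i") (auto split: option.splits)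
  then show ?thesis
    unfolding fill_def using assms by (simp flip: omega_concat_omega_concat add: omega_concat_map)
qed

text \<open>If each hole of a context is replaced by a hole followed by \<open>a\<close>, then
  filling the new context with \<open>u\<close> agrees, up to neutral letters, with filling the old
  one with \<open>u @ [a]\<close>.\<close>

lemma eqv_snoc:
  assumes "eqv u v" "set u \<subseteq> \<Sigma>" "set v \<subseteq> \<Sigma>" "a \<in> \<Sigma>"
  shows "eqv (u @ [a]) (v @ [a])"
  unfolding eqv_def
proof
  fix C assume C_in: "C \<in> contexts"
  then have C: "C i = None \<or> (\<exists>a\<in>\<Sigma>. C i = Some a)" for i by (rule contexts_cases)
  define D where "D i = (case C i of None \<Rightarrow> [None, Some a] | Some b \<Rightarrow> [Some b])" for i
  have D: "D i \<noteq> []" for i by (simp add: D_def split: option.splits)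
  have "omega_concat D \<in> contexts" unfolding contexts_def
  proof (rule omega_concat_in_omega_words)
    show "set (D i) \<subseteq> insert None (Some ` \<Sigma>)" for i using C[of i] assms(4) by (auto simp: D_def)
  qed (simp add: D)
  then have "fill (omega_concat D) u \<in> L \<longleftrightarrow> fill (omega_concat D) v \<in> L"
    using assms(1) by (simp add: eqv_def)
  moreover have "fill C (x @ [a]) \<in> L \<longleftrightarrow> fill (omega_concat D) x \<in> L" if "set x \<subseteq> \<Sigma>" for x
    unfolding fill_omega_concat[of D, OF D] unfolding fill_def
  proof (intro omega_concat_core_cong infinite_all)
    fix i
    show "set (case C i of None \<Rightarrow> (x @ [a]) @ [e] | Some a \<Rightarrow> [a]) \<subseteq> \<Sigma>"
      using C[of i] that assms(4) by (cases "C i") auto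
    show "set (concat (map (case_option (x @ [e]) (\<lambda>a. [a])) (D i))) \<subseteq> \<Sigma>"
      using C[of i] that assms(4) by (cases "C i") (auto simp: D_def)
    show "core (case C i of None \<Rightarrow> (x @ [a]) @ [e] | Some a \<Rightarrow> [a]) =
        core (concat (map (case_option (x @ [e]) (\<lambda>a. [a])) (D i)))"
      by (simp add: D_def split: option.splits)
    show "concat (map (case_option (x @ [e]) (\<lambda>a. [a])) (D i)) \<noteq> []"
      by (simp add: D_def split: option.splits)
  qed (simp split: option.splits)
  ultimately show "fill C (u @ [a]) \<in> L \<longleftrightarrow> fill C (v @ [a]) \<in> L" using assms by simp
qed

text \<open>For one pair \<open>(a, b)\<close>, all factors where \<open>a\<close> has to become
  \<open>b\<close> are made the holes of a single context, so one equivalence exchanges them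
  simultaneously, however many there are. Induction handles the finitely many pairs in turn.\<close>

lemma finite_swap:
  assumes "finite F" "\<And>a b. (a, b) \<in> F \<Longrightarrow> eqv a b"
    and "\<And>i. set (p i) \<subseteq> \<Sigma>" "\<And>i. set (q i) \<subseteq> \<Sigma>"
    and "\<And>i. p i = q i \<or> (p i, q i) \<in> F"
  shows "omega_concat (\<lambda>i. p i @ [e]) \<in> L \<longleftrightarrow> omega_concat (\<lambda>i. q i @ [e]) \<in> L"
  using assms
proof (induction F arbitrary: p rule: finite_induct)
  case empty
  then have "p = q" by auto
  then show ?case by simp
next
  case (insert ab F)
  obtain a b where ab: "ab = (a, b)" by (cases ab)
  let ?H = "\<lambda>i. (p i, q i) = (a, b)"
  define r where "r i = (if ?H i then b else p i)" for i
  define D where "D i = (if ?H i then [None] else map Some (p i @ [e]))" for i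
  have D: "D i \<noteq> []" for i by (simp add: D_def)
  have some: "concat (map (\<lambda>c. case c of None \<Rightarrow> u | Some a \<Rightarrow> [a]) (map Some l)) = l" for u l :: "'a list"
    by (induction l) auto
  have "omega_concat D \<in> contexts" unfolding contexts_def
  proof (rule omega_concat_in_omega_words)
    show "set (D i) \<subseteq> insert None (Some ` \<Sigma>)" for i using insert.prems(2)[of i] by (auto simp: D_def)
  qed (simp add: D)
  then have "fill (omega_concat D) a \<in> L \<longleftrightarrow> fill (omega_concat D) b \<in> L"
    using insert.prems(1) by (auto simp: eqv_def ab)
  moreover have "fill (omega_concat D) x = omega_concat (\<lambda>i. if ?H i then x @ [e] else p i @ [e])" for x
    unfolding fill_omega_concat[of D, OF D]
    by (intro arg_cong[where f = omega_concat] ext)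
      (auto simp: D_def some simp del: map_append map_map)
  moreover have "(\<lambda>i. if ?H i then a @ [e] else p i @ [e]) = (\<lambda>i. p i @ [e])" by auto
  moreover have "(\<lambda>i. if ?H i then b @ [e] else p i @ [e]) = (\<lambda>i. r i @ [e])" by (auto simp: r_def)
  moreover have "omega_concat (\<lambda>i. r i @ [e]) \<in> L \<longleftrightarrow> omega_concat (\<lambda>i. q i @ [e]) \<in> L"
  proof (rule insert.IH)
    show "set (r i) \<subseteq> \<Sigma>" for i using insert.prems(2)[of i] insert.prems(3)[of i] by (auto simp: r_def)
    show "r i = q i \<or> (r i, q i) \<in> F" for i using insert.prems(4)[of i] by (auto simp: r_def ab)
  qed (use insert.prems in auto)
  ultimately show ?case by simp
qed

text \<open>Over a finite alphabet there are finitely many cores of length at most \<open>m\<close>,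
  hence finitely many pairs of corresponding cores, and \<open>finite_swap\<close> applies. This is
  where boundedness of the blocks is exploited.\<close>

lemma blockwise_eqv_bounded:
  assumes g: "strict_mono g" "g 0 = 0"
    and xy: "x \<in> omega_words \<Sigma>" "y \<in> omega_words \<Sigma>"
    and eqv: "\<And>i. eqv (map x [g i..<g (Suc i)]) (map y [g i..<g (Suc i)])"
    and len: "\<And>i. length (core (map x [g i..<g (Suc i)])) \<le> m"
      "\<And>i. length (core (map y [g i..<g (Suc i)])) \<le> m"
  shows "x \<in> L \<longleftrightarrow> y \<in> L"
proof -
  define p where "p i = core (map x [g i..<g (Suc i)])" for i
  define q where "q i = core (map y [g i..<g (Suc i)])" for i
  define T where "T = {u. set u \<subseteq> \<Sigma> \<and> length u \<le> m}"
  have sets: "set (map z [i..<j]) \<subseteq> \<Sigma>" if "z \<in> omega_words \<Sigma>" for z i j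
    using that by (auto simp: omega_words_def)
  have sets_core: "set (core (map z [i..<j])) \<subseteq> \<Sigma>" if "z \<in> omega_words \<Sigma>" for z i j
    using sets[OF that] set_core by blast
  have fT: "finite T" unfolding T_def by (rule finite_lists_length_le[OF finite_alphabet])
  have pq: "p i \<in> T" "q i \<in> T" for i
    using sets_core len xy by (simp_all add: p_def q_def T_def)
  have "eqv (p i) (q i)" for i
  proof (rule eqv_trans[OF eqv_trans])
    show "eqv (p i) (map x [g i..<g (Suc i)])"
      unfolding p_def by (intro eqv_core sets sets_core xy) simp
    show "eqv (map y [g i..<g (Suc i)]) (q i)"
      unfolding q_def by (intro eqv_core sets sets_core xy) simp
  qed (rule eqv)
  then have "omega_concat (\<lambda>i. p i @ [e]) \<in> L \<longleftrightarrow> omega_concat (\<lambda>i. q i @ [e]) \<in> L"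
    using fT pq by (intro finite_swap[where F = "(T \<times> T) \<inter> {(a, b). eqv a b}"]) (auto simp: T_def)
  moreover have "x \<in> L \<longleftrightarrow> omega_concat (\<lambda>i. p i @ [e]) \<in> L"
    using sets_core xy by (intro word_core_cong[OF g]) (auto simp: p_def)
  moreover have "y \<in> L \<longleftrightarrow> omega_concat (\<lambda>i. q i @ [e]) \<in> L"
    using sets_core xy by (intro word_core_cong[OF g]) (auto simp: q_def)
  ultimately show ?thesis by simp
qed

section \<open>Writing finite words on sparse sets of positions\<close>

lemma core_map_outside:
  assumes "a \<le> a'" "a' \<le> b'" "b' \<le> b"
    and "\<And>n. a \<le> n \<Longrightarrow> n < b \<Longrightarrow> n < a' \<or> b' \<le> n \<Longrightarrow> w n = e"
  shows "core (map w [a..<b]) = core (map w [a'..<b'])"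
proof -
  have "[a..<b] = [a..<a'] @ [a'..<b'] @ [b'..<b]"
    using assms(1-3) by (metis le_trans le_Suc_ex upt_add_eq_append)
  moreover have "core (map w [a..<a']) = []" "core (map w [b'..<b]) = []"
    using assms by (auto simp: core_Nil_iff)
  ultimately show ?thesis by simp
qed

lemma core_map_cong:
  assumes "\<And>n. a \<le> n \<Longrightarrow> n < b \<Longrightarrow> w n = w' n"
  shows "core (map w [a..<b]) = core (map w' [a..<b])"
proof -
  have "map w [a..<b] = map w' [a..<b]" using assms by simp
  then show ?thesis by (simp only:)
qed

lemma length_core_le:
  assumes "\<And>n. a \<le> n \<Longrightarrow> n < b \<Longrightarrow> w n \<noteq> e \<Longrightarrow> n \<in> A" "finite A"
  shows "length (core (map w [a..<b])) \<le> card A"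
proof -
  have "length (core (map w [a..<b])) = length (filter (\<lambda>n. w n \<noteq> e) [a..<b])"
    by (simp add: core_def filter_map comp_def)
  also have "\<dots> = card (set (filter (\<lambda>n. w n \<noteq> e) [a..<b]))"
    by (rule distinct_card[symmetric]) simp
  also have "\<dots> \<le> card A" using assms by (intro card_mono) auto
  finally show ?thesis .
qed

text \<open>The letters of \<open>u\<close> are put greedily on the positions of \<open>Z\<close>,
  and \<open>e\<close> everywhere else. As \<open>u\<close> may contain \<open>e\<close> and may be
  shorter than the room available, only cores can be compared.\<close>

lemma ex_placement:
  assumes "distinct xs" "length u \<le> card (Z \<inter> set xs)" "set u \<subseteq> \<Sigma>"
  shows "\<exists>y\<in>omega_words \<Sigma>. (\<forall>n. y n \<noteq> e \<longrightarrow> n \<in> Z) \<and> core (map y xs) = core u"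
  using assms
proof (induction xs arbitrary: u)
  case Nil
  then show ?case by (intro bexI[of _ "\<lambda>_. e"]) (auto simp: omega_words_def)
next
  case (Cons p xs)
  have upd: "y(p := a) \<in> omega_words \<Sigma>" "map (y(p := a)) (p # xs) = a # map y xs"
    if "y \<in> omega_words \<Sigma>" "a \<in> \<Sigma>" for y a
    using that Cons.prems(1) by (auto simp: omega_words_def)
  show ?case
  proof (cases "p \<in> Z \<and> u \<noteq> []")
    case True
    then obtain a u' where u: "u = a # u'" by (cases u) auto
    have "Z \<inter> set (p # xs) = insert p (Z \<inter> set xs)" "p \<notin> Z \<inter> set xs" using True Cons.prems(1) by auto
    then have "length u' \<le> card (Z \<inter> set xs)" using Cons.prems(2) u by simp
    then obtain y where y: "y \<in> omega_words \<Sigma>" "\<forall>n. y n \<noteq> e \<longrightarrow> n \<in> Z" "core (map y xs) = core u'"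
      using Cons.IH[of u'] Cons.prems u by auto
    have "a \<in> \<Sigma>" using Cons.prems(3) u by simp
    show ?thesis
    proof (intro bexI[of _ "y(p := a)"] conjI)
      show "core (map (y(p := a)) (p # xs)) = core u"
        unfolding upd(2)[OF y(1) \<open>a \<in> \<Sigma>\<close>] using y(3) u by simp
    qed (use y True upd(1)[OF y(1) \<open>a \<in> \<Sigma>\<close>] in auto)
  next
    case False
    have "length u \<le> card (Z \<inter> set xs)" using False Cons.prems(2) by auto
    then obtain y where y: "y \<in> omega_words \<Sigma>" "\<forall>n. y n \<noteq> e \<longrightarrow> n \<in> Z" "core (map y xs) = core u"
      using Cons.IH[of u] Cons.prems by auto
    show ?thesis
    proof (intro bexI[of _ "y(p := e)"] conjI)
      show "core (map (y(p := e)) (p # xs)) = core u"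
        unfolding upd(2)[OF y(1) e_in] using y(3) by simp
    qed (use y upd(1)[OF y(1) e_in] in auto)
  qed
qed

lemma ex_block_placement:
  assumes g: "strict_mono g" "g 0 = 0"
    and u: "\<And>i. set (u i) \<subseteq> \<Sigma>" "\<And>i. length (u i) \<le> card {n. g i \<le> n \<and> n < g (Suc i) \<and> Z n}"
  shows "\<exists>x\<in>omega_words \<Sigma>. (\<forall>n. x n \<noteq> e \<longrightarrow> Z n) \<and> (\<forall>i. core (map x [g i..<g (Suc i)]) = core (u i))"
proof -
  have "\<exists>y\<in>omega_words \<Sigma>. (\<forall>n. y n \<noteq> e \<longrightarrow> n \<in> Collect Z) \<and> core (map y [g i..<g (Suc i)]) = core (u i)" for i
  proof (rule ex_placement)
    have "Collect Z \<inter> set [g i..<g (Suc i)] = {n. g i \<le> n \<and> n < g (Suc i) \<and> Z n}" by auto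
    then show "length (u i) \<le> card (Collect Z \<inter> set [g i..<g (Suc i)])" using u(2)[of i] by simp
  qed (simp_all add: u(1))
  then obtain y where y: "\<And>i. y i \<in> omega_words \<Sigma> \<and> (\<forall>n. y i n \<noteq> e \<longrightarrow> n \<in> Collect Z) \<and>
      core (map (y i) [g i..<g (Suc i)]) = core (u i)" by metis
  define x where "x n = y (block_of g n) n" for n
  have "x n \<in> \<Sigma>" for n unfolding x_def using y omega_wordsD by blast
  then have "x \<in> omega_words \<Sigma>" by (auto simp: omega_words_def)
  moreover have "\<forall>n. x n \<noteq> e \<longrightarrow> Z n" using y by (auto simp: x_def)
  moreover have "core (map x [g i..<g (Suc i)]) = core (u i)" for i
  proof -
    have "core (map x [g i..<g (Suc i)]) = core (map (y i) [g i..<g (Suc i)])"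
      by (rule core_map_cong) (simp add: x_def block_of_eqI[OF g(1)])
    then show ?thesis using y by simp
  qed
  ultimately show ?thesis by blast
qed

text \<open>The two conditions on \<open>\<psi>\<close> leave a gap: where the blocks are unbounded
  but do not reach the sizes \<open>f i\<close>, either truth value is allowed. This freedom is what
  makes such a \<open>\<psi>\<close> obtainable from \<open>L\<close>.\<close>

definition unboundedness_test :: "((bool \<times> bool) word \<Rightarrow> bool) \<Rightarrow> (nat \<Rightarrow> nat) \<Rightarrow> bool" where
  "unboundedness_test \<psi> f \<longleftrightarrow> word_definable UNIV \<psi> \<and>
     (\<forall>z m. \<psi> z \<longrightarrow> (\<exists>p q. p \<le> q \<and> (\<forall>r. p < r \<and> r \<le> q \<longrightarrow> \<not> snd (z r)) \<and>
        m \<le> card {r. p \<le> r \<and> r \<le> q \<and> fst (z r)})) \<and>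
     (\<forall>z g. strict_mono g \<longrightarrow> g 0 = 0 \<longrightarrow> (\<forall>n. snd (z n) \<longleftrightarrow> n \<in> range g) \<longrightarrow>
        (\<forall>i. f i \<le> card {n. g i \<le> n \<and> n < g (Suc i) \<and> fst (z n)}) \<longrightarrow> \<psi> z)"

text \<open>Soundness is put contrapositively, with a uniform bound \<open>m\<close> on all
  boundary-free intervals, because both tests are refuted on bounded blocks.\<close>

lemma unboundedness_testI:
  assumes "word_definable UNIV \<psi>"
    and "\<And>z m. \<psi> z \<Longrightarrow>
      (\<And>p q. p \<le> q \<Longrightarrow> (\<And>r. p < r \<Longrightarrow> r \<le> q \<Longrightarrow> \<not> snd (z r)) \<Longrightarrow>
        card {r. p \<le> r \<and> r \<le> q \<and> fst (z r)} \<le> m) \<Longrightarrow> False"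
    and "\<And>z g. strict_mono g \<Longrightarrow> g 0 = 0 \<Longrightarrow> (\<And>n. snd (z n) \<longleftrightarrow> n \<in> range g) \<Longrightarrow>
      (\<And>i. f i \<le> card {n. g i \<le> n \<and> n < g (Suc i) \<and> fst (z n)}) \<Longrightarrow> \<psi> z"
  shows "unboundedness_test \<psi> f"
  unfolding unboundedness_test_def
proof (intro conjI allI impI)
  fix z m
  assume "\<psi> z"
  show "\<exists>p q. p \<le> q \<and> (\<forall>r. p < r \<and> r \<le> q \<longrightarrow> \<not> snd (z r)) \<and>
      m \<le> card {r. p \<le> r \<and> r \<le> q \<and> fst (z r)}"
  proof (rule ccontr)
    assume neg: "\<nexists>p q. p \<le> q \<and> (\<forall>r. p < r \<and> r \<le> q \<longrightarrow> \<not> snd (z r)) \<and>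
        m \<le> card {r. p \<le> r \<and> r \<le> q \<and> fst (z r)}"
    show False
    proof (rule assms(2)[OF \<open>\<psi> z\<close>])
      fix p q :: nat
      assume "p \<le> q" "\<And>r. p < r \<Longrightarrow> r \<le> q \<Longrightarrow> \<not> snd (z r)"
      then have "\<not> m \<le> card {r. p \<le> r \<and> r \<le> q \<and> fst (z r)}" using neg by blast
      then show "card {r. p \<le> r \<and> r \<le> q \<and> fst (z r)} \<le> m" by simp
    qed
  qed
next
  fix z g
  assume "strict_mono g" "g 0 = (0::nat)" "\<forall>n. snd (z n) \<longleftrightarrow> n \<in> range g"
    "\<forall>i. f i \<le> card {n. g i \<le> n \<and> n < g (Suc i) \<and> fst (z n)}"
  then show "\<psi> z" by (intro assms(3)[of g z]) simp_all
qed (rule assms(1))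

lemma MSO_L_definable_if_unboundedness_test:
  assumes "unboundedness_test \<psi> f" "MSO_U_definable \<Gamma> K"
  shows "MSO_L_definable \<Sigma> L \<Gamma> K"
  using _ assms(2)
proof (rule MSO_L_definable_if_expressible_bounding)
  fix P X
  assume P: "expressible P"
  show "expressible (\<lambda>s S. \<forall>n. \<exists>A. finite A \<and> n \<le> card A \<and> P s (S(X := A)))"
    using _ _ _ P
  proof (rule expressible_bounding)
    show "word_definable UNIV \<psi>" using assms(1) by (simp add: unboundedness_test_def)
    show "\<exists>p q. p \<le> q \<and> (\<forall>r. p < r \<and> r \<le> q \<longrightarrow> \<not> snd (z r)) \<and>
        m \<le> card {r. p \<le> r \<and> r \<le> q \<and> fst (z r)}" if "\<psi> z" for z m
      using assms(1) that by (simp add: unboundedness_test_def)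
    show "\<psi> z" if "strict_mono g" "g 0 = 0" "\<And>n. snd (z n) \<longleftrightarrow> n \<in> range g"
      "\<And>i. f i \<le> card {n. g i \<le> n \<and> n < g (Suc i) \<and> fst (z n)}" for z g
      using assms(1) that by (simp add: unboundedness_test_def)
  qed
qed

end

section \<open>Finitely many classes\<close>

context neutral_language
begin

definition finite_index :: "'a list set \<Rightarrow> bool" where
  "finite_index T \<longleftrightarrow> finite T \<and> T \<subseteq> lists \<Sigma> \<and> (\<forall>u\<in>lists \<Sigma>. \<exists>t\<in>T. eqv u t)"

text \<open>The choice depends only on the class of \<open>u\<close>. Hence \<open>rep T\<close> is
  a class invariant even when \<open>T\<close> contains several words of one class.\<close>

definition rep :: "'a list set \<Rightarrow> 'a list \<Rightarrow> 'a list" where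
  "rep T u = (SOME t. t \<in> T \<and> eqv u t)"

lemma rep:
  assumes "finite_index T" "u \<in> lists \<Sigma>"
  shows "rep T u \<in> T" "eqv u (rep T u)"
proof -
  have "\<exists>t. t \<in> T \<and> eqv u t" using assms by (auto simp: finite_index_def)
  then have "rep T u \<in> T \<and> eqv u (rep T u)" unfolding rep_def by (rule someI_ex)
  then show "rep T u \<in> T" "eqv u (rep T u)" by auto
qed

lemma rep_cong: "eqv u v \<Longrightarrow> rep T u = rep T v"
proof -
  assume "eqv u v"
  then have "eqv u t \<longleftrightarrow> eqv v t" for t by (metis eqv_sym eqv_trans)
  then show ?thesis by (simp add: rep_def)
qed

lemma rep_snoc:
  assumes "finite_index T" "u \<in> lists \<Sigma>" "a \<in> \<Sigma>"
  shows "rep T (rep T u @ [a]) = rep T (u @ [a])"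
proof (rule rep_cong)
  have "rep T u \<in> lists \<Sigma>" using rep[OF assms(1,2)] assms(1) by (auto simp: finite_index_def)
  then show "eqv (rep T u @ [a]) (u @ [a])"
    using assms rep[OF assms(1,2)] by (intro eqv_snoc eqv_sym[of u]) auto
qed

text \<open>If there were no such factors, the classes would satisfy all hypotheses of
  \<open>omega_regular_if_finite_congruence\<close>, with \<open>eqv_snoc\<close> providing the
  congruence, and \<open>L\<close> would be \<omega>-regular.\<close>

lemma ex_inseparable_factors:
  assumes L: "L \<subseteq> omega_words \<Sigma>" "\<not> omega_regular \<Sigma> L" and T: "finite_index T"
  shows "\<exists>u v. (\<forall>i. u i \<in> lists \<Sigma> \<and> u i \<noteq> [] \<and> v i \<in> lists \<Sigma> \<and> v i \<noteq> [] \<and> rep T (u i) = rep T (v i)) \<and>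
    omega_concat u \<in> L \<and> omega_concat v \<notin> L"
proof (rule ccontr)
  assume neg: "\<not> ?thesis"
  define cls where "cls u = to_nat_on T (rep T u)" for u
  have fin: "finite T" using T by (simp add: finite_index_def)
  have cls_eq: "cls u = cls v \<longleftrightarrow> rep T u = rep T v" if "u \<in> lists \<Sigma>" "v \<in> lists \<Sigma>" for u v
    using rep[OF T] that fin by (simp add: cls_def countable_finite to_nat_on_inj)
  have "omega_regular \<Sigma> L"
  proof (rule omega_regular_if_finite_congruence[OF L(1)])
    have "cls ` lists \<Sigma> \<subseteq> to_nat_on T ` T" using rep(1)[OF T] by (auto simp: cls_def)
    then show "finite (cls ` lists \<Sigma>)" using fin finite_surj by blast
  next
    fix u v a
    assume uv: "u \<in> lists \<Sigma>" "v \<in> lists \<Sigma>" "a \<in> \<Sigma>" "cls u = cls v"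
    then have "rep T (u @ [a]) = rep T (v @ [a])"
      using rep_snoc[OF T uv(1,3)] rep_snoc[OF T uv(2,3)] by (simp add: cls_eq)
    then show "cls (u @ [a]) = cls (v @ [a])" by (simp add: cls_def)
  next
    fix u v
    assume uv: "\<And>i. u i \<in> lists \<Sigma> \<and> u i \<noteq> []" "\<And>i. v i \<in> lists \<Sigma> \<and> v i \<noteq> []"
      "\<And>i. cls (u i) = cls (v i)" "omega_concat u \<in> L"
    have "rep T (u i) = rep T (v i)" for i using uv(1,2,3)[of i] cls_eq by blast
    then show "omega_concat v \<in> L" using neg uv by blast
  qed
  then show False using L(2) by simp
qed

text \<open>
  The letters \<open>a, b\<close> of two words are accompanied by the class representatives \<open>s, t\<close> of the factors
  read since the last block boundary, which have to agree whenever a block ends.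
\<close>

definition step_rel :: "'a list set \<Rightarrow> (bool \<times> bool) \<times> 'a \<times> 'a \<times> 'a list \<times> 'a list \<Rightarrow>
    (bool \<times> bool) \<times> 'a \<times> 'a \<times> 'a list \<times> 'a list \<Rightarrow> bool" where
  "step_rel T = (\<lambda>((Z, B), a, b, s, t) ((Z', B'), a', b', s', t').
     (a \<noteq> e \<longrightarrow> Z) \<and> (b \<noteq> e \<longrightarrow> Z) \<and> (B \<longrightarrow> s = rep T [] \<and> t = rep T []) \<and>
     (B' \<longrightarrow> rep T (s @ [a]) = rep T (t @ [b])) \<and>
     (\<not> B' \<longrightarrow> s' = rep T (s @ [a]) \<and> t' = rep T (t @ [b])))"

text \<open>A boundary at 0 and infinitely many boundaries guarantee that the blocks are finite and
  cover all positions.\<close>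

definition finite_index_test :: "'a list set \<Rightarrow> (bool \<times> bool) word \<Rightarrow> bool" where
  "finite_index_test T z \<longleftrightarrow> snd (z 0) \<and> infinite {n. snd (z n)} \<and>
     (\<exists>P\<in>omega_words (\<Sigma> \<times> \<Sigma> \<times> T \<times> T). (\<forall>n. step_rel T (z n, P n) (z (Suc n), P (Suc n))) \<and>
        (\<lambda>n. fst (P n)) \<in> L \<and> \<not> (\<lambda>n. fst (snd (P n))) \<in> L)"

lemma word_definable_finite_index_test:
  assumes "finite T"
  shows "word_definable UNIV (finite_index_test T)"
proof -
  have "word_definable (UNIV \<times> (\<Sigma> \<times> \<Sigma> \<times> T \<times> T)) (\<lambda>z.
      (\<forall>n. step_rel T (fst (z n), snd (z n)) (fst (z (Suc n)), snd (z (Suc n)))) \<and>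
      (\<lambda>n. fst (snd (z n))) \<in> L \<and> \<not> (\<lambda>n. fst (snd (snd (z n)))) \<in> L)"
    using assms finite_alphabet
    by (intro word_definable_conj word_definable_not word_definable_lang
        word_definable_local[where G = "\<lambda>c d. step_rel T (fst c, snd c) (fst d, snd d)"])
      (auto simp: finite_UNIV)
  then have "word_definable UNIV (\<lambda>z. \<exists>P\<in>omega_words (\<Sigma> \<times> \<Sigma> \<times> T \<times> T).
      (\<forall>n. step_rel T (z n, P n) (z (Suc n), P (Suc n))) \<and>
      (\<lambda>n. fst (P n)) \<in> L \<and> \<not> (\<lambda>n. fst (snd (P n))) \<in> L)"
    using assms finite_alphabet by (intro word_definable_ex) (simp_all add: finite_UNIV)
  then show ?thesis
    unfolding finite_index_test_def[abs_def]
    by (intro word_definable_conj word_definable_first word_definable_infinite) (simp_all add: finite_UNIV)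
qed

text \<open>The growth needed in block \<open>i\<close> is the room for both \<open>u i\<close> and
  \<open>v i\<close>. On bounded blocks, the two words guessed by the test contradict
  \<open>blockwise_eqv_bounded\<close>.\<close>

lemma unboundedness_test_finite_index:
  assumes L: "L \<subseteq> omega_words \<Sigma>" "\<not> omega_regular \<Sigma> L" and T: "finite_index T"
  shows "\<exists>f. unboundedness_test (finite_index_test T) f"
proof -
  obtain u v where uv: "\<forall>i. u i \<in> lists \<Sigma> \<and> u i \<noteq> [] \<and> v i \<in> lists \<Sigma> \<and> v i \<noteq> [] \<and> rep T (u i) = rep T (v i)"
    and L_uv: "omega_concat u \<in> L" "omega_concat v \<notin> L"
    using ex_inseparable_factors[OF assms] by (elim exE conjE)
  have set_uv: "set (u i) \<subseteq> \<Sigma>" "set (v i) \<subseteq> \<Sigma>" for i using uv by (auto simp: lists_eq_set)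
  have map_in: "map x xs \<in> lists \<Sigma>" if "x \<in> omega_words \<Sigma>" for x xs
    using omega_wordsD[OF that] by auto
  have fin: "finite T" using T by (simp add: finite_index_def)
  have "unboundedness_test (finite_index_test T) (\<lambda>i. max (length (u i)) (length (v i)))"
  proof (rule unboundedness_testI)
    show "word_definable UNIV (finite_index_test T)" by (rule word_definable_finite_index_test[OF fin])
  next
    fix z m
    assume test: "finite_index_test T z"
      and bound: "\<And>p q. p \<le> q \<Longrightarrow> (\<And>r. p < r \<Longrightarrow> r \<le> q \<Longrightarrow> \<not> snd (z r)) \<Longrightarrow>
        card {r. p \<le> r \<and> r \<le> q \<and> fst (z r)} \<le> m"
    then obtain P where P: "P \<in> omega_words (\<Sigma> \<times> \<Sigma> \<times> T \<times> T)"
      "\<And>n. step_rel T (z n, P n) (z (Suc n), P (Suc n))"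
      "(\<lambda>n. fst (P n)) \<in> L" "(\<lambda>n. fst (snd (P n))) \<notin> L"
      unfolding finite_index_test_def by blast
    define x where "x n = fst (P n)" for n
    define y where "y n = fst (snd (P n))" for n
    define s where "s n = fst (snd (snd (P n)))" for n
    define t where "t n = snd (snd (snd (P n)))" for n
    have xy: "x \<in> omega_words \<Sigma>" "y \<in> omega_words \<Sigma>"
      using omega_wordsD[OF P(1)] by (auto simp: omega_words_def x_def y_def mem_Times_iff)
    have step_P: "x n \<noteq> e \<longrightarrow> fst (z n)" "y n \<noteq> e \<longrightarrow> fst (z n)"
      "snd (z n) \<longrightarrow> s n = rep T [] \<and> t n = rep T []"
      "snd (z (Suc n)) \<longrightarrow> rep T (s n @ [x n]) = rep T (t n @ [y n])"
      "\<not> snd (z (Suc n)) \<longrightarrow> s (Suc n) = rep T (s n @ [x n]) \<and> t (Suc n) = rep T (t n @ [y n])" for n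
      using P(2)[of n] by (auto simp: step_rel_def x_def y_def s_def t_def split_beta)
    obtain g :: "nat \<Rightarrow> nat" where g: "strict_mono g" "g 0 = 0" "range g = {n. snd (z n)}"
      using ex_strict_mono_range[of "{n. snd (z n)}"] test by (auto simp: finite_index_test_def)
    have not_between: "\<not> snd (z n)" if "g i < n" "n < g (Suc i)" for i n
      using not_in_range_between[OF g(1) that] g(3) by auto
    have g_z: "snd (z (g i))" for i using g(3) by auto
    \<comment> \<open>By \<open>rep_snoc\<close>, appending a letter to the representative leads to
      the same class as appending it to the factor, so nothing is lost by storing only
      representatives.\<close>
    have mid: "s n = rep T (map x [g i..<n]) \<and> t n = rep T (map y [g i..<n])"
      if "g i \<le> n" "n < g (Suc i)" for i n
      using that
    proof (induction n rule: dec_induct)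
      case base
      then show ?case using step_P(3) g_z by simp
    next
      case (step n)
      have "rep T (rep T (map w [g i..<n]) @ [w n]) = rep T (map w [g i..<Suc n])"
        if "w \<in> omega_words \<Sigma>" for w
        using rep_snoc[OF T map_in[OF that] omega_wordsD[OF that]] step.hyps by simp
      then show ?case
        using step step_P(5)[of n] not_between[of i "Suc n"] xy by simp
    qed
    have gl: "g i < g (Suc i)" for i using g(1) by (simp add: strict_monoD)
    have "x \<in> L \<longleftrightarrow> y \<in> L"
    proof (rule blockwise_eqv_bounded[OF g(1,2) xy])
      fix i
      \<comment> \<open>\<open>n\<close> is the last position of the block. The comparison of the
        two completed blocks happens in the step from \<open>n\<close> to the boundary
        \<open>Suc n\<close>.\<close>
      obtain n where n: "g (Suc i) = Suc n" "g i \<le> n" using gl[of i] by (cases "g (Suc i)") auto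
      have snoc: "rep T (rep T (map w [g i..<n]) @ [w n]) = rep T (map w [g i..<g (Suc i)])"
        if "w \<in> omega_words \<Sigma>" for w
        using rep_snoc[OF T map_in[OF that] omega_wordsD[OF that]] n by simp
      have "rep T (s n @ [x n]) = rep T (t n @ [y n])" using step_P(4)[of n] g_z[of "Suc i"] n by simp
      then have "rep T (map x [g i..<g (Suc i)]) = rep T (map y [g i..<g (Suc i)])"
        using mid[of i n] n snoc xy by simp
      then show "eqv (map x [g i..<g (Suc i)]) (map y [g i..<g (Suc i)])"
        using rep(2)[OF T map_in[OF xy(1)]] rep(2)[OF T map_in[OF xy(2)]] eqv_sym eqv_trans by metis
      have "card {r. g i \<le> r \<and> r \<le> n \<and> fst (z r)} \<le> m"
        using n not_between[of i] by (intro bound) auto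
      moreover have "length (core (map w [g i..<g (Suc i)])) \<le> card {r. g i \<le> r \<and> r \<le> n \<and> fst (z r)}"
        if "\<And>n. w n \<noteq> e \<longrightarrow> fst (z n)" for w
        using that n by (intro length_core_le) auto
      ultimately show "length (core (map x [g i..<g (Suc i)])) \<le> m"
        "length (core (map y [g i..<g (Suc i)])) \<le> m"
        using step_P(1,2) le_trans by blast+
    qed
    then show False using P(3,4) by (simp add: x_def[abs_def] y_def[abs_def])
  next
    fix z and g :: "nat \<Rightarrow> nat"
    assume g: "strict_mono g" "g 0 = 0" and B: "\<And>n. snd (z n) \<longleftrightarrow> n \<in> range g"
      and room: "\<And>i. max (length (u i)) (length (v i)) \<le> card {n. g i \<le> n \<and> n < g (Suc i) \<and> fst (z n)}"
    have "\<exists>x\<in>omega_words \<Sigma>. (\<forall>n. x n \<noteq> e \<longrightarrow> fst (z n)) \<and>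
        (\<forall>i. core (map x [g i..<g (Suc i)]) = core (u i))"
      using room by (intro ex_block_placement[OF g set_uv(1)]) simp
    then obtain x where x: "x \<in> omega_words \<Sigma>" "\<forall>n. x n \<noteq> e \<longrightarrow> fst (z n)"
      "\<forall>i. core (map x [g i..<g (Suc i)]) = core (u i)" by blast
    have "\<exists>x\<in>omega_words \<Sigma>. (\<forall>n. x n \<noteq> e \<longrightarrow> fst (z n)) \<and>
        (\<forall>i. core (map x [g i..<g (Suc i)]) = core (v i))"
      using room by (intro ex_block_placement[OF g set_uv(2)]) simp
    then obtain y where y: "y \<in> omega_words \<Sigma>" "\<forall>n. y n \<noteq> e \<longrightarrow> fst (z n)"
      "\<forall>i. core (map y [g i..<g (Suc i)]) = core (v i)" by blast
    define k where "k n = block_of g n" for n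
    define P where "P n = (x n, y n, rep T (map x [g (k n)..<n]), rep T (map y [g (k n)..<n]))" for n
    have gl: "g i < g (Suc i)" for i using g(1) by (simp add: strict_monoD)
    have k_g: "k (g i) = i" for i unfolding k_def using gl by (intro block_of_eqI[OF g(1)]) auto
    have "P n \<in> \<Sigma> \<times> \<Sigma> \<times> T \<times> T" for n
      unfolding P_def using omega_wordsD x(1) y(1) rep(1)[OF T map_in] by blast
    then have "P \<in> omega_words (\<Sigma> \<times> \<Sigma> \<times> T \<times> T)" by (rule omega_wordsI)
    moreover have "step_rel T (z n, P n) (z (Suc n), P (Suc n))" for n
    proof -
      have le: "g (k n) \<le> n" "n < g (Suc (k n))" using g by (simp_all add: k_def block_of_le block_of_less)
      have snoc: "rep T (rep T (map w [g (k n)..<n]) @ [w n]) = rep T (map w [g (k n)..<Suc n])"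
        if "w \<in> omega_words \<Sigma>" for w
        using rep_snoc[OF T map_in[OF that] omega_wordsD[OF that]] le by simp
      have start: "g (k n) = n" if "snd (z n)" using that B k_g by auto
      have "rep T (map x [g (k n)..<Suc n]) = rep T (map y [g (k n)..<Suc n])" if "snd (z (Suc n))"
      proof -
        obtain j where j: "Suc n = g j" using B[of "Suc n"] \<open>snd (z (Suc n))\<close> by auto
        have "g (k n) < g j" "g j \<le> g (Suc (k n))" using j le by simp_all
        then have "j = Suc (k n)"
          using g(1) by (simp add: strict_mono_less strict_mono_less_eq)
        then have eq: "Suc n = g (Suc (k n))" using j by simp
        \<comment> \<open>A block is equivalent to the factor written on it because their cores
          agree. At the end of the block, the classes are thus those of \<open>u\<close> and
          \<open>v\<close>, which coincide.\<close>
        have "rep T (map w [g (k n)..<Suc n]) = rep T l"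
          if "w \<in> omega_words \<Sigma>" "core (map w [g (k n)..<g (Suc (k n))]) = core l" "l \<in> lists \<Sigma>" for w l
          unfolding eq using that omega_wordsD[OF that(1)]
          by (intro rep_cong eqv_core) (auto simp: lists_eq_set)
        then show ?thesis using x y uv by metis
      qed
      moreover have "k (Suc n) = k n" if "\<not> snd (z (Suc n))"
      proof -
        have "Suc n \<noteq> g (Suc (k n))" using B \<open>\<not> snd (z (Suc n))\<close> by auto
        then show ?thesis unfolding k_def using le
          by (intro block_of_eqI[OF g(1)]) (simp_all add: k_def)
      qed
      ultimately show ?thesis
        using start x(2) y(2) snoc[OF x(1)] snoc[OF y(1)]
        by (auto simp: step_rel_def P_def split_beta)
    qed
    moreover have "x \<in> L" "y \<notin> L"
      using word_core_cong[OF g x(1) set_uv(1)] word_core_cong[OF g y(1) set_uv(2)] x(3) y(3) uv L_uv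
      by simp_all
    moreover have "infinite {n. snd (z n)}"
      using B range_inj_infinite[OF strict_mono_imp_inj_on[OF g(1)]] by (simp add: Collect_mem_eq)
    moreover have "snd (z 0)" using B g(2) by (metis rangeI)
    ultimately show "finite_index_test T z"
      unfolding finite_index_test_def by (intro conjI bexI[of _ P]) (simp_all add: P_def)
  qed
  then show ?thesis by blast
qed

end

section \<open>Infinitely many classes\<close>

context neutral_language
begin

text \<open>
  \<open>G\<close> marks the beginnings of periods. \<open>N\<close> is an arbitrary union of periods, and the context \<open>x\<close> lives
  outside of it.
\<close>

definition interchangeable ::
  "'a word \<Rightarrow> 'a word \<Rightarrow> bool word \<Rightarrow> bool word \<Rightarrow> bool word \<Rightarrow> bool" where
  "interchangeable v w G V W \<longleftrightarrow> (\<forall>N\<in>omega_words UNIV. \<forall>x\<in>omega_words \<Sigma>.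
     (\<forall>n. (N n \<longrightarrow> x n = e) \<and> (\<not> G (Suc n) \<longrightarrow> (N n \<longleftrightarrow> N (Suc n)))) \<longrightarrow>
     ((\<lambda>n. if N n \<and> V n then v n else x n) \<in> L \<longleftrightarrow> (\<lambda>n. if N n \<and> W n then w n else x n) \<in> L))"

text \<open>
  In every period \<open>V\<close> is the first block of \<open>C\<close>, and \<open>W\<close> is contained in a single block of \<open>B\<close>: it is
  an initial part, free of later boundaries, of the final segment \<open>U\<close> of the period.
\<close>

definition selection ::
  "bool word \<Rightarrow> bool word \<Rightarrow> bool word \<Rightarrow> bool word \<Rightarrow> bool word \<Rightarrow> bool word \<Rightarrow> bool" where
  "selection B C G V U W \<longleftrightarrow> (\<forall>n.
     (G n \<longrightarrow> C n) \<and> (G n \<longrightarrow> V n) \<and> (\<not> G (Suc n) \<longrightarrow> (V (Suc n) \<longleftrightarrow> V n \<and> \<not> C (Suc n))) \<and>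
     (W n \<longrightarrow> U n) \<and> (\<not> G (Suc n) \<and> U n \<longrightarrow> U (Suc n)) \<and>
     (\<not> G (Suc n) \<and> U n \<and> W (Suc n) \<longrightarrow> W n \<and> \<not> B (Suc n)))"

text \<open>\<open>w\<close> is chosen before \<open>v\<close> and its cuts \<open>C\<close>; this
  order of quantifiers expresses universality. The periods \<open>G\<close> and the selections
  inside them may depend on \<open>v\<close> and \<open>C\<close>.\<close>

definition infinite_index_test :: "(bool \<times> bool) word \<Rightarrow> bool" where
  "infinite_index_test z \<longleftrightarrow> (\<exists>w\<in>omega_words \<Sigma>. (\<forall>n. w n \<noteq> e \<longrightarrow> fst (z n)) \<and>
     (\<forall>v\<in>omega_words \<Sigma>. \<forall>C\<in>omega_words UNIV. C 0 \<longrightarrow> infinite {n. C n} \<longrightarrow>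
       (\<exists>G\<in>omega_words UNIV. \<exists>V\<in>omega_words UNIV. \<exists>U\<in>omega_words UNIV. \<exists>W\<in>omega_words UNIV.
          G 0 \<and> infinite {n. G n} \<and> selection (\<lambda>n. snd (z n)) C G V U W \<and>
          interchangeable v w G V W)))"

lemma word_definable_infinite_index_test: "word_definable UNIV infinite_index_test"
proof -
  have fin: "finite (UNIV :: (bool \<times> bool) set)" "finite (UNIV :: bool set)" by simp_all
  note fins = finite_cartesian_product fin finite_alphabet
  \<comment> \<open>From the innermost to the outermost component, the letters carry
    \<open>z\<close>, \<open>w\<close>, \<open>v\<close>, \<open>C\<close>, \<open>G\<close>,
    \<open>V\<close>, \<open>U\<close> and \<open>W\<close>. Unfolding
    \<open>interchangeable\<close> adds \<open>N\<close> and \<open>x\<close> outside.\<close>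
  let ?\<Gamma> = "(((((((UNIV :: (bool \<times> bool) set) \<times> \<Sigma>) \<times> \<Sigma>) \<times> (UNIV :: bool set)) \<times> (UNIV :: bool set)) \<times>
    (UNIV :: bool set)) \<times> (UNIV :: bool set)) \<times> (UNIV :: bool set)"
  have sel: "word_definable ?\<Gamma> (\<lambda>y. selection (\<lambda>n. snd (fst (fst (fst (fst (fst (fst (fst (y n)))))))))
     (\<lambda>n. snd (fst (fst (fst (fst (y n)))))) (\<lambda>n. snd (fst (fst (fst (y n))))) (\<lambda>n. snd (fst (fst (y n))))
     (\<lambda>n. snd (fst (y n))) (\<lambda>n. snd (y n)))"
    unfolding selection_def
    by (rule word_definable_local[where G = "\<lambda>c d.
      (snd (fst (fst (fst c))) \<longrightarrow> snd (fst (fst (fst (fst c))))) \<and>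
      (snd (fst (fst (fst c))) \<longrightarrow> snd (fst (fst c))) \<and>
      (\<not> snd (fst (fst (fst d))) \<longrightarrow>
         (snd (fst (fst d)) \<longleftrightarrow> snd (fst (fst c)) \<and> \<not> snd (fst (fst (fst (fst d)))))) \<and>
      (snd c \<longrightarrow> snd (fst c)) \<and> (\<not> snd (fst (fst (fst d))) \<and> snd (fst c) \<longrightarrow> snd (fst d)) \<and>
      (\<not> snd (fst (fst (fst d))) \<and> snd (fst c) \<and> snd d \<longrightarrow>
         snd c \<and> \<not> snd (fst (fst (fst (fst (fst (fst (fst d)))))))) "])
      (intro fins)
  have int: "word_definable ?\<Gamma> (\<lambda>y. interchangeable
     (\<lambda>n. snd (fst (fst (fst (fst (fst (y n))))))) (\<lambda>n. snd (fst (fst (fst (fst (fst (fst (y n))))))))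
     (\<lambda>n. snd (fst (fst (fst (y n))))) (\<lambda>n. snd (fst (fst (y n)))) (\<lambda>n. snd (y n)))"
    unfolding interchangeable_def
  proof (intro word_definable_all word_definable_imp word_definable_iff fins)
    show "word_definable ((?\<Gamma> \<times> UNIV) \<times> \<Sigma>) (\<lambda>y. \<forall>n. (snd (fst (y n)) \<longrightarrow> snd (y n) = e) \<and>
        (\<not> snd (fst (fst (fst (fst (fst (y (Suc n))))))) \<longrightarrow> (snd (fst (y n)) \<longleftrightarrow> snd (fst (y (Suc n))))))"
      by (rule word_definable_local[where G = "\<lambda>c d. (snd (fst c) \<longrightarrow> snd c = e) \<and>
          (\<not> snd (fst (fst (fst (fst (fst d))))) \<longrightarrow> (snd (fst c) \<longleftrightarrow> snd (fst d)))"])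
        (intro fins)
    show "word_definable ((?\<Gamma> \<times> UNIV) \<times> \<Sigma>) (\<lambda>y. (\<lambda>n.
        if snd (fst (y n)) \<and> snd (fst (fst (fst (fst (y n)))))
        then snd (fst (fst (fst (fst (fst (fst (fst (y n)))))))) else snd (y n)) \<in> L)"
      by (rule word_definable_lang[where f = "\<lambda>c. if snd (fst c) \<and> snd (fst (fst (fst (fst c))))
        then snd (fst (fst (fst (fst (fst (fst (fst c))))))) else snd c"])
        (intro fins, auto)
    show "word_definable ((?\<Gamma> \<times> UNIV) \<times> \<Sigma>) (\<lambda>y. (\<lambda>n.
        if snd (fst (y n)) \<and> snd (fst (fst (y n)))
        then snd (fst (fst (fst (fst (fst (fst (fst (fst (y n))))))))) else snd (y n)) \<in> L)"
      by (rule word_definable_lang[where f = "\<lambda>c. if snd (fst c) \<and> snd (fst (fst c))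
        then snd (fst (fst (fst (fst (fst (fst (fst (fst c)))))))) else snd c"])
        (intro fins, auto)
  qed
  show ?thesis
    unfolding infinite_index_test_def[abs_def]
  proof (intro word_definable_ex word_definable_all word_definable_imp word_definable_conj fins sel int)
    show "word_definable ((UNIV :: (bool \<times> bool) set) \<times> \<Sigma>) (\<lambda>y. \<forall>n. snd (y n) \<noteq> e \<longrightarrow> fst (fst (y n)))"
      by (rule word_definable_local[where G = "\<lambda>c d. snd c \<noteq> e \<longrightarrow> fst (fst c)"]) (intro fins)
    show "word_definable ((((UNIV :: (bool \<times> bool) set) \<times> \<Sigma>) \<times> \<Sigma>) \<times> UNIV) (\<lambda>y. snd (y 0))"
      by (rule word_definable_first[where g = snd]) (intro fins)
    show "word_definable ((((UNIV :: (bool \<times> bool) set) \<times> \<Sigma>) \<times> \<Sigma>) \<times> UNIV) (\<lambda>y. infinite {n. snd (y n)})"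
      by (rule word_definable_infinite[where g = snd]) (intro fins)
    show "word_definable ?\<Gamma> (\<lambda>y. snd (fst (fst (fst (y 0)))))"
      by (rule word_definable_first[where g = "\<lambda>c. snd (fst (fst (fst c)))"]) (intro fins)
    show "word_definable ?\<Gamma> (\<lambda>y. infinite {n. snd (fst (fst (fst (y n))))})"
      by (rule word_definable_infinite[where g = "\<lambda>c. snd (fst (fst (fst c)))"]) (intro fins)
  qed
qed

text \<open>The periods numbered by \<open>\<kappa>\<close> carry the successive entries of the
  filled context. All other periods are neutral, so they can be attached to neighbouring factors
  without changing cores.\<close>

lemma context_placement:
  assumes g: "strict_mono g" "g 0 = 0" and \<kappa>: "strict_mono (\<kappa> :: nat \<Rightarrow> nat)"
    and F: "F \<in> omega_words \<Sigma>" and c: "c \<in> contexts" and t: "set t \<subseteq> \<Sigma>"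
    and outside: "\<And>n. block_of g n \<notin> range \<kappa> \<Longrightarrow> F n = e"
    and inside: "\<And>i. core (map F [g (\<kappa> i)..<g (Suc (\<kappa> i))]) =
      core (case c i of None \<Rightarrow> t @ [e] | Some a \<Rightarrow> [a])"
  shows "F \<in> L \<longleftrightarrow> fill c t \<in> L"
  unfolding fill_def
proof (rule word_core_cong[OF _ _ F])
  \<comment> \<open>The cuts are the starts of the selected periods, except that the first one must
    be 0. The neutral stretch before \<open>g (\<kappa> 0)\<close> thereby joins the first
    factor.\<close>
  define h where "h i = (if i = 0 then 0 else g (\<kappa> i))" for i :: nat
  have mono: "i < j \<Longrightarrow> g i < g j" "i \<le> j \<Longrightarrow> g i \<le> g j" for i j
    using g(1) by (simp_all add: strict_mono_less strict_mono_less_eq)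
  have \<kappa>_less: "\<kappa> i < \<kappa> (Suc i)" for i using \<kappa> by (simp add: strict_mono_less)
  have h_le: "h i \<le> g (\<kappa> i)" for i by (simp add: h_def)
  have le_h: "g (Suc (\<kappa> i)) \<le> h (Suc i)" for i
    using \<kappa>_less[of i] mono(2)[of "Suc (\<kappa> i)" "\<kappa> (Suc i)"] by (simp add: h_def)
  have period: "g (\<kappa> i) < g (Suc (\<kappa> i))" for i by (rule mono) simp
  show "strict_mono h"
    unfolding strict_mono_Suc_iff using h_le le_h period by (meson le_less_trans less_le_trans)
  show "h 0 = 0" by (simp add: h_def)
  show "set (case c i of None \<Rightarrow> t @ [e] | Some a \<Rightarrow> [a]) \<subseteq> \<Sigma>" for i
    using contexts_cases[OF c, of i] t by auto
  show "infinite {i. (case c i of None \<Rightarrow> t @ [e] | Some a \<Rightarrow> [a]) \<noteq> []}"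
    by (rule infinite_all) (simp split: option.split)
  fix i
  have "core (map F [h i..<h (Suc i)]) = core (map F [g (\<kappa> i)..<g (Suc (\<kappa> i))])"
  proof (rule core_map_outside[OF h_le less_imp_le[OF period] le_h])
    fix n assume n: "h i \<le> n" "n < h (Suc i)" "n < g (\<kappa> i) \<or> g (Suc (\<kappa> i)) \<le> n"
    define k where "k = block_of g n"
    have k: "g k \<le> n" "n < g (Suc k)" using g by (simp_all add: k_def block_of_le block_of_less)
    have "k \<noteq> \<kappa> j" for j
    proof
      assume kj: "k = \<kappa> j"
      have "g (\<kappa> j) < g (\<kappa> (Suc i))" using n(2) k(1) kj by (simp add: h_def)
      then have "j \<le> i" using g(1) \<kappa> by (simp add: strict_mono_less less_Suc_eq_le)
      moreover have "j \<noteq> i" using n(3) k kj by auto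
      ultimately have "j < i" by simp
      then have "Suc (\<kappa> j) \<le> \<kappa> i" "i \<noteq> 0" using \<kappa> by (simp_all add: strict_mono_less Suc_le_eq)
      then have "g (Suc (\<kappa> j)) \<le> h i" using mono(2) by (simp add: h_def)
      then show False using n(1) k(2) kj by simp
    qed
    then show "F n = e" using outside[of n] by (auto simp: k_def)
  qed
  then show "core (map F [h i..<h (Suc i)]) = core (case c i of None \<Rightarrow> t @ [e] | Some a \<Rightarrow> [a])"
    using inside by simp
qed

text \<open>
  Let \<open>v\<close> repeat a fixed word \<open>u\<close> that is inequivalent to all words of length at most \<open>m\<close>. Infinitely
  many of the selected factors of \<open>w\<close> are then one and the same word \<open>t\<close>, and placing a context that
  separates \<open>u\<close> from \<open>t\<close> into these periods contradicts interchangeability.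
\<close>

lemma infinite_index_test_sound:
  assumes inf: "\<And>T. \<not> finite_index T" and test: "infinite_index_test z"
    and bound: "\<And>p q. p \<le> q \<Longrightarrow> (\<And>r. p < r \<Longrightarrow> r \<le> q \<Longrightarrow> \<not> snd (z r)) \<Longrightarrow>
      card {r. p \<le> r \<and> r \<le> q \<and> fst (z r)} \<le> m"
  shows False
proof -
  define T where "T = {u. set u \<subseteq> \<Sigma> \<and> length u \<le> m}"
  have fin: "finite T" unfolding T_def by (rule finite_lists_length_le[OF finite_alphabet])
  \<comment> \<open>Otherwise the finitely many words of length at most \<open>m\<close> would
    represent all classes.\<close>
  have "\<not> (\<forall>u\<in>lists \<Sigma>. \<exists>t\<in>T. eqv u t)"
    using inf[of T] fin by (auto simp: finite_index_def T_def)
  then obtain u where u: "set u \<subseteq> \<Sigma>" "\<And>t. t \<in> T \<Longrightarrow> \<not> eqv u t"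
    by (auto simp: lists_eq_set)
  have "u \<noteq> []" using u(2)[of "[]"] by (auto simp: T_def eqv_def)
  define l where "l = length u"
  have l: "l > 0" using \<open>u \<noteq> []\<close> by (simp add: l_def)
  define v where "v n = u ! (n mod l)" for n
  define C where "C n \<longleftrightarrow> l dvd n" for n
  have v: "v \<in> omega_words \<Sigma>"
    using u(1) l by (intro omega_wordsI) (auto simp: v_def l_def)
  have "infinite {n. C n}"
    unfolding infinite_nat_iff_unbounded_le
  proof
    fix n show "\<exists>k\<ge>n. k \<in> {n. C n}" using l by (intro exI[of _ "l * n"]) (auto simp: C_def)
  qed
  obtain w where w: "w \<in> omega_words \<Sigma>" "\<forall>n. w n \<noteq> e \<longrightarrow> fst (z n)"
    and resp: "\<forall>v\<in>omega_words \<Sigma>. \<forall>C\<in>omega_words UNIV. C 0 \<longrightarrow> infinite {n. C n} \<longrightarrow>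
       (\<exists>G\<in>omega_words UNIV. \<exists>V\<in>omega_words UNIV. \<exists>U\<in>omega_words UNIV. \<exists>W\<in>omega_words UNIV.
          G 0 \<and> infinite {n. G n} \<and> selection (\<lambda>n. snd (z n)) C G V U W \<and>
          interchangeable v w G V W)"
    using test unfolding infinite_index_test_def by (elim bexE conjE)
  have "\<exists>G\<in>omega_words UNIV. \<exists>V\<in>omega_words UNIV. \<exists>U\<in>omega_words UNIV. \<exists>W\<in>omega_words UNIV.
          G 0 \<and> infinite {n. G n} \<and> selection (\<lambda>n. snd (z n)) C G V U W \<and>
          interchangeable v w G V W"
    by (rule resp[rule_format, OF v _ _ \<open>infinite {n. C n}\<close>]) (simp_all add: C_def omega_words_def)
  then obtain G V U W where G: "G 0" "infinite {n. G n}"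
    and sel: "selection (\<lambda>n. snd (z n)) C G V U W" and int: "interchangeable v w G V W"
    by (elim bexE conjE)
  have sel': "G n \<longrightarrow> C n" "G n \<longrightarrow> V n" "\<not> G (Suc n) \<longrightarrow> (V (Suc n) \<longleftrightarrow> V n \<and> \<not> C (Suc n))"
     "W n \<longrightarrow> U n" "\<not> G (Suc n) \<and> U n \<longrightarrow> U (Suc n)"
     "\<not> G (Suc n) \<and> U n \<and> W (Suc n) \<longrightarrow> W n \<and> \<not> snd (z (Suc n))" for n
    using sel[unfolded selection_def, THEN spec[of _ n]] by blast+
  obtain g :: "nat \<Rightarrow> nat" where g: "strict_mono g" "g 0 = 0" "range g = {n. G n}"
    using ex_strict_mono_range[of "{n. G n}"] G by auto
  have Gg: "G (g k)" for k using g(3) by auto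
  have not_G: "\<not> G n" if "g k < n" "n < g (Suc k)" for k n
    using not_in_range_between[OF g(1) that] g(3) by auto
  have gl: "g k < g (Suc k)" for k using g(1) by (simp add: strict_mono_less)
  have dvd: "l dvd g k" for k using sel'(1) Gg by (simp add: C_def)

  \<comment> \<open>Periods begin at multiples of \<open>l\<close>, and \<open>V\<close> runs from
    there up to the next multiple. So \<open>V\<close> marks exactly one copy of \<open>u\<close> in
    each period.\<close>
  have V: "V n \<longleftrightarrow> n < g k + l" if "g k \<le> n" "n < g (Suc k)" for n k
    using that
  proof (induction n rule: dec_induct)
    case base
    then show ?case using sel'(2) Gg l by simp
  next
    case (step n)
    have "V (Suc n) \<longleftrightarrow> V n \<and> \<not> C (Suc n)"
      using sel'(3)[of n] not_G[of k "Suc n"] step by simp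
    moreover have "C (Suc n) \<longleftrightarrow> l dvd (Suc n - g k)"
      using dvd_add_right_iff[OF dvd[of k], of "Suc n - g k"] step.hyps by (simp add: C_def)
    moreover have "l dvd (Suc n - g k) \<longleftrightarrow> Suc n = g k + l" if "n < g k + l"
      using that step.hyps l by (auto dest: dvd_imp_le)
    ultimately show ?case using step by auto
  qed
  have room: "g k + l \<le> g (Suc k)" for k
  proof -
    have "l dvd g (Suc k) - g k" using dvd by (simp add: dvd_diff_nat)
    then show ?thesis using gl[of k] dvd_imp_le[of l "g (Suc k) - g k"] by simp
  qed
  have v_block: "map v [g k..<g k + l] = u" for k
  proof (rule nth_equalityI)
    show "length (map v [g k..<g k + l]) = length u" by (simp add: l_def)
    fix i assume "i < length (map v [g k..<g k + l])"
    then have "i < l" by simp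
    then show "map v [g k..<g k + l] ! i = u ! i" using dvd[of k] by (auto simp: v_def elim: dvdE)
  qed

  define t where "t k = core (map (\<lambda>n. if W n then w n else e) [g k..<g (Suc k)])" for k
  have t_set: "set (t k) \<subseteq> \<Sigma>" for k
    using set_core omega_wordsD[OF w(1)] by (fastforce simp: t_def)
  have t_len: "length (t k) \<le> m" for k
  proof (cases "\<exists>n. g k \<le> n \<and> n < g (Suc k) \<and> W n")
    case False
    then have "t k = []" unfolding t_def core_Nil_iff by auto
    then show ?thesis by simp
  next
    case True
    define p where "p = (LEAST n. g k \<le> n \<and> W n)"
    obtain n0 where n0: "g k \<le> n0" "n0 < g (Suc k)" "W n0" using True by blast
    have p: "g k \<le> p" "W p" "p \<le> n0"
      using LeastI[of "\<lambda>n. g k \<le> n \<and> W n" n0] Least_le[of "\<lambda>n. g k \<le> n \<and> W n" n0] n0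
      by (auto simp: p_def)
    have before: "\<not> W n" if "g k \<le> n" "n < p" for n
      using not_less_Least[of n "\<lambda>n. g k \<le> n \<and> W n"] that by (auto simp: p_def)
    \<comment> \<open>From the first position of \<open>W\<close> in the period on, \<open>U\<close>
      persists. A later position in \<open>W\<close> then forces its predecessor into
      \<open>W\<close> and is not a boundary, so going back step by step no boundary lies in
      between.\<close>
    have run: "U n \<and> (W n \<longrightarrow> (\<forall>r. p < r \<and> r \<le> n \<longrightarrow> \<not> snd (z r)))" if "p \<le> n" "n < g (Suc k)" for n
      using that
    proof (induction n rule: dec_induct)
      case base
      then show ?case using p sel'(4) by auto
    next
      case (step n)
      have "\<not> G (Suc n)" using not_G[of k "Suc n"] step p by simp
      then show ?case using step sel'(5,6)[of n] by (auto simp: le_Suc_eq)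
    qed
    define q where "q = Max {n. g k \<le> n \<and> n < g (Suc k) \<and> W n}"
    have fin_W: "finite {n. g k \<le> n \<and> n < g (Suc k) \<and> W n}" by simp
    have q: "g k \<le> q" "q < g (Suc k)" "W q"
      using Max_in[OF fin_W] n0 unfolding q_def by blast+
    have after: "n \<le> q" if "g k \<le> n" "n < g (Suc k)" "W n" for n
      unfolding q_def using fin_W that by (intro Max_ge) auto
    have "p \<le> q" using before[of q] q by force
    have "length (t k) \<le> card {r. p \<le> r \<and> r \<le> q \<and> fst (z r)}"
      unfolding t_def
    proof (rule length_core_le)
      fix n assume n: "g k \<le> n" "n < g (Suc k)" "(if W n then w n else e) \<noteq> e"
      then have "W n" "w n \<noteq> e" by (auto split: if_splits)
      then show "n \<in> {r. p \<le> r \<and> r \<le> q \<and> fst (z r)}"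
        using before[of n] after[of n] n w(2) by force
    qed simp
    also have "\<dots> \<le> m"
      using run[OF \<open>p \<le> q\<close> q(2)] q(3) by (intro bound[OF \<open>p \<le> q\<close>]) auto
    finally show ?thesis .
  qed
  have "t k \<in> T" for k using t_set t_len by (simp add: T_def)
  then have "finite (t ` UNIV)" using fin finite_subset[of "range t" T] by blast
  then obtain k0 where K: "infinite {k \<in> UNIV. t k = t k0}"
    using pigeonhole_infinite[OF infinite_UNIV_nat, of t] by blast
  define \<kappa> where "\<kappa> = enumerate {k. t k = t k0}"
  have \<kappa>: "strict_mono \<kappa>" using K by (simp add: \<kappa>_def strict_mono_enumerate)
  have t_\<kappa>: "t (\<kappa> i) = t k0" for i
    using enumerate_in_set[of "{k. t k = t k0}" i] K by (simp add: \<kappa>_def)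
  have "\<not> eqv u (t k0)" using u(2) \<open>\<And>k. t k \<in> T\<close> by blast
  then obtain c where c: "c \<in> contexts" and diff: "\<not> (fill c u \<in> L \<longleftrightarrow> fill c (t k0) \<in> L)"
    unfolding eqv_def by blast

  define \<iota> where "\<iota> = inv \<kappa>"
  have \<iota>: "\<iota> (\<kappa> i) = i" for i
    unfolding \<iota>_def using strict_mono_imp_inj_on[OF \<kappa>] by (rule inv_f_f)
  \<comment> \<open>The separating context is spread over the periods with the recurring factor
    \<open>t k0\<close>: the \<open>i\<close>-th of them is opened for exchange if
    \<open>c i\<close> is a hole, and otherwise shows the letter of \<open>c i\<close> at its first
    position.\<close>
  define N where "N n \<longleftrightarrow> block_of g n \<in> range \<kappa> \<and> c (\<iota> (block_of g n)) = None" for n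
  define x where "x n = (if n = g (block_of g n) \<and> block_of g n \<in> range \<kappa>
      then (case c (\<iota> (block_of g n)) of None \<Rightarrow> e | Some a \<Rightarrow> a) else e)" for n
  have x: "x \<in> omega_words \<Sigma>"
  proof (rule omega_wordsI)
    fix n show "x n \<in> \<Sigma>" using contexts_cases[OF c, of "\<iota> (block_of g n)"] by (auto simp: x_def)
  qed
  have blk: "block_of g n = k" if "g k \<le> n" "n < g (Suc k)" for n k
    using that by (intro block_of_eqI[OF g(1)])
  have Nx: "(N n \<longrightarrow> x n = e) \<and> (\<not> G (Suc n) \<longrightarrow> (N n \<longleftrightarrow> N (Suc n)))" for n
  proof (intro conjI impI)
    assume "\<not> G (Suc n)"
    define k where "k = block_of g n"
    have k: "g k \<le> n" "n < g (Suc k)" using g by (simp_all add: k_def block_of_le block_of_less)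
    have "Suc n \<noteq> g (Suc k)" using \<open>\<not> G (Suc n)\<close> Gg by metis
    then have "block_of g (Suc n) = k" using k by (intro blk) simp_all
    then show "N n \<longleftrightarrow> N (Suc n)" by (simp add: N_def k_def)
  qed (auto simp: N_def x_def)
  have fill_iff: "(\<lambda>n. if N n \<and> Q n then y n else x n) \<in> L \<longleftrightarrow> fill c s \<in> L"
    if y: "y \<in> omega_words \<Sigma>" and s: "set s \<subseteq> \<Sigma>"
      and core_s: "\<And>i. core (map (\<lambda>n. if Q n then y n else e) [g (\<kappa> i)..<g (Suc (\<kappa> i))]) = core s"
    for Q y s
  proof (rule context_placement[OF g(1,2) \<kappa> _ c s])
    show "(\<lambda>n. if N n \<and> Q n then y n else x n) \<in> omega_words \<Sigma>"
      using omega_wordsD[OF x] omega_wordsD[OF y] by (intro omega_wordsI) simp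
    show "(if N n \<and> Q n then y n else x n) = e" if "block_of g n \<notin> range \<kappa>" for n
      using that by (simp add: N_def x_def)
    fix i
    show "core (map (\<lambda>n. if N n \<and> Q n then y n else x n) [g (\<kappa> i)..<g (Suc (\<kappa> i))]) =
        core (case c i of None \<Rightarrow> s @ [e] | Some a \<Rightarrow> [a])"
    proof (cases "c i")
      case None
      have "(if N n \<and> Q n then y n else x n) = (if Q n then y n else e)"
        if "g (\<kappa> i) \<le> n" "n < g (Suc (\<kappa> i))" for n
        using blk[OF that] None by (auto simp: N_def x_def \<iota>)
      then have "core (map (\<lambda>n. if N n \<and> Q n then y n else x n) [g (\<kappa> i)..<g (Suc (\<kappa> i))]) =
          core (map (\<lambda>n. if Q n then y n else e) [g (\<kappa> i)..<g (Suc (\<kappa> i))])"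
        by (rule core_map_cong)
      then show ?thesis using None core_s by simp
    next
      case (Some a)
      have "core (map (\<lambda>n. if N n \<and> Q n then y n else x n) [g (\<kappa> i)..<g (Suc (\<kappa> i))]) =
          core (map (\<lambda>n. if N n \<and> Q n then y n else x n) [g (\<kappa> i)..<Suc (g (\<kappa> i))])"
      proof (rule core_map_outside)
        fix n assume n: "g (\<kappa> i) \<le> n" "n < g (Suc (\<kappa> i))" "n < g (\<kappa> i) \<or> Suc (g (\<kappa> i)) \<le> n"
        then show "(if N n \<and> Q n then y n else x n) = e"
          using blk[OF n(1,2)] Some by (auto simp: N_def x_def \<iota>)
      qed (use gl[of "\<kappa> i"] in auto)
      also have "map (\<lambda>n. if N n \<and> Q n then y n else x n) [g (\<kappa> i)..<Suc (g (\<kappa> i))] = [a]"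
        using blk[OF order_refl gl[of "\<kappa> i"]] Some by (simp add: N_def x_def \<iota>)
      finally show ?thesis using Some by simp
    qed
  qed
  have "(\<lambda>n. if N n \<and> V n then v n else x n) \<in> L \<longleftrightarrow> (\<lambda>n. if N n \<and> W n then w n else x n) \<in> L"
    using int Nx x unfolding interchangeable_def by (simp add: omega_words_def)
  moreover have "(\<lambda>n. if N n \<and> V n then v n else x n) \<in> L \<longleftrightarrow> fill c u \<in> L"
  proof (rule fill_iff[OF v u(1)])
    fix i
    have "core (map (\<lambda>n. if V n then v n else e) [g (\<kappa> i)..<g (Suc (\<kappa> i))]) =
        core (map (\<lambda>n. if V n then v n else e) [g (\<kappa> i)..<g (\<kappa> i) + l])"
      by (rule core_map_outside) (use room[of "\<kappa> i"] V[of "\<kappa> i"] in auto)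
    also have "\<dots> = core (map v [g (\<kappa> i)..<g (\<kappa> i) + l])"
      by (rule core_map_cong) (use room[of "\<kappa> i"] V[of "\<kappa> i"] in auto)
    finally show "core (map (\<lambda>n. if V n then v n else e) [g (\<kappa> i)..<g (Suc (\<kappa> i))]) = core u"
      by (simp only: v_block)
  qed
  moreover have "(\<lambda>n. if N n \<and> W n then w n else x n) \<in> L \<longleftrightarrow> fill c (t k0) \<in> L"
  proof (rule fill_iff[OF w(1) t_set])
    fix i
    show "core (map (\<lambda>n. if W n then w n else e) [g (\<kappa> i)..<g (Suc (\<kappa> i))]) = core (t k0)"
      using t_\<kappa>[of i] by (simp flip: t_\<kappa>[of i] add: t_def)
  qed
  ultimately show False using diff by blast
qed

section \<open>Universal words on fast growing blocks\<close>

lemma ex_recurring_enumeration: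
  "\<exists>u :: nat \<Rightarrow> 'a list. (\<forall>i. set (u i) \<subseteq> \<Sigma>) \<and> (\<forall>l n. set l \<subseteq> \<Sigma> \<longrightarrow> (\<exists>j\<ge>n. u j = l))"
proof -
  have ne: "lists \<Sigma> \<noteq> {}" by (metis empty_iff lists.Nil)
  have cnt: "countable (lists \<Sigma>)" using finite_alphabet by (simp add: countable_finite)
  define u where "u i = from_nat_into (lists \<Sigma>) (fst (prod_decode i))" for i
  have "set (u i) \<subseteq> \<Sigma>" for i using from_nat_into[OF ne] by (auto simp: u_def lists_eq_set)
  moreover have "\<exists>j\<ge>n. u j = l" if "set l \<subseteq> \<Sigma>" for l n
  proof (intro exI conjI)
    show "n \<le> prod_encode (to_nat_on (lists \<Sigma>) l, n)" by (rule le_prod_encode_2)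
    show "u (prod_encode (to_nat_on (lists \<Sigma>) l, n)) = l"
      using from_nat_into_to_nat_on[OF cnt] that by (simp add: u_def lists_eq_set)
  qed
  ultimately show ?thesis by blast
qed

text \<open>Each period pairs the first factor of \<open>v\<close> in it with a later block of
  \<open>w\<close> on which the same word is written. Exchanging the two leaves the core of every
  period unchanged, whatever the context, so \<open>words_core_cong\<close> gives
  interchangeability.\<close>

lemma infinite_index_test_complete:
  assumes u: "\<And>i. set (u i) \<subseteq> \<Sigma>" and recurring: "\<And>l n. set l \<subseteq> \<Sigma> \<Longrightarrow> \<exists>j\<ge>n. u j = l"
    and b: "strict_mono b" "b 0 = 0" and B: "\<And>n. snd (z n) \<longleftrightarrow> n \<in> range b"
    and room: "\<And>i. length (u i) \<le> card {n. b i \<le> n \<and> n < b (Suc i) \<and> fst (z n)}"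
  shows "infinite_index_test z"
proof -
  have "\<exists>w\<in>omega_words \<Sigma>. (\<forall>n. w n \<noteq> e \<longrightarrow> fst (z n)) \<and> (\<forall>i. core (map w [b i..<b (Suc i)]) = core (u i))"
    using room by (intro ex_block_placement[OF b u])
  then obtain w where w: "w \<in> omega_words \<Sigma>" "\<forall>n. w n \<noteq> e \<longrightarrow> fst (z n)"
    "\<And>i. core (map w [b i..<b (Suc i)]) = core (u i)" by blast
  have "\<exists>G\<in>omega_words UNIV. \<exists>V\<in>omega_words UNIV. \<exists>U\<in>omega_words UNIV. \<exists>W\<in>omega_words UNIV.
      G 0 \<and> infinite {n. G n} \<and> selection (\<lambda>n. snd (z n)) C G V U W \<and> interchangeable v w G V W"
    if v: "v \<in> omega_words \<Sigma>" and C: "C 0" "infinite {n. C n}" for v C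
  proof -
    have next_C: "\<exists>c\<ge>n. C c" for n using C(2) by (auto simp: infinite_nat_iff_unbounded_le)
    \<comment> \<open>A triple consists of the start of a period, the index of the block used in it,
      and the end of the first factor. By \<open>?R\<close>, the next period starts only after both
      that factor and that block have ended.\<close>
    let ?I = "\<lambda>i (p :: nat \<times> nat \<times> nat). case p of (\<gamma>, j, c) \<Rightarrow> (i = (0 :: nat) \<longrightarrow> \<gamma> = 0) \<and> C \<gamma> \<and>
        \<gamma> < c \<and> C c \<and> (\<forall>n. \<gamma> < n \<and> n < c \<longrightarrow> \<not> C n) \<and> \<gamma> \<le> b j \<and> u j = map v [\<gamma>..<c]"
    let ?R = "\<lambda>(p :: nat \<times> nat \<times> nat) (p' :: nat \<times> nat \<times> nat). case p of (\<gamma>, j, c) \<Rightarrow>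
        c \<le> fst p' \<and> b (Suc j) \<le> fst p'"
    have start: "\<exists>j c. \<gamma> < c \<and> C c \<and> (\<forall>n. \<gamma> < n \<and> n < c \<longrightarrow> \<not> C n) \<and> \<gamma> \<le> b j \<and> u j = map v [\<gamma>..<c]"
      for \<gamma>
    proof -
      define c where "c = (LEAST n. \<gamma> < n \<and> C n)"
      obtain c0 where "Suc \<gamma> \<le> c0" "C c0" using next_C[of "Suc \<gamma>"] by blast
      then have c: "\<gamma> < c \<and> C c" unfolding c_def using LeastI[of "\<lambda>n. \<gamma> < n \<and> C n" c0] by simp
      have "\<forall>n. \<gamma> < n \<and> n < c \<longrightarrow> \<not> C n"
      proof (intro allI impI)
        show "\<not> C n" if "\<gamma> < n \<and> n < c" for n
          using not_less_Least[of n "\<lambda>n. \<gamma> < n \<and> C n"] that by (simp add: c_def)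
      qed
      \<comment> \<open>Since \<open>j \<le> b j\<close>, asking for an occurrence with index at
        least \<open>\<gamma>\<close> places the block after the start of the period.\<close>
      moreover obtain j where "\<gamma> \<le> j" "u j = map v [\<gamma>..<c]"
        using recurring[of "map v [\<gamma>..<c]" \<gamma>] omega_wordsD[OF v] by auto
      moreover have "j \<le> b j" using b(1) by (rule strict_mono_imp_increasing)
      ultimately show ?thesis using c by (intro exI[of _ j] exI[of _ c]) simp
    qed
    have "\<exists>h. \<forall>i. ?I i (h i) \<and> ?R (h i) (h (Suc i))"
    proof (rule dependent_nat_choice)
      show "\<exists>p. ?I 0 p" using start[of 0] C(1) by auto
      fix p i assume "?I i p"
      obtain \<gamma> j c where p: "p = (\<gamma>, j, c)" by (cases p)
      obtain \<gamma>' where \<gamma>': "max c (b (Suc j)) \<le> \<gamma>'" "C \<gamma>'"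
        using next_C[of "max c (b (Suc j))"] by blast
      obtain j' c' where "?I (Suc i) (\<gamma>', j', c')" using start[of \<gamma>'] \<gamma>'(2) by auto
      then show "\<exists>p'. ?I (Suc i) p' \<and> ?R p p'" using \<gamma>'(1) p by (intro exI[of _ "(\<gamma>', j', c')"]) simp
    qed
    then obtain h where h: "\<forall>i. ?I i (h i) \<and> ?R (h i) (h (Suc i))" by (rule exE)
    define g where "g i = fst (h i)" for i
    define j where "j i = fst (snd (h i))" for i
    define c where "c i = snd (snd (h i))" for i
    have H: "(i = 0 \<longrightarrow> g i = 0) \<and> C (g i) \<and> g i < c i \<and> C (c i) \<and> (\<forall>n. g i < n \<and> n < c i \<longrightarrow> \<not> C n) \<and>
        g i \<le> b (j i) \<and> u (j i) = map v [g i..<c i] \<and> c i \<le> g (Suc i) \<and> b (Suc (j i)) \<le> g (Suc i)" for i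
      using h[THEN spec[of _ i]] by (simp add: g_def j_def c_def split_beta)
    have g: "strict_mono g" "g 0 = 0"
      unfolding strict_mono_Suc_iff using H[of 0] H less_le_trans by blast+
    define k where "k n = block_of g n" for n
    have k: "g (k n) \<le> n" "n < g (Suc (k n))" for n
      using g by (simp_all add: k_def block_of_le block_of_less)
    have k_eq: "k n = i" if "g i \<le> n" "n < g (Suc i)" for n i
      unfolding k_def using that by (rule block_of_eqI[OF g(1)])
    have gl: "g i < g (Suc i)" for i using g(1) by (simp add: strict_mono_less)
    have bl: "b i < b (Suc i)" for i using b(1) by (simp add: strict_mono_less)
    define G where "G n \<longleftrightarrow> n \<in> range g" for n
    define V where "V n \<longleftrightarrow> n < c (k n)" for n
    define U where "U n \<longleftrightarrow> b (j (k n)) \<le> n" for n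
    define W where "W n \<longleftrightarrow> b (j (k n)) \<le> n \<and> n < b (Suc (j (k n)))" for n
    have same: "k (Suc n) = k n" if "\<not> G (Suc n)" for n
    proof (rule k_eq)
      show "g (k n) \<le> Suc n" using k(1)[of n] by simp
      show "Suc n < g (Suc (k n))"
        using k(2)[of n] that by (metis G_def Suc_leI le_neq_implies_less rangeI)
    qed
    have "selection (\<lambda>n. snd (z n)) C G V U W"
      unfolding selection_def
    proof (intro allI conjI impI)
      fix n
      show "C n" if "G n" using that H by (auto simp: G_def)
      show "V n" if "G n"
      proof -
        obtain i where "n = g i" using \<open>G n\<close> by (auto simp: G_def)
        then show ?thesis using k_eq[of i n] gl[of i] H[of i] by (simp add: V_def)
      qed
      show "V (Suc n) \<longleftrightarrow> V n \<and> \<not> C (Suc n)" if "\<not> G (Suc n)"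
      proof -
        have "\<not> C (Suc n)" if "Suc n < c (k n)" using H[of "k n"] k(1)[of n] that by simp
        moreover have "Suc n < c (k n)" if "n < c (k n)" "\<not> C (Suc n)"
          using that H[of "k n"] by (cases "Suc n = c (k n)") auto
        ultimately show ?thesis unfolding V_def same[OF that] by auto
      qed
      show "U n" if "W n" using that by (simp add: U_def W_def)
      show "U (Suc n)" if "\<not> G (Suc n) \<and> U n" using that same by (simp add: U_def)
      show "W n" "\<not> snd (z (Suc n))" if *: "\<not> G (Suc n) \<and> U n \<and> W (Suc n)"
      proof -
        have "b (j (k n)) \<le> n" "Suc n < b (Suc (j (k n)))"
          using * same[of n] unfolding U_def W_def by auto
        then show "W n" "\<not> snd (z (Suc n))"
          using not_in_range_between[OF b(1), of "j (k n)" "Suc n"] B by (simp_all add: W_def)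
      qed
    qed
    moreover have "interchangeable v w G V W"
      unfolding interchangeable_def
    proof (intro ballI impI)
      fix N x
      assume x: "x \<in> omega_words \<Sigma>"
        and Nx: "\<forall>n. (N n \<longrightarrow> x n = e) \<and> (\<not> G (Suc n) \<longrightarrow> (N n \<longleftrightarrow> N (Suc n)))"
      let ?F = "\<lambda>Q y n. if N n \<and> Q n then y n else x n"
      have F: "?F Q y \<in> omega_words \<Sigma>" if "y \<in> omega_words \<Sigma>" for Q y
        using omega_wordsD[OF x] omega_wordsD[OF that] by (intro omega_wordsI) simp
      have N: "N n \<longleftrightarrow> N (g i)" if "g i \<le> n" "n < g (Suc i)" for n i
      proof (rule constant_on_block[OF _ g(1) that])
        fix n assume "n \<notin> range g" "n > 0"
        then show "N (n - 1) \<longleftrightarrow> N n" using Nx[THEN spec[of _ "n - 1"]] by (simp add: G_def)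
      qed
      have blocks: "core (map (?F V v) [g i..<g (Suc i)]) = core (map (?F W w) [g i..<g (Suc i)])" for i
      proof (cases "N (g i)")
        case False
        then show ?thesis using N by (intro core_map_cong) auto
      next
        case True
        have Hi: "g i < c i" "c i \<le> g (Suc i)" "g i \<le> b (j i)" "b (Suc (j i)) \<le> g (Suc i)"
            "u (j i) = map v [g i..<c i]"
          using H[of i] by simp_all
        have Fv: "?F V v n = (if n < c i then v n else e)"
          and Fw: "?F W w n = (if b (j i) \<le> n \<and> n < b (Suc (j i)) then w n else e)"
          if "g i \<le> n" "n < g (Suc i)" for n
          using N[OF that] True Nx[THEN spec[of _ n]] k_eq[OF that] by (simp_all add: V_def W_def)
        have "core (map (?F V v) [g i..<g (Suc i)]) = core (map (?F V v) [g i..<c i])"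
          by (rule core_map_outside) (use Hi Fv in auto)
        also have "\<dots> = core (map v [g i..<c i])"
          by (rule core_map_cong) (use Hi Fv in simp)
        also have "\<dots> = core (map w [b (j i)..<b (Suc (j i))])" using Hi(5) w(3)[of "j i"] by simp
        also have "\<dots> = core (map (?F W w) [b (j i)..<b (Suc (j i))])"
          by (rule core_map_cong) (use Hi Fw in simp)
        also have "\<dots> = core (map (?F W w) [g i..<g (Suc i)])"
          by (rule core_map_outside[symmetric]) (use Hi Fw bl[of "j i"] in auto)
        finally show ?thesis .
      qed
      show "?F V v \<in> L \<longleftrightarrow> ?F W w \<in> L"
        by (rule words_core_cong[OF g F[OF v] F[OF w(1)] blocks])
    qed
    moreover have "infinite {n. G n}"
      using range_inj_infinite[OF strict_mono_imp_inj_on[OF g(1)]] by (simp add: G_def[abs_def] Collect_mem_eq)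
    moreover have "G 0" unfolding G_def using g(2) by (metis rangeI)
    ultimately show ?thesis by (auto simp: omega_words_def)
  qed
  then show ?thesis
    unfolding infinite_index_test_def using w(1,2) by (intro bexI[of _ w] conjI ballI impI) simp_all
qed

lemma unboundedness_test_infinite_index:
  assumes "\<And>T. \<not> finite_index T"
  shows "\<exists>f. unboundedness_test infinite_index_test f"
proof -
  obtain u :: "nat \<Rightarrow> 'a list" where u: "\<forall>i. set (u i) \<subseteq> \<Sigma>"
    "\<forall>l n. set l \<subseteq> \<Sigma> \<longrightarrow> (\<exists>j\<ge>n. u j = l)"
    using ex_recurring_enumeration by (elim exE conjE)
  have "unboundedness_test infinite_index_test (\<lambda>i. length (u i))"
  proof (rule unboundedness_testI[OF word_definable_infinite_index_test])
    show False if "infinite_index_test z" "\<And>p q. p \<le> q \<Longrightarrow> (\<And>r. p < r \<Longrightarrow> r \<le> q \<Longrightarrow> \<not> snd (z r)) \<Longrightarrow>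
        card {r. p \<le> r \<and> r \<le> q \<and> fst (z r)} \<le> m" for z m
      using assms that by (rule infinite_index_test_sound)
    show "infinite_index_test z" if "strict_mono g" "g 0 = 0" "\<And>n. snd (z n) \<longleftrightarrow> n \<in> range g"
      "\<And>i. length (u i) \<le> card {n. g i \<le> n \<and> n < g (Suc i) \<and> fst (z n)}" for z g
      using u that by (intro infinite_index_test_complete[of u g z]) simp_all
  qed
  then show ?thesis by blast
qed

end

section \<open>Conclusion by cases on the number of classes\<close>

theorem corollary4p3:
  fixes \<Sigma> :: "'a set" and L :: "'a word set"
    and \<Gamma> :: "'c set" and K :: "'c word set"
  assumes "finite \<Sigma>" and "L \<subseteq> omega_words \<Sigma>"
    and "\<not> omega_regular \<Sigma> L"
    and "has_neutral_letter \<Sigma> L"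
    and "finite \<Gamma>" and "K \<subseteq> omega_words \<Gamma>"
    and "MSO_U_definable \<Gamma> K"
  shows "MSO_L_definable \<Sigma> L \<Gamma> K"
proof -
  obtain e where "is_neutral_letter \<Sigma> L e"
    using assms(4) unfolding has_neutral_letter_def by blast
  then interpret neutral_language \<Sigma> L e
    using assms(1) by unfold_locales
  have "\<exists>\<psi> f. unboundedness_test \<psi> f"
  proof (cases "\<exists>T. finite_index T")
    case True
    then show ?thesis using unboundedness_test_finite_index[OF assms(2,3)] by blast
  next
    case False
    then show ?thesis using unboundedness_test_infinite_index by blast
  qed
  then show ?thesis using MSO_L_definable_if_unboundedness_test assms(7) by blast
qed

end
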